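(* Let $k\ge 0$ be a fixed real number, let $A$ be the self-adjoint (Friedrichs) Legendre operator in $L^2(-1,1)$ (defined in the context), let $n\in\mathbb{N}$, and let $\mathcal{D}(A^n)$ be the domain of its $n$-th power, which is given by $$\mathcal{D}(A^n)=\{f:(-1,1)\to\mathbb{C}\mid f\in AC_{\mathrm{loc}}^{(2n-1)}(-1,1);\ (1-t^2)^n f^{(2n)}\in L^2(-1,1)\}.$$ Then: (i) if $f\in\mathcal{D}(A^n)$, then $f^{(n)}\in L^2(-1,1)$; (ii) if $f\in\mathcal{D}(A^n)$, then $f,f',\ldots,f^{(n-1)}\in AC[-1,1]$ (after appropriately defining these functions at the endpoints $t=\pm1$); (iii) the implication in (i) is best possible in the sense that there exists $g\in\mathcal{D}(A^n)$ such that $g^{(n+1)}\notin L^2(-1,1)$.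
   Context: $\mathbb{N}$ denotes the positive integers. $L^2(-1,1)$ is the space of complex-valued Lebesgue square-integrable functions on $(-1,1)$. $AC_{\mathrm{loc}}(-1,1)$ is the set of functions $f:(-1,1)\to\mathbb{C}$ that are absolutely continuous on every compact subinterval of $(-1,1)$; for an integer $m\ge 0$, $AC_{\mathrm{loc}}^{(m)}(-1,1)$ is the set of $f:(-1,1)\to\mathbb{C}$ such that $f,f',\ldots,f^{(m)}$ all belong to $AC_{\mathrm{loc}}(-1,1)$ (so $f^{(m+1)}$ exists a.e.). $AC[-1,1]$ is the set of absolutely continuous functions on $[-1,1]$; a function on $(-1,1)$ is said to be in $AC[-1,1]$ if it becomes so after being suitably defined at $\pm1$. For fixed $k\ge0$, the Legendre expression is $\ell[y](t)=-\big((1-t^2)y'(t)\big)'+ky(t)$ for $t\in(-1,1)$. The Legendre operator $A$ in $L^2(-1,1)$ is defined by $Af=\ell[f]$ with domain $$\mathcal{D}(A)=\{f:(-1,1)\to\mathbb{C}\mid f,f'\in AC_{\mathrm{loc}}(-1,1);\ f,\ell[f]\in L^2(-1,1);\ \lim_{t\to\pm1}(1-t^2)f'(t)=0\}.$$ It is self-adjoint (it is the Friedrichs extension of the minimal operator generated by $\ell$). $A^n$ is the usual $n$-fold composition: $\mathcal{D}(A^1)=\mathcal{D}(A)$ and $\mathcal{D}(A^{n})=\{f\in\mathcal{D}(A^{n-1})\mid A^{n-1}f\in\mathcal{D}(A)\}$ for $n\ge2$. *)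

theory Defs
  imports "HOL-Analysis.Analysis"
begin

text \<open>
  A function on the open interval from -1 to 1 is represented by a total function on the reals.
  Apart from the values of a continuation in the absolute continuity on the closed interval, only
  the values on the open interval matter: every notion below is insensitive to the values outside.
\<close>

abbreviation I11 :: "real set" where
  "I11 \<equiv> {-1<..<1}"

text \<open>Members of \<open>L2\<close> are functions, not equivalence classes. The Lebesgue (completed) measure is
  used, so membership does not depend on the values on a null set.\<close>

definition L2 :: "(real \<Rightarrow> complex) set" where
  "L2 = {f. f \<in> borel_measurable (lebesgue_on I11) \<and>
            integrable (lebesgue_on I11) (\<lambda>t. (cmod (f t))\<^sup>2)}"

text \<open>A pair \<open>(a, b)\<close> in the finite set \<open>D\<close> stands for an interval with endpoints \<open>a\<close> and \<open>b\<close>;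
  the intervals are non-overlapping.\<close>

definition abs_continuous_on :: "real set \<Rightarrow> (real \<Rightarrow> complex) \<Rightarrow> bool" where
  "abs_continuous_on S f \<longleftrightarrow>
     (\<forall>\<epsilon>>0. \<exists>\<delta>>0. \<forall>D :: (real \<times> real) set.
        finite D \<and> (\<forall>(a, b)\<in>D. a \<le> b \<and> {a..b} \<subseteq> S) \<and>
        pairwise (\<lambda>(a, b) (c, d). disjnt {a<..<b} {c<..<d}) D \<and>
        (\<Sum>(a, b)\<in>D. b - a) < \<delta>
        \<longrightarrow> (\<Sum>(a, b)\<in>D. cmod (f b - f a)) < \<epsilon>)"

definition AC_loc :: "(real \<Rightarrow> complex) set" where
  "AC_loc = {f. \<forall>a b. -1 < a \<and> a \<le> b \<and> b < 1 \<longrightarrow> abs_continuous_on {a..b} f}"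

text \<open>The \<open>j\<close>-th derivative. Where a derivative does not exist, \<open>vector_derivative\<close> has an
  unspecified value; existence is therefore demanded separately in \<open>AC_loc_order\<close>.\<close>

definition nderiv :: "nat \<Rightarrow> (real \<Rightarrow> complex) \<Rightarrow> real \<Rightarrow> complex" where
  "nderiv j f = ((\<lambda>g t. vector_derivative g (at t)) ^^ j) f"

definition AC_loc_order :: "nat \<Rightarrow> (real \<Rightarrow> complex) set" where
  "AC_loc_order m =
     {f. (\<forall>j<m. \<forall>t\<in>I11. nderiv j f differentiable (at t)) \<and> (\<forall>j\<le>m. nderiv j f \<in> AC_loc)}"

text \<open>For a function on the open interval: it extends to an absolutely continuous function on the
  closed interval.\<close>

definition AC_closed :: "(real \<Rightarrow> complex) set" where
  "AC_closed = {f. \<exists>F. abs_continuous_on {-1..1} F \<and> (\<forall>t\<in>I11. F t = f t)}"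

definition legendre_expr :: "real \<Rightarrow> (real \<Rightarrow> complex) \<Rightarrow> real \<Rightarrow> complex" where
  "legendre_expr k y t =
     - vector_derivative (\<lambda>s. (1 - s\<^sup>2) *\<^sub>R nderiv 1 y s) (at t) + k *\<^sub>R y t"

definition legendre_dom :: "real \<Rightarrow> (real \<Rightarrow> complex) set" where
  "legendre_dom k =
     {f. f \<in> AC_loc_order 1 \<and> f \<in> L2 \<and> legendre_expr k f \<in> L2 \<and>
         ((\<lambda>t. (1 - t\<^sup>2) *\<^sub>R nderiv 1 f t) \<longlongrightarrow> 0) (at_right (-1)) \<and>
         ((\<lambda>t. (1 - t\<^sup>2) *\<^sub>R nderiv 1 f t) \<longlongrightarrow> 0) (at_left 1)}"

text \<open>The graph of the Legendre operator. The expression of \<open>f\<close> is determined only almost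
  everywhere, so the second component ranges over all representatives of its class. The graph of the
  \<open>n\<close>-th power is the \<open>n\<close>-fold relational composition: an intermediate value \<open>A\<^sup>j f\<close> belongs to the
  domain iff one of its representatives does.\<close>

definition legendre_op :: "real \<Rightarrow> ((real \<Rightarrow> complex) \<times> (real \<Rightarrow> complex)) set" where
  "legendre_op k =
     {(f, g). f \<in> legendre_dom k \<and> g \<in> L2 \<and>
              (AE t in lebesgue_on I11. g t = legendre_expr k f t)}"

definition legendre_power_dom :: "real \<Rightarrow> nat \<Rightarrow> (real \<Rightarrow> complex) set" where
  "legendre_power_dom k n = Domain (legendre_op k ^^ n)"

end

theory Submission
  imports Defs
begin

text \<open>
  Write \<open>p = 1 - t\<^sup>2\<close> and \<open>f\<^sub>j\<close> for the \<open>j\<close>-th derivative of \<open>f\<close>. Differentiating the flux \<open>p f\<^sub>1\<close> repeatedly gives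
  \<open>(p f\<^sub>1)\<^bsup>(j+1)\<^esup> = p f\<^bsub>j+2\<^esub> - 2 (j + 1) t f\<^bsub>j+1\<^esub> - j (j + 1) f\<^sub>j\<close>,
  which is the same as \<open>(p\<^bsup>j+1\<^esup> f\<^bsub>j+1\<^esub>)' = p\<^sup>j ((p f\<^sub>1)\<^bsup>(j+1)\<^esup> + j (j + 1) f\<^sub>j)\<close>.
  Everything follows from this identity and two weighted Hardy inequalities.

  The first one, \<open>Hardy_lower_weight\<close>, says that \<open>p\<^bsup>m+1\<^esup> g' \<in> L2\<close> forces \<open>p\<^sup>m g \<in> L2\<close>. Starting from
  \<open>p\<^sup>n f\<^bsub>2n\<^esub> \<in> L2\<close> one descends through \<open>p\<^bsup>n-1\<^esup> f\<^bsub>2n-1\<^esub>, \<dots>, f\<^sub>n\<close> and on to \<open>f\<^sub>0\<close>, all of them in \<open>L2\<close>. This is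
  (i), and (ii) follows because \<open>f\<^sub>0, \<dots>, f\<^bsub>n-1\<^esub>\<close> then have integrable derivatives.

  The second one, \<open>Hardy_divide_weight\<close>, says that if \<open>v' = p\<^sup>n u\<close> with \<open>u \<in> L2\<close> and \<open>v\<close> vanishes at both
  endpoints, then \<open>p\<^bsup>-(n+1)\<^esup> v \<in> L2\<close>. Both inequalities come from integrating the derivative of
  \<open>t p\<^sup>k |g|\<^sup>2\<close> over \<open>[-r, r]\<close>: the factor \<open>t\<close> treats the two endpoints at the same time.

  The description of the domain is an induction on \<open>n\<close>. If \<open>p\<^bsup>n+1\<^esup> f\<^bsub>2n+2\<^esub> \<in> L2\<close>, the descent controls every
  term of the \<open>2n\<close>-th derivative of the Legendre expression. Conversely let \<open>f\<close> and its image \<open>g\<close>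
  both lie in the space for \<open>n\<close>. The equation expresses \<open>f\<^bsub>j+2\<^esub>\<close> through lower derivatives and
  \<open>g\<^sub>j\<close>, which gives the regularity of \<open>f\<close>; for \<open>j = 2n - 1\<close> it also gives the weak bound
  \<open>p\<^bsup>n+1\<^esup> f\<^bsub>2n+1\<^esub> \<in> L2\<close>. So \<open>v = p\<^bsup>2n+1\<^esup> f\<^bsub>2n+1\<^esub>\<close> satisfies \<open>v / p \<in> L2\<close>, and since \<open>1 / p\<close> is not square
  integrable at the endpoints, \<open>v\<close> vanishes there (\<open>limits_zero_at_endpoints\<close>). By the identity with
  \<open>j = 2n\<close>, \<open>v'\<close> is \<open>p\<^sup>n\<close> times an \<open>L2\<close> function, and the second Hardy inequality improves the
  bound to \<open>p\<^sup>n f\<^bsub>2n+1\<^esub> \<in> L2\<close>; the equation then yields \<open>p\<^bsup>n+1\<^esup> f\<^bsub>2n+2\<^esub> \<in> L2\<close>. For the first power the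
  vanishing of \<open>v = p f\<^sub>1\<close> is the boundary condition of the operator.

  For (iii) the function \<open>(1 - t)\<close> to the power \<open>n + 1/4\<close> is a witness.

  All integrations by parts concern absolutely continuous functions in the sense of the
  \<open>\<epsilon>\<close>-\<open>\<delta>\<close> definition. The first half therefore proves that such a function is differentiable
  almost everywhere and is the integral of its derivative. The real and imaginary parts become
  increasing after adding the total variation, an increasing absolutely continuous function defines
  a measure that has a density by the Radon-Nikodym theorem, and the indefinite integral of the
  density is differentiable almost everywhere.
\<close>

section \<open>Families of non-overlapping intervals\<close>

definition interval_family :: "real set \<Rightarrow> (real \<times> real) set \<Rightarrow> bool" where
  "interval_family S D \<longleftrightarrow> finite D \<and> (\<forall>(a, b)\<in>D. a \<le> b \<and> {a..b} \<subseteq> S) \<and>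
     pairwise (\<lambda>(a, b) (c, d). disjnt {a<..<b} {c<..<d}) D"

lemma abs_continuous_on_interval_family:
  "abs_continuous_on S f \<longleftrightarrow> (\<forall>\<epsilon>>0. \<exists>\<delta>>0. \<forall>D. interval_family S D \<and>
     (\<Sum>(a, b)\<in>D. b - a) < \<delta> \<longrightarrow> (\<Sum>(a, b)\<in>D. cmod (f b - f a)) < \<epsilon>)"
  unfolding abs_continuous_on_def interval_family_def by (simp add: conj_assoc)

lemma abs_continuous_onD:
  assumes "abs_continuous_on S f" "\<epsilon> > 0"
  obtains \<delta> where "\<delta> > 0" "\<And>D. \<lbrakk>interval_family S D; (\<Sum>(a, b)\<in>D. b - a) < \<delta>\<rbrakk> \<Longrightarrow> (\<Sum>(a, b)\<in>D. cmod (f b - f a)) < \<epsilon>"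
  using assms unfolding abs_continuous_on_interval_family by meson

lemma interval_family_finite: "interval_family S D \<Longrightarrow> finite D"
  by (simp add: interval_family_def)

lemma interval_familyD:
  assumes "interval_family S D" "(c, d) \<in> D"
  shows "c \<le> d" "c \<in> S" "d \<in> S" "{c..d} \<subseteq> S"
  using assms unfolding interval_family_def by fastforce+

lemma interval_family_disjoint:
  assumes "interval_family S D" "(c, d) \<in> D" "(c', d') \<in> D" "(c, d) \<noteq> (c', d')"
  shows "{c<..<d} \<inter> {c'<..<d'} = {}"
  using assms unfolding interval_family_def pairwise_def disjnt_def by fast

lemma interval_familyI:
  assumes "finite D" "\<And>c d. (c, d) \<in> D \<Longrightarrow> c \<le> d \<and> {c..d} \<subseteq> S"
    "\<And>c d c' d'. (c, d) \<in> D \<Longrightarrow> (c', d') \<in> D \<Longrightarrow> (c, d) \<noteq> (c', d') \<Longrightarrow> {c<..<d} \<inter> {c'<..<d'} = {}"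
  shows "interval_family S D"
  using assms unfolding interval_family_def pairwise_def disjnt_def by fast

lemma interval_family_mono: "interval_family S D \<Longrightarrow> S \<subseteq> T \<Longrightarrow> interval_family T D"
  unfolding interval_family_def by fastforce

lemma interval_family_subset: "interval_family S D \<Longrightarrow> E \<subseteq> D \<Longrightarrow> interval_family S E"
  by (rule interval_familyI)
    (use interval_familyD[of S D] interval_family_disjoint[of S D] interval_family_finite[of S D]
       finite_subset[of E D] in \<open>(blast | simp add: subset_eq)+\<close>)

lemma interval_family_empty: "interval_family S {}"
  by (simp add: interval_family_def)

lemma interval_family_single: "a \<le> b \<Longrightarrow> {a..b} \<subseteq> S \<Longrightarrow> interval_family S {(a, b)}"
  by (simp add: interval_family_def)

lemma interval_family_length_le:
  assumes "interval_family {a..b} D" "a \<le> b"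
  shows "(\<Sum>(c, d)\<in>D. d - c) \<le> b - a"
proof -
  have fin: "finite D" using assms interval_family_finite by blast
  have disj: "disjoint_family_on (\<lambda>(c, d). {c<..<d}) D"
    using assms(1) unfolding interval_family_def disjoint_family_on_def pairwise_def disjnt_def
    by fast
  have "(\<Sum>(c, d)\<in>D. d - c) = (\<Sum>x\<in>D. measure lborel ((\<lambda>(c, d). {c<..<d}) x))"
    using interval_familyD(1)[OF assms(1)] by (intro sum.cong) auto
  also have "\<dots> = measure lborel (\<Union>x\<in>D. (\<lambda>(c, d). {c<..<d}) x)"
    by (intro measure_finite_Union[symmetric] fin disj) (auto simp: emeasure_lborel_Ioo interval_familyD(1)[OF assms(1)])
  also have "\<dots> \<le> measure lborel {a..b}"
  proof (rule measure_mono_fmeasurable)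
    show "(\<Union>x\<in>D. (\<lambda>(c, d). {c<..<d}) x) \<subseteq> {a..b}"
      using interval_familyD(4)[OF assms(1)] by fastforce
    show "(\<Union>x\<in>D. (\<lambda>(c, d). {c<..<d}) x) \<in> sets lborel"
      using fin by (intro sets.finite_UN) auto
    show "{a..b} \<in> fmeasurable lborel" by (simp add: fmeasurable_def emeasure_lborel_Icc_eq)
  qed
  finally show ?thesis using assms(2) by simp
qed

definition clamp_to :: "real \<Rightarrow> real \<Rightarrow> real \<Rightarrow> real" where
  "clamp_to a b x = max a (min b x)"

lemma clamp_to_eq: "a \<le> x \<Longrightarrow> x \<le> b \<Longrightarrow> clamp_to a b x = x"
  by (simp add: clamp_to_def)

lemma clamp_to_bounds: "a \<le> b \<Longrightarrow> a \<le> clamp_to a b x \<and> clamp_to a b x \<le> b"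
  by (auto simp: clamp_to_def)

lemma clamp_to_mono: "x \<le> y \<Longrightarrow> clamp_to a b x \<le> clamp_to a b y"
  by (auto simp: clamp_to_def)

text \<open>Clamping both endpoints turns a family into a family in \<open>[a, b]\<close>. Intervals outside \<open>[a, b]\<close> may
  collapse to the same degenerate pair, so the image can have fewer members; since degenerate pairs
  carry no increment, sums of increments do not notice.\<close>

lemma clamp_family:
  assumes D: "interval_family S D" and "a \<le> b"
  defines "D' \<equiv> (\<lambda>(c, d). (clamp_to a b c, clamp_to a b d)) ` D"
  shows "interval_family {a..b} D'"
    and "(\<And>x. g (x, x) = (0::real)) \<Longrightarrow> sum g D' = (\<Sum>(c, d)\<in>D. g (clamp_to a b c, clamp_to a b d))"
proof -
  let ?k = "clamp_to a b"
  have fin: "finite D" using D interval_family_finite by blast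
  have sub: "{?k c<..<?k d} \<subseteq> {c<..<d}" for c d
    using \<open>a \<le> b\<close> by (auto simp: clamp_to_def max_def min_def split: if_splits)
  have disj: "{?k c<..<?k d} \<inter> {?k c'<..<?k d'} = {}"
    if "(c, d) \<in> D" "(c', d') \<in> D" "(c, d) \<noteq> (c', d')" for c d c' d'
  proof -
    have "{c<..<d} \<inter> {c'<..<d'} = {}"
      using interval_family_disjoint[OF D that] by blast
    then show ?thesis using sub[of c d] sub[of c' d'] by blast
  qed
  show "interval_family {a..b} D'"
    unfolding interval_family_def
  proof (intro conjI)
    show "finite D'" using fin by (simp add: D'_def)
    show "\<forall>(x, y)\<in>D'. x \<le> y \<and> {x..y} \<subseteq> {a..b}"
      using \<open>a \<le> b\<close>
      by (auto simp: D'_def clamp_to_def max_def min_def split: if_splits dest!: interval_familyD(1)[OF D])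
    show "pairwise (\<lambda>(a, b) (c, d). disjnt {a<..<b} {c<..<d}) D'"
      unfolding pairwise_def D'_def disjnt_def using disj by fast
  qed
  assume g: "\<And>x. g (x, x) = 0"
  have "sum g D' = sum (g \<circ> (\<lambda>(c, d). (?k c, ?k d))) D"
    unfolding D'_def
  proof (rule sum.reindex_nontrivial[OF fin])
    fix x y assume xy: "x \<in> D" "y \<in> D" "x \<noteq> y" and eq: "(\<lambda>(c, d). (?k c, ?k d)) x = (\<lambda>(c, d). (?k c, ?k d)) y"
    obtain c d c' d' where [simp]: "x = (c, d)" "y = (c', d')" by (metis surj_pair)
    have "?k c = ?k c'" "?k d = ?k d'" using eq by auto
    then have "{?k c<..<?k d} = {}" using disj[of c d c' d'] xy by auto
    then have "?k d \<le> ?k c" by simp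
    moreover have "c \<le> d" using xy interval_familyD(1)[OF D] by simp
    then have "?k c \<le> ?k d" by (auto simp: clamp_to_def max_def min_def)
    ultimately have "?k c = ?k d" by simp
    then show "g ((\<lambda>(c, d). (?k c, ?k d)) x) = 0" using g by simp
  qed
  then show "sum g D' = (\<Sum>(c, d)\<in>D. g (?k c, ?k d))"
    by (simp add: case_prod_unfold comp_def)
qed

lemma interval_family_Un:
  assumes D1: "interval_family {a..x} D1" and D2: "interval_family {x..b} D2" and "a \<le> x" "x \<le> b"
  shows "interval_family {a..b} (D1 \<union> D2)"
proof (rule interval_familyI)
  show "finite (D1 \<union> D2)" using D1 D2 interval_family_finite by blast
  show "c \<le> d \<and> {c..d} \<subseteq> {a..b}" if "(c, d) \<in> D1 \<union> D2" for c d
    using that interval_familyD(1,4)[OF D1, of c d] interval_familyD(1,4)[OF D2, of c d] \<open>a \<le> x\<close> \<open>x \<le> b\<close>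
    by fastforce
  have *: "{c<..<d} \<inter> {c'<..<d'} = {}" if "(c, d) \<in> D1" "(c', d') \<in> D2" for c d c' d'
    using interval_familyD[OF D1 that(1)] interval_familyD[OF D2 that(2)] by auto
  fix c d c' d' assume "(c, d) \<in> D1 \<union> D2" "(c', d') \<in> D1 \<union> D2" "(c, d) \<noteq> (c', d')"
  then consider "(c, d) \<in> D1" "(c', d') \<in> D1" | "(c, d) \<in> D2" "(c', d') \<in> D2"
    | "(c, d) \<in> D1" "(c', d') \<in> D2" | "(c, d) \<in> D2" "(c', d') \<in> D1" by blast
  then show "{c<..<d} \<inter> {c'<..<d'} = {}"
    using interval_family_disjoint[OF D1, of c d c' d'] interval_family_disjoint[OF D2, of c d c' d']
      *[of c d c' d'] *[of c' d' c d] \<open>(c, d) \<noteq> (c', d')\<close> by (cases; blast)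
qed

section \<open>The variation of an absolutely continuous function\<close>

text \<open>The supremum is over families that need not cover \<open>[a, b]\<close>: this gives the usual total
  variation, and spares the choice of complementary intervals.\<close>

definition variation_on :: "real \<Rightarrow> real \<Rightarrow> (real \<Rightarrow> complex) \<Rightarrow> real" where
  "variation_on a b f = (SUP D\<in>{D. interval_family {a..b} D}. \<Sum>(c, d)\<in>D. cmod (f d - f c))"

text \<open>An interval that contains \<open>x\<close> in its interior is cut at \<open>x\<close>, which can only increase the sum.\<close>

lemma variation_split:
  assumes D: "interval_family {a..b} D" and "a \<le> x" "x \<le> b"
  obtains D1 D2 where "interval_family {a..x} D1" "interval_family {x..b} D2"
    "(\<Sum>(c, d)\<in>D. cmod (f d - f c)) \<le> (\<Sum>(c, d)\<in>D1. cmod (f d - f c)) + (\<Sum>(c, d)\<in>D2. cmod (f d - f c))"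
proof -
  let ?g = "\<lambda>(c, d). cmod (f d - f c)"
  let ?D1 = "(\<lambda>(c, d). (clamp_to a x c, clamp_to a x d)) ` D"
  let ?D2 = "(\<lambda>(c, d). (clamp_to x b c, clamp_to x b d)) ` D"
  have 1: "interval_family {a..x} ?D1" and s1: "sum ?g ?D1 = (\<Sum>(c, d)\<in>D. ?g (clamp_to a x c, clamp_to a x d))"
    using clamp_family(1)[OF D \<open>a \<le> x\<close>] clamp_family(2)[OF D \<open>a \<le> x\<close>, of ?g] by auto
  have 2: "interval_family {x..b} ?D2" and s2: "sum ?g ?D2 = (\<Sum>(c, d)\<in>D. ?g (clamp_to x b c, clamp_to x b d))"
    using clamp_family(1)[OF D \<open>x \<le> b\<close>] clamp_family(2)[OF D \<open>x \<le> b\<close>, of ?g] by auto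
  have "sum ?g D \<le> (\<Sum>(c, d)\<in>D. ?g (clamp_to a x c, clamp_to a x d) + ?g (clamp_to x b c, clamp_to x b d))"
  proof (rule sum_mono, clarify)
    fix c d assume cd: "(c, d) \<in> D"
    then have "c \<le> d" "c \<in> {a..b}" "d \<in> {a..b}" using interval_familyD[OF D] by blast+
    then consider "d \<le> x" | "x \<le> c" | "c \<le> x" "x \<le> d" by linarith
    then show "cmod (f d - f c) \<le> cmod (f (clamp_to a x d) - f (clamp_to a x c)) + cmod (f (clamp_to x b d) - f (clamp_to x b c))"
    proof cases
      case 3
      then have "clamp_to a x d = x" "clamp_to a x c = c" "clamp_to x b d = d" "clamp_to x b c = x"
        using \<open>c \<in> {a..b}\<close> \<open>d \<in> {a..b}\<close> by (auto simp: clamp_to_def)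
      then show ?thesis using norm_triangle_ineq[of "f x - f c" "f d - f x"] by (simp add: algebra_simps)
    next
      case 1
      then have "clamp_to a x d = d" "clamp_to a x c = c"
        using \<open>c \<in> {a..b}\<close> \<open>d \<in> {a..b}\<close> \<open>c \<le> d\<close> by (auto simp: clamp_to_def)
      then show ?thesis by simp
    next
      case 2
      then have "clamp_to x b d = d" "clamp_to x b c = c"
        using \<open>c \<in> {a..b}\<close> \<open>d \<in> {a..b}\<close> \<open>c \<le> d\<close> by (auto simp: clamp_to_def)
      then show ?thesis by simp
    qed
  qed
  also have "\<dots> = sum ?g ?D1 + sum ?g ?D2"
    unfolding s1 s2 by (simp add: sum.distrib case_prod_unfold)
  finally show thesis using that[OF 1 2] by simp
qed

text \<open>Cut \<open>[a, b]\<close> into \<open>j\<close> pieces shorter than the \<open>\<delta>\<close> that belongs to \<open>\<epsilon> = 1\<close>; each piece contributes at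
  most 1.\<close>

lemma variation_bounded:
  assumes "abs_continuous_on {a..b} f"
  shows "\<exists>K. \<forall>D. interval_family {a..b} D \<longrightarrow> (\<Sum>(c, d)\<in>D. cmod (f d - f c)) \<le> K"
proof -
  obtain \<delta> where "\<delta> > 0" and \<delta>: "\<And>D. \<lbrakk>interval_family {a..b} D; (\<Sum>(c, d)\<in>D. d - c) < \<delta>\<rbrakk> \<Longrightarrow> (\<Sum>(c, d)\<in>D. cmod (f d - f c)) < 1"
    using abs_continuous_onD[OF assms, of 1] by auto
  have claim: "(\<Sum>(c, d)\<in>D. cmod (f d - f c)) \<le> real j"
    if "interval_family {x..y} D" "{x..y} \<subseteq> {a..b}" "y - x < real j * \<delta>" for j x y D
    using that
  proof (induction j arbitrary: y D)
    case 0
    have "D = {}"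
    proof (rule ccontr)
      assume "D \<noteq> {}"
      then obtain c d where "(c, d) \<in> D" by fast
      then show False using interval_familyD[OF 0(1), of c d] 0(3) by auto
    qed
    then show ?case by simp
  next
    case (Suc j)
    show ?case
    proof (cases "x \<le> y")
      case False
      have "D = {}"
      proof (rule ccontr)
        assume "D \<noteq> {}"
        then obtain c d where "(c, d) \<in> D" by fast
        then show False using interval_familyD[OF Suc(2), of c d] False by auto
      qed
      then show ?thesis by simp
    next
      case True
      define z where "z = x + (y - x) * (real j / real (Suc j))"
      have z: "x \<le> z" "z \<le> y" using True mult_right_mono[OF True, of "real j"] by (auto simp: z_def field_simps)
      obtain D1 D2 where D: "interval_family {x..z} D1" "interval_family {z..y} D2"
        "(\<Sum>(c, d)\<in>D. cmod (f d - f c)) \<le> (\<Sum>(c, d)\<in>D1. cmod (f d - f c)) + (\<Sum>(c, d)\<in>D2. cmod (f d - f c))"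
        using variation_split[OF Suc(2) z] by metis
      have yz: "y - z < \<delta>" using Suc(4) by (simp add: z_def field_simps)
      show ?thesis
      proof (cases "j = 0")
        case True
        have "(\<Sum>(c, d)\<in>D. cmod (f d - f c)) < 1"
          using True Suc interval_family_length_le[OF Suc(2) \<open>x \<le> y\<close>]
          by (intro \<delta> interval_family_mono[OF Suc(2)]) auto
        then show ?thesis by simp
      next
        case False
        have zx: "z - x < real j * \<delta>"
        proof -
          have "(y - x) * real j < real (Suc j) * \<delta> * real j" using Suc(4) False by simp
          then have "(y - x) * real j / real (Suc j) < real j * \<delta>" by (simp add: field_simps)
          then show ?thesis by (simp add: z_def)
        qed
        have "(\<Sum>(c, d)\<in>D1. cmod (f d - f c)) \<le> real j"
          using z Suc(3) by (intro Suc.IH[OF D(1) _ zx]) auto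
        moreover have "(\<Sum>(c, d)\<in>D2. cmod (f d - f c)) < 1"
          using z Suc(3) yz interval_family_length_le[OF D(2) z(2)]
          by (intro \<delta> interval_family_mono[OF D(2)]) auto
        ultimately show ?thesis using D(3) by simp
      qed
    qed
  qed
  obtain j :: nat where "b - a < real j * \<delta>" using \<open>\<delta> > 0\<close> reals_Archimedean3 by blast
  then show ?thesis using claim by blast
qed

lemma variation_upper:
  assumes "abs_continuous_on {a..b} f" "interval_family {x..y} D" "{x..y} \<subseteq> {a..b}"
  shows "(\<Sum>(c, d)\<in>D. cmod (f d - f c)) \<le> variation_on x y f"
proof -
  obtain K where K: "\<And>D. interval_family {a..b} D \<Longrightarrow> (\<Sum>(c, d)\<in>D. cmod (f d - f c)) \<le> K"
    using variation_bounded[OF assms(1)] by blast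
  show ?thesis unfolding variation_on_def
    using assms(2) K interval_family_mono[OF _ assms(3)]
    by (intro cSUP_upper bdd_aboveI[of _ K]) auto
qed

lemma variation_least:
  assumes "\<And>D. interval_family {x..y} D \<Longrightarrow> (\<Sum>(c, d)\<in>D. cmod (f d - f c)) \<le> K"
  shows "variation_on x y f \<le> K"
  unfolding variation_on_def using assms interval_family_empty by (intro cSUP_least) auto

lemma variation_add:
  assumes "abs_continuous_on {a..b} f" "a \<le> x" "x \<le> y" "y \<le> b"
  shows "variation_on a y f = variation_on a x f + variation_on x y f"
proof (rule antisym)
  show "variation_on a y f \<le> variation_on a x f + variation_on x y f"
  proof (rule variation_least)
    fix D assume D: "interval_family {a..y} D"
    obtain D1 D2 where "interval_family {a..x} D1" "interval_family {x..y} D2"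
        "(\<Sum>(c, d)\<in>D. cmod (f d - f c)) \<le> (\<Sum>(c, d)\<in>D1. cmod (f d - f c)) + (\<Sum>(c, d)\<in>D2. cmod (f d - f c))"
      using variation_split[OF D assms(2,3)] by metis
    moreover have "(\<Sum>(c, d)\<in>D1. cmod (f d - f c)) \<le> variation_on a x f"
      using assms calculation by (intro variation_upper[OF assms(1)]) auto
    moreover have "(\<Sum>(c, d)\<in>D2. cmod (f d - f c)) \<le> variation_on x y f"
      using assms calculation by (intro variation_upper[OF assms(1)]) auto
    ultimately show "(\<Sum>(c, d)\<in>D. cmod (f d - f c)) \<le> variation_on a x f + variation_on x y f" by linarith
  qed
  let ?S = "\<lambda>D. \<Sum>(c, d)\<in>D. cmod (f d - f c)"
  have le: "?S D1 + ?S D2 \<le> variation_on a y f" if D: "interval_family {a..x} D1" "interval_family {x..y} D2" for D1 D2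
  proof -
    have fin: "finite D1" "finite D2" using D interval_family_finite by blast+
    \<comment> \<open>The families may share a degenerate interval at \<open>x\<close>, but no other.\<close>
    have "?S D1 + ?S D2 = ?S (D1 \<union> D2) + ?S (D1 \<inter> D2)"
      by (rule sum.union_inter[OF fin, symmetric])
    also have "?S (D1 \<inter> D2) = 0"
    proof (rule sum.neutral, clarify)
      fix c d assume "(c, d) \<in> D1" "(c, d) \<in> D2"
      then have "c = d" using interval_familyD[OF D(1), of c d] interval_familyD[OF D(2), of c d] by auto
      then show "cmod (f d - f c) = 0" by simp
    qed
    also have "?S (D1 \<union> D2) \<le> variation_on a y f"
      using assms by (intro variation_upper[OF assms(1)] interval_family_Un[OF D]) auto
    finally show ?thesis by simp
  qed
  have "variation_on a x f \<le> variation_on a y f - ?S D2" if "interval_family {x..y} D2" for D2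
    by (rule variation_least) (use le that in force)
  then have "variation_on x y f \<le> variation_on a y f - variation_on a x f"
    by (intro variation_least) force
  then show "variation_on a x f + variation_on x y f \<le> variation_on a y f" by simp
qed

text \<open>Replace each interval of a short family by a family inside it that almost realises its variation.
  The union is again a family, of no larger total length, so absolute continuity of \<open>f\<close> applies
  to it. The chosen families contain only nondegenerate intervals, which makes them disjoint as sets
  of pairs and lets the sums be combined.\<close>

lemma variation_abs_continuous:
  assumes f: "abs_continuous_on {a..b} f" and "\<epsilon> > 0"
  obtains \<delta> where "\<delta> > 0" "\<And>D. \<lbrakk>interval_family {a..b} D; (\<Sum>(c, d)\<in>D. d - c) < \<delta>\<rbrakk>
    \<Longrightarrow> (\<Sum>(c, d)\<in>D. variation_on c d f) < \<epsilon>"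
proof -
  let ?S = "\<lambda>D. \<Sum>(c, d)\<in>D. cmod (f d - f c)"
  obtain \<delta> where "\<delta> > 0" and \<delta>: "\<And>D. \<lbrakk>interval_family {a..b} D; (\<Sum>(c, d)\<in>D. d - c) < \<delta>\<rbrakk> \<Longrightarrow> ?S D < \<epsilon> / 2"
    using abs_continuous_onD[OF f, of "\<epsilon> / 2"] \<open>\<epsilon> > 0\<close> by auto
  have "(\<Sum>(c, d)\<in>D. variation_on c d f) < \<epsilon>"
    if D: "interval_family {a..b} D" and len: "(\<Sum>(c, d)\<in>D. d - c) < \<delta>" for D
  proof -
    have finD: "finite D" using D interval_family_finite by blast
    define \<eta> where "\<eta> = \<epsilon> / 2 / (real (card D) + 1)"
    have "\<eta> > 0" using \<open>\<epsilon> > 0\<close> by (simp add: \<eta>_def)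
    have "\<exists>E. interval_family {c..d} E \<and> (\<forall>(u, v)\<in>E. u < v) \<and> variation_on c d f < ?S E + \<eta>" if "(c, d) \<in> D" for c d
    proof -
      have "\<exists>E. interval_family {c..d} E \<and> variation_on c d f - \<eta> < ?S E"
      proof (rule ccontr)
        assume "\<not> ?thesis"
        then have "variation_on c d f \<le> variation_on c d f - \<eta>" by (intro variation_least) force
        then show False using \<open>\<eta> > 0\<close> by simp
      qed
      then obtain E where E: "interval_family {c..d} E" "variation_on c d f - \<eta> < ?S E" by blast
      let ?E = "{(u, v)\<in>E. u < v}"
      have "?S ?E = ?S E"
        using interval_familyD(1)[OF E(1)] interval_family_finite[OF E(1)]
        by (intro sum.mono_neutral_left) (fastforce simp: order.order_iff_strict)+
      moreover have "interval_family {c..d} ?E" by (rule interval_family_subset[OF E(1)]) auto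
      ultimately show ?thesis using E(2) by (intro exI[of _ ?E]) auto
    qed
    then have "\<exists>E. interval_family {fst x..snd x} E \<and> (\<forall>(u, v)\<in>E. u < v) \<and>
        variation_on (fst x) (snd x) f < ?S E + \<eta>" if "x \<in> D" for x
      using that by (cases x) auto
    then obtain E where "\<And>x. x \<in> D \<Longrightarrow> interval_family {fst x..snd x} (E x) \<and>
        (\<forall>(u, v)\<in>E x. u < v) \<and> variation_on (fst x) (snd x) f < ?S (E x) + \<eta>"
      by metis
    then have E: "\<And>c d. (c, d) \<in> D \<Longrightarrow> interval_family {c..d} (E (c, d))"
      and Enon: "\<And>c d u v. (c, d) \<in> D \<Longrightarrow> (u, v) \<in> E (c, d) \<Longrightarrow> u < v"
      and Ev: "\<And>c d. (c, d) \<in> D \<Longrightarrow> variation_on c d f < ?S (E (c, d)) + \<eta>"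
      by fastforce+
    let ?U = "\<Union>x\<in>D. E x"
    have finE: "finite (E x)" if "x \<in> D" for x using E that interval_family_finite by (cases x) blast
    have sub: "{u<..<v} \<subseteq> {c<..<d}" "{u..v} \<subseteq> {c..d}" if "(c, d) \<in> D" "(u, v) \<in> E (c, d)" for c d u v
      using interval_familyD[OF E[OF that(1)] that(2)] by auto
    have djD: "{c<..<d} \<inter> {c'<..<d'} = {}" if "(c, d) \<in> D" "(c', d') \<in> D" "(c, d) \<noteq> (c', d')" for c d c' d'
      using interval_family_disjoint[OF D that] by blast
    have disj: "E x \<inter> E y = {}" if "x \<in> D" "y \<in> D" "x \<noteq> y" for x y
    proof (rule ccontr)
      assume "E x \<inter> E y \<noteq> {}"
      then obtain u v where uv: "(u, v) \<in> E x" "(u, v) \<in> E y" by fast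
      obtain c d c' d' where [simp]: "x = (c, d)" "y = (c', d')" by (metis surj_pair)
      have "{u<..<v} = {}" using sub[of c d u v] sub[of c' d' u v] uv that djD[of c d c' d'] by auto
      then show False using Enon[of c d u v] uv that dense[of u v] by auto
    qed
    have U: "interval_family {a..b} ?U"
    proof (rule interval_familyI)
      show "finite ?U" using finD finE by blast
      show "u \<le> v \<and> {u..v} \<subseteq> {a..b}" if uv: "(u, v) \<in> ?U" for u v
      proof -
        obtain c d where cd: "(c, d) \<in> D" "(u, v) \<in> E (c, d)" using uv by auto
        show ?thesis using sub(2)[OF cd] Enon[OF cd] interval_familyD(4)[OF D cd(1)] by auto
      qed
      fix u v u' v' assume uv: "(u, v) \<in> ?U" "(u', v') \<in> ?U" "(u, v) \<noteq> (u', v')"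
      obtain c d where 1: "(c, d) \<in> D" "(u, v) \<in> E (c, d)" using uv by auto
      obtain c' d' where 2: "(c', d') \<in> D" "(u', v') \<in> E (c', d')" using uv by auto
      show "{u<..<v} \<inter> {u'<..<v'} = {}"
      proof (cases "(c, d) = (c', d')")
        case True
        then have "(u', v') \<in> E (c, d)" using 2 by simp
        then show ?thesis using interval_family_disjoint[OF E[OF 1(1)] 1(2)] uv by blast
      next
        case False
        then show ?thesis using sub(1)[OF 1] sub(1)[OF 2] djD[OF 1(1) 2(1)] by blast
      qed
    qed
    have "(\<Sum>(u, v)\<in>?U. v - u) = (\<Sum>x\<in>D. \<Sum>(u, v)\<in>E x. v - u)"
      using disj finD finE by (intro sum.UNION_disjoint) auto
    also have "\<dots> \<le> (\<Sum>(c, d)\<in>D. d - c)"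
      using interval_family_length_le[OF E interval_familyD(1)[OF D]] by (intro sum_mono) auto
    finally have "?S ?U < \<epsilon> / 2" using \<delta>[OF U] len by simp
    also have "?S ?U = (\<Sum>x\<in>D. ?S (E x))"
      using disj finD finE by (intro sum.UNION_disjoint) auto
    finally have 1: "(\<Sum>x\<in>D. ?S (E x)) < \<epsilon> / 2" .
    have "(\<Sum>(c, d)\<in>D. variation_on c d f) \<le> (\<Sum>x\<in>D. ?S (E x) + \<eta>)"
      using Ev by (intro sum_mono) force
    also have "\<dots> = (\<Sum>x\<in>D. ?S (E x)) + real (card D) * \<eta>" by (simp add: sum.distrib)
    also have "real (card D) * \<eta> < \<epsilon> / 2" 
      using \<open>\<epsilon> > 0\<close> by (simp add: \<eta>_def field_simps)
    finally show ?thesis using 1 by simp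
  qed
  then show thesis using that[OF \<open>\<delta> > 0\<close>] by blast
qed

section \<open>Absolutely continuous functions are indefinite integrals\<close>

text \<open>An open set is the increasing union of finite unions of compact intervals, and each finite union
  can be divided into finitely many non-overlapping ones.\<close>

lemma interval_measure_open_le:
  assumes mono: "\<And>x y. x \<le> y \<Longrightarrow> F x \<le> F y" and cont: "continuous_on UNIV F"
    and small: "\<And>D. interval_family UNIV D \<Longrightarrow> (\<Sum>(c, d)\<in>D. d - c) < \<delta> \<Longrightarrow> (\<Sum>(c, d)\<in>D. F d - F c) < \<epsilon>"
    and U: "open U" "emeasure lborel U < ennreal \<delta>"
  shows "emeasure (interval_measure F) U \<le> ennreal \<epsilon>"
proof -
  let ?M = "interval_measure F"
  obtain \<D> where \<D>: "countable \<D>" "\<D> \<subseteq> Pow U" "\<And>X. X \<in> \<D> \<Longrightarrow> \<exists>a b. X = cbox a (b::real)" "\<Union>\<D> = U"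
    using open_countable_Union_open_cbox[OF U(1)] by blast
  show ?thesis
  proof (cases "\<D> = {}")
    case True
    then have "U = {}" using \<D> by auto
    then show ?thesis by simp
  next
    case False
    define K where "K = from_nat_into \<D>"
    have rangeK: "range K = \<D>" using False \<D>(1) by (simp add: K_def range_from_nat_into)
    have Kb: "K n \<in> sets borel" for n
    proof -
      have "K n \<in> \<D>" using rangeK by blast
      then obtain a b where "K n = cbox a b" using \<D>(3) by blast
      then show ?thesis by simp
    qed
    define C where "C n = \<Union>(K ` {..<n})" for n :: nat
    have le: "emeasure ?M (C n) \<le> ennreal \<epsilon>" for n
    proof -
      have "\<exists>a b. s = cbox a b" if "s \<in> K ` {..<n}" for s
        using that \<D>(3) rangeK by blast
      then obtain p where p: "p division_of (C n)"
        unfolding C_def using elementary_unions_intervals[of "K ` {..<n}"] by blast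
      have finp: "finite p" using division_ofD(1)[OF p] .
      have k: "k = {Inf k..Sup k} \<and> Inf k \<le> Sup k" if kp: "k \<in> p" for k
      proof -
        obtain a b where "k = cbox a b" "k \<noteq> {}" using division_ofD(3,4)[OF p kp] by blast
        then show ?thesis by (auto simp: cbox_interval)
      qed
      define D where "D = (\<lambda>k. (Inf k, Sup k)) ` p"
      have inj: "inj_on (\<lambda>k. (Inf k, Sup k)) p"
        by (rule inj_onI) (metis k Pair_inject)
      have D: "interval_family UNIV D"
      proof (rule interval_familyI)
        show "finite D" using finp by (simp add: D_def)
        show "c \<le> d \<and> {c..d} \<subseteq> UNIV" if "(c, d) \<in> D" for c d using that k by (auto simp: D_def)
        fix c d c' d' assume *: "(c, d) \<in> D" "(c', d') \<in> D" "(c, d) \<noteq> (c', d')"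
        then have "{c..d} \<in> p" "{c'..d'} \<in> p" "c \<le> d" "c' \<le> d'" using k by (auto simp: D_def)
        moreover have "{c..d} \<noteq> {c'..d'}" using * \<open>c \<le> d\<close> by auto
        ultimately have "interior {c..d} \<inter> interior {c'..d'} = {}"
          using division_ofD(5)[OF p] by blast
        then show "{c<..<d} \<inter> {c'<..<d'} = {}" by simp
      qed
      have "(\<Sum>(c, d)\<in>D. d - c) = (\<Sum>k\<in>p. Sup k - Inf k)"
        unfolding D_def by (subst sum.reindex[OF inj]) (simp add: comp_def)
      also have "\<dots> = (\<Sum>k\<in>p. measure lebesgue k)"
      proof (intro sum.cong refl)
        fix l assume "l \<in> p"
        then obtain u v where "l = {u..v}" "u \<le> v" using k by blast
        then show "Sup l - Inf l = measure lebesgue l" by simp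
      qed
      also have "\<dots> = measure lebesgue (C n)" by (rule content_division[OF p])
      also have "\<dots> < \<delta>"
      proof -
        have Cb: "C n \<in> sets borel"
          unfolding C_def using Kb by (intro sets.finite_Union) auto
        have "C n \<subseteq> U" unfolding C_def using rangeK \<D>(2) by blast
        then have "emeasure lborel (C n) < ennreal \<delta>"
          using emeasure_mono[of "C n" U lborel] U by (auto intro: le_less_trans)
        moreover have "emeasure lborel (C n) = ennreal (measure lborel (C n))"
          using calculation by (intro emeasure_eq_ennreal_measure) (auto simp: top_unique less_top[symmetric])
        ultimately show ?thesis using Cb by (auto simp: ennreal_less_iff)
      qed
      finally have small': "(\<Sum>(c, d)\<in>D. F d - F c) < \<epsilon>" using small[OF D] by simp
      have "emeasure ?M (C n) = emeasure ?M (\<Union>k\<in>p. k)" using division_ofD(6)[OF p] by simp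
      also have "\<dots> \<le> (\<Sum>k\<in>p. emeasure ?M k)"
      proof (intro emeasure_subadditive_finite finp image_subsetI)
        fix l assume "l \<in> p"
        then obtain u v where "l = {u..v}" "u \<le> v" using k by blast
        then show "l \<in> sets ?M" by simp
      qed
      also have "\<dots> = (\<Sum>k\<in>p. ennreal (F (Sup k) - F (Inf k)))"
      proof (intro sum.cong refl)
        fix l assume "l \<in> p"
        then obtain u v where "l = {u..v}" "u \<le> v" using k by blast
        then show "emeasure ?M l = ennreal (F (Sup l) - F (Inf l))"
          using emeasure_interval_measure_Icc[of u v F] mono cont by simp
      qed
      also have "\<dots> = ennreal (\<Sum>k\<in>p. F (Sup k) - F (Inf k))"
        using k mono by (intro sum_ennreal) simp
      also have "(\<Sum>k\<in>p. F (Sup k) - F (Inf k)) = (\<Sum>(c, d)\<in>D. F d - F c)"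
        unfolding D_def by (subst sum.reindex[OF inj]) (simp add: comp_def)
      finally show ?thesis using small' by (meson ennreal_leI less_imp_le order_trans)
    qed
    have inc: "incseq C" unfolding incseq_def C_def by (intro allI impI Union_mono image_mono) auto
    have setsC: "range C \<subseteq> sets ?M" using Kb by (auto simp: C_def)
    have "(\<Union>n. C n) = U" using rangeK \<D>(4) unfolding C_def by fastforce
    then have "emeasure ?M U = (SUP n. emeasure ?M (C n))" using SUP_emeasure_incseq[OF setsC inc] by simp
    also have "\<dots> \<le> ennreal \<epsilon>" using le by (intro SUP_least) auto
    finally show ?thesis .
  qed
qed

text \<open>A null set lies in open sets of arbitrarily small length, and these have small measure with
  respect to \<open>F\<close> by the previous estimate. So the measure defined by \<open>F\<close> is absolutely continuous with
  respect to Lebesgue measure and the Radon-Nikodym theorem applies.\<close>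

lemma increasing_abs_continuous_density:
  fixes F :: "real \<Rightarrow> real"
  assumes mono: "\<And>x y. x \<le> y \<Longrightarrow> F x \<le> F y" and cont: "continuous_on UNIV F"
    and ac: "\<And>\<epsilon>. \<epsilon> > 0 \<Longrightarrow> \<exists>\<delta>>0. \<forall>D. interval_family UNIV D \<and> (\<Sum>(c, d)\<in>D. d - c) < \<delta> \<longrightarrow> (\<Sum>(c, d)\<in>D. F d - F c) < \<epsilon>"
  obtains h where "\<And>x. 0 \<le> h x" "\<And>a b. a \<le> b \<Longrightarrow> (h has_integral F b - F a) {a..b}"
proof -
  let ?M = "interval_measure F"
  have rcont: "continuous (at_right a) F" for a
    using cont by (simp add: continuous_on_eq_continuous_at continuous_at_imp_continuous_at_within)
  have "absolutely_continuous lborel ?M"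
    unfolding absolutely_continuous_def
  proof
    fix N assume N: "N \<in> null_sets (lborel :: real measure)"
    have "emeasure ?M N \<le> ennreal \<epsilon>" if pos: "\<epsilon> > 0" for \<epsilon>
    proof -
      obtain \<delta> where \<delta>: "\<delta> > 0" "\<And>D. interval_family UNIV D \<Longrightarrow> (\<Sum>(c, d)\<in>D. d - c) < \<delta> \<Longrightarrow> (\<Sum>(c, d)\<in>D. F d - F c) < \<epsilon>"
        using ac[OF pos] by blast
      have Nl: "N \<in> sets lebesgue" "emeasure lebesgue N = 0" using N by (auto intro: null_setsD1 null_sets_completionI)
      obtain T where T: "open T" "N \<subseteq> T" "T - N \<in> lmeasurable" "emeasure lebesgue (T - N) < ennreal \<delta>"
        using sets_lebesgue_outer_open[OF Nl(1) \<delta>(1)] by blast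
      have "emeasure lebesgue T = emeasure lebesgue ((T - N) \<union> N)" using T(2) by (simp add: Un_absorb2)
      also have "\<dots> \<le> emeasure lebesgue (T - N) + emeasure lebesgue N"
        using T(3) Nl by (intro emeasure_subadditive) auto
      finally have "emeasure lborel T < ennreal \<delta>" using Nl T by (simp add: le_less_trans)
      then have "emeasure ?M T \<le> ennreal \<epsilon>"
        using interval_measure_open_le[OF mono cont \<delta>(2) T(1)] by blast
      moreover have "emeasure ?M N \<le> emeasure ?M T" using T by (intro emeasure_mono) auto
      ultimately show ?thesis by simp
    qed
    then have "emeasure ?M N \<le> 0" by - (rule ennreal_le_epsilon, simp)
    then have "emeasure ?M N = 0" by simp
    then show "N \<in> null_sets ?M" using N by (auto simp: null_sets_def)
  qed
  then obtain f where f: "f \<in> borel_measurable lborel" "density lborel f = ?M"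
    using sigma_finite_measure.Radon_Nikodym[OF sigma_finite_lborel, of ?M] by auto
  have emf: "(\<integral>\<^sup>+x. f x * indicator {a..b} x \<partial>lborel) = ennreal (F b - F a)" if "a \<le> b" for a b
    using emeasure_density[OF f(1), of "{a..b}"] f(2) emeasure_interval_measure_Icc[OF that mono cont] by simp
  define h where "h x = enn2real (f x)" for x
  have hm: "h \<in> borel_measurable borel" using f(1) unfolding h_def by simp
  have int: "(h has_integral F b - F a) {a..b}" if "a \<le> b" for a b
  proof -
    have "AE x in lborel. f x * indicator {a..b} x \<noteq> \<infinity>"
      using emf[OF that] f(1) by (intro nn_integral_noteq_infinite) auto
    then have "(\<integral>\<^sup>+x. ennreal (h x * indicator {a..b} x) \<partial>lborel) = (\<integral>\<^sup>+x. f x * indicator {a..b} x \<partial>lborel)"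
      by (intro nn_integral_cong_AE) (auto simp: h_def indicator_def less_top)
    then have "((\<lambda>x. h x * indicator {a..b} x) has_integral F b - F a) UNIV"
      using emf[OF that] mono[OF that]
      by (intro nn_integral_has_integral borel_measurable_times hm borel_measurable_indicator) (auto simp: h_def)
    moreover have "(\<lambda>x. h x * indicator {a..b} x) = (\<lambda>x. if x \<in> {a..b} then h x else 0)"
      by (auto simp: indicator_def)
    ultimately show ?thesis
      using has_integral_restrict_UNIV[of "{a..b}" h] by (simp del: atLeastAtMost_iff)
  qed
  show thesis by (rule that[of h]) (simp add: h_def, rule int)
qed

text \<open>Extending \<open>P\<close> by constants beyond \<open>a\<close> and \<open>b\<close> reduces the statement to functions on the whole line.\<close>

lemma increasing_on_interval_density:
  fixes P :: "real \<Rightarrow> real"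
  assumes "a \<le> b" and mono: "\<And>x y. \<lbrakk>a \<le> x; x \<le> y; y \<le> b\<rbrakk> \<Longrightarrow> P x \<le> P y"
    and ac: "\<And>\<epsilon>. \<epsilon> > 0 \<Longrightarrow> \<exists>\<delta>>0. \<forall>D. interval_family {a..b} D \<and> (\<Sum>(c, d)\<in>D. d - c) < \<delta> \<longrightarrow> (\<Sum>(c, d)\<in>D. P d - P c) < \<epsilon>"
  obtains h where "\<And>x. 0 \<le> h x" 
    "\<And>u v. u \<le> v \<Longrightarrow> (h has_integral P (clamp_to a b v) - P (clamp_to a b u)) {u..v}"
proof -
  let ?k = "clamp_to a b"
  define F where "F = P \<circ> ?k"
  have Fmono: "F x \<le> F y" if "x \<le> y" for x y
    using that mono clamp_to_bounds[OF \<open>a \<le> b\<close>] clamp_to_mono unfolding F_def by simp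
  have Fac: "\<exists>\<delta>>0. \<forall>D. interval_family UNIV D \<and> (\<Sum>(c, d)\<in>D. d - c) < \<delta> \<longrightarrow> (\<Sum>(c, d)\<in>D. F d - F c) < \<epsilon>"
    if "\<epsilon> > 0" for \<epsilon>
  proof -
    obtain \<delta> where \<delta>: "\<delta> > 0" "\<And>D. \<lbrakk>interval_family {a..b} D; (\<Sum>(c, d)\<in>D. d - c) < \<delta>\<rbrakk> \<Longrightarrow> (\<Sum>(c, d)\<in>D. P d - P c) < \<epsilon>"
      using ac[OF \<open>\<epsilon> > 0\<close>] by blast
    have "(\<Sum>(c, d)\<in>D. F d - F c) < \<epsilon>" if D: "interval_family UNIV D" "(\<Sum>(c, d)\<in>D. d - c) < \<delta>" for D
    proof -
      let ?D = "(\<lambda>(c, d). (?k c, ?k d)) ` D"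
      have "(\<Sum>(c, d)\<in>?D. d - c) = (\<Sum>(c, d)\<in>D. ?k d - ?k c)"
        using clamp_family(2)[OF D(1) \<open>a \<le> b\<close>, of "\<lambda>(c, d). d - c"] by simp
      also have "\<dots> \<le> (\<Sum>(c, d)\<in>D. d - c)"
      proof (rule sum_mono, clarify)
        fix c d assume "(c, d) \<in> D"
        then have "c \<le> d" using interval_familyD(1)[OF D(1)] by blast
        then show "?k d - ?k c \<le> d - c" by (auto simp: clamp_to_def max_def min_def)
      qed
      finally have "(\<Sum>(c, d)\<in>?D. P d - P c) < \<epsilon>"
        using D(2) by (intro \<delta>(2) clamp_family(1)[OF D(1) \<open>a \<le> b\<close>]) auto
      then show ?thesis
        using clamp_family(2)[OF D(1) \<open>a \<le> b\<close>, of "\<lambda>(c, d). P d - P c"] by (simp add: F_def)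
    qed
    then show ?thesis using \<delta>(1) by blast
  qed
  have "continuous_on UNIV F"
    unfolding continuous_on_iff
  proof (intro ballI allI impI)
    fix x \<epsilon> :: real assume "\<epsilon> > 0"
    then obtain \<delta> where \<delta>: "\<delta> > 0" "\<And>D. \<lbrakk>interval_family UNIV D; (\<Sum>(c, d)\<in>D. d - c) < \<delta>\<rbrakk> \<Longrightarrow> (\<Sum>(c, d)\<in>D. F d - F c) < \<epsilon>"
      using Fac[OF \<open>\<epsilon> > 0\<close>] by blast
    have "dist (F y) (F x) < \<epsilon>" if "dist y x < \<delta>" for y
    proof (cases "x \<le> y")
      case True
      then show ?thesis using \<delta>(2)[of "{(x, y)}"] interval_family_single[of x y UNIV] that Fmono[OF True]
        by (simp add: dist_real_def)
    next
      case False
      then show ?thesis using \<delta>(2)[of "{(y, x)}"] interval_family_single[of y x UNIV] that Fmono[of y x]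
        by (simp add: dist_real_def)
    qed
    then show "\<exists>d>0. \<forall>x'\<in>UNIV. dist x' x < d \<longrightarrow> dist (F x') (F x) < \<epsilon>" using \<delta>(1) by blast
  qed
  then obtain h where "\<And>x. 0 \<le> h x" "\<And>a b. a \<le> b \<Longrightarrow> (h has_integral F b - F a) {a..b}"
    using increasing_abs_continuous_density[of F] Fmono Fac by metis
  then show thesis using that[of h] by (simp add: F_def)
qed

lemma absolutely_integrable_complex_of_real:
  fixes h :: "real \<Rightarrow> real"
  assumes "h absolutely_integrable_on S"
  shows "(\<lambda>x. c * complex_of_real (h x)) absolutely_integrable_on S"
  using absolutely_integrable_linear[OF assms, of "\<lambda>x. c * complex_of_real x"]
  by (simp add: comp_def bounded_linear_const_mult bounded_linear_of_real)

lemma abs_continuous_on_density: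
  assumes f: "abs_continuous_on {a..b} f" and "a \<le> b"
  obtains g where "\<And>u v. u \<le> v \<Longrightarrow> g absolutely_integrable_on {u..v}"
    "\<And>u v. u \<le> v \<Longrightarrow> (g has_integral f (clamp_to a b v) - f (clamp_to a b u)) {u..v}"
proof -
  define V where "V x = variation_on a x f" for x
  have V: "V d - V c = variation_on c d f" if "a \<le> c" "c \<le> d" "d \<le> b" for c d
    using variation_add[OF f that] by (simp add: V_def)
  have incr: "cmod (f d - f c) \<le> variation_on c d f" if "a \<le> c" "c \<le> d" "d \<le> b" for c d
    using variation_upper[OF f interval_family_single[OF that(2) subset_refl]] that by simp
  \<comment> \<open>Adding the variation to a real component of \<open>f\<close> makes it increasing; \<open>r = 0\<close> gives the variation itself.\<close>
  have dens: "\<exists>h. (\<forall>x. 0 \<le> h x) \<and> (\<forall>u v. u \<le> v \<longrightarrow>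
       (h has_integral (V (clamp_to a b v) + r (f (clamp_to a b v))) - (V (clamp_to a b u) + r (f (clamp_to a b u)))) {u..v})"
    if r: "\<And>z w. r z - r w = r (z - w)" "\<And>z. \<bar>r z\<bar> \<le> cmod z" for r :: "complex \<Rightarrow> real"
  proof -
    let ?P = "\<lambda>x. V x + r (f x)"
    have mono: "?P x \<le> ?P y" if "a \<le> x" "x \<le> y" "y \<le> b" for x y
      using V[OF that] incr[OF that] r(1)[of "f x" "f y"] r(2)[of "f x - f y"]
      by (simp add: norm_minus_commute)
    have ac: "\<exists>\<delta>>0. \<forall>D. interval_family {a..b} D \<and> (\<Sum>(c, d)\<in>D. d - c) < \<delta> \<longrightarrow> (\<Sum>(c, d)\<in>D. ?P d - ?P c) < \<epsilon>"
      if "\<epsilon> > 0" for \<epsilon>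
    proof -
      obtain \<delta> where \<delta>: "\<delta> > 0" "\<And>D. \<lbrakk>interval_family {a..b} D; (\<Sum>(c, d)\<in>D. d - c) < \<delta>\<rbrakk>
          \<Longrightarrow> (\<Sum>(c, d)\<in>D. variation_on c d f) < \<epsilon> / 2"
        using variation_abs_continuous[OF f, of "\<epsilon> / 2"] \<open>\<epsilon> > 0\<close> by auto
      have "(\<Sum>(c, d)\<in>D. ?P d - ?P c) < \<epsilon>"
        if D: "interval_family {a..b} D" "(\<Sum>(c, d)\<in>D. d - c) < \<delta>" for D
      proof -
        have "(\<Sum>(c, d)\<in>D. ?P d - ?P c) \<le> (\<Sum>x\<in>D. 2 * (\<lambda>(c, d). variation_on c d f) x)"
        proof (rule sum_mono, clarify)
          fix c d assume "(c, d) \<in> D"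
          then have *: "a \<le> c" "c \<le> d" "d \<le> b" using interval_familyD[OF D(1), of c d] by auto
          show "V d + r (f d) - (V c + r (f c)) \<le> 2 * variation_on c d f"
            using V[OF *] incr[OF *] r(1)[of "f d" "f c"] r(2)[of "f d - f c"] by simp
        qed
        also have "\<dots> < \<epsilon>" using \<delta>(2)[OF D] by (simp add: sum_distrib_left[symmetric])
        finally show ?thesis .
      qed
      then show ?thesis using \<delta>(1) by blast
    qed
    obtain h where "\<And>x. 0 \<le> h x"
      "\<And>u v. u \<le> v \<Longrightarrow> (h has_integral ?P (clamp_to a b v) - ?P (clamp_to a b u)) {u..v}"
      using increasing_on_interval_density[OF \<open>a \<le> b\<close> mono ac] by blast
    then show ?thesis by blast
  qed
  let ?k = "clamp_to a b"
  obtain h0 where h0: "\<And>x. 0 \<le> h0 x" "\<And>u v. u \<le> v \<Longrightarrow> (h0 has_integral V (?k v) - V (?k u)) {u..v}"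
    using dens[of "\<lambda>_. 0"] by auto
  obtain h1 where h1: "\<And>x. 0 \<le> h1 x" "\<And>u v. u \<le> v \<Longrightarrow> (h1 has_integral (V (?k v) + Re (f (?k v))) - (V (?k u) + Re (f (?k u)))) {u..v}"
    using dens[of Re] abs_Re_le_cmod by auto
  obtain h2 where h2: "\<And>x. 0 \<le> h2 x" "\<And>u v. u \<le> v \<Longrightarrow> (h2 has_integral (V (?k v) + Im (f (?k v))) - (V (?k u) + Im (f (?k u)))) {u..v}"
    using dens[of Im] abs_Im_le_cmod by auto
  have ai: "h0 absolutely_integrable_on {u..v}" "h1 absolutely_integrable_on {u..v}" "h2 absolutely_integrable_on {u..v}"
    if "u \<le> v" for u v
    using h0(2)[OF that] h1(2)[OF that] h2(2)[OF that] h0(1) h1(1) h2(1)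
    by (auto intro!: nonnegative_absolutely_integrable_1 intro: has_integral_integrable)
  define g where "g x = 1 * complex_of_real (h1 x - h0 x) + \<i> * complex_of_real (h2 x - h0 x)" for x
  show thesis
  proof (rule that[of g])
    fix u v :: real assume uv: "u \<le> v"
    show "g absolutely_integrable_on {u..v}"
      unfolding g_def using ai[OF uv]
      by (intro set_integral_add(1) absolutely_integrable_complex_of_real set_integral_diff(1)) auto
    let ?f = "\<lambda>x. f (?k x)"
    have "((\<lambda>x. 1 * complex_of_real (h1 x - h0 x) + \<i> * complex_of_real (h2 x - h0 x)) has_integral
       1 * complex_of_real (((V (?k v) + Re (?f v)) - (V (?k u) + Re (?f u))) - (V (?k v) - V (?k u)))
       + \<i> * complex_of_real (((V (?k v) + Im (?f v)) - (V (?k u) + Im (?f u))) - (V (?k v) - V (?k u)))) {u..v}"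
      by (intro has_integral_add has_integral_mult_right has_integral_of_real has_integral_diff h0(2) h1(2) h2(2) uv)
    also have "(1 * complex_of_real (((V (?k v) + Re (?f v)) - (V (?k u) + Re (?f u))) - (V (?k v) - V (?k u)))
       + \<i> * complex_of_real (((V (?k v) + Im (?f v)) - (V (?k u) + Im (?f u))) - (V (?k v) - V (?k u)))) = ?f v - ?f u"
      by (simp add: complex_eq_iff)
    finally show "(g has_integral ?f v - ?f u) {u..v}" by (simp add: g_def[abs_def])
  qed
qed

text \<open>This is the Lebesgue differentiation theorem on the line. The fact
  \<open>integrable_ccontinuous_explicit\<close> treats averages to the right of a point; applied to
  the reflected function it gives those to the left.\<close>

lemma indefinite_integral_derivative_ae:
  fixes g :: "real \<Rightarrow> complex"
  assumes int: "\<And>u v. u \<le> v \<Longrightarrow> (g has_integral F v - F u) {u..v}"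
  obtains N where "negligible N" "\<And>x. x \<notin> N \<Longrightarrow> (F has_vector_derivative g x) (at x)"
proof -
  have gi: "g integrable_on cbox a b" for a b :: real
    using int[of a b] by (cases "a \<le> b") (auto simp: cbox_interval intro: has_integral_integrable)
  then have gi': "(\<lambda>x. g (- x)) integrable_on cbox a b" for a b :: real
    using iffD2[OF integrable_reflect[where f = g and a = "-b" and b = "-a"] gi] by (simp only: minus_minus)
  obtain N1 where N1: "negligible N1" "\<And>x e. \<lbrakk>x \<notin> N1; 0 < e\<rbrakk> \<Longrightarrow> \<exists>d>0. \<forall>h. 0 < h \<and> h < d \<longrightarrow>
      norm (integral (cbox x (x + h *\<^sub>R One)) g /\<^sub>R h ^ DIM(real) - g x) < e"
    using integrable_ccontinuous_explicit[OF gi] by blast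
  obtain N2 where N2: "negligible N2" "\<And>x e. \<lbrakk>x \<notin> N2; 0 < e\<rbrakk> \<Longrightarrow> \<exists>d>0. \<forall>h. 0 < h \<and> h < d \<longrightarrow>
      norm (integral (cbox x (x + h *\<^sub>R One)) (\<lambda>x. g (- x)) /\<^sub>R h ^ DIM(real) - g (- x)) < e"
    using integrable_ccontinuous_explicit[OF gi'] by blast
  have deriv: "(F has_vector_derivative g x) (at x)" if x: "x \<notin> N1" "- x \<notin> N2" for x
    unfolding has_vector_derivative_def has_derivative_at_alt
  proof (intro conjI allI impI)
    show "bounded_linear (\<lambda>h. h *\<^sub>R g x)" by (rule bounded_linear_scaleR_left)
    fix e :: real assume "e > 0"
    obtain d1 where d1: "d1 > 0" "\<And>h. 0 < h \<Longrightarrow> h < d1 \<Longrightarrow> cmod (integral {x..x+h} g /\<^sub>R h - g x) < e"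
      using N1(2)[OF x(1) \<open>e > 0\<close>] by (auto simp: cbox_interval)
    obtain d2 where d2: "d2 > 0" "\<And>h. 0 < h \<Longrightarrow> h < d2 \<Longrightarrow> cmod (integral {-x..-x+h} (\<lambda>x. g (-x)) /\<^sub>R h - g x) < e"
      using N2(2)[OF x(2) \<open>e > 0\<close>] by (auto simp: cbox_interval)
    have *: "cmod (I - h *\<^sub>R z) \<le> e * h" if "h > 0" "cmod (I /\<^sub>R h - z) < e" for I z h
    proof -
      have "I - h *\<^sub>R z = h *\<^sub>R (I /\<^sub>R h - z)" using that(1) by (simp add: scaleR_right_diff_distrib)
      then have "cmod (I - h *\<^sub>R z) = h * cmod (I /\<^sub>R h - z)" using that(1) by simp
      then show ?thesis using that by (simp add: mult.commute)
    qed
    have "cmod (F y - F x - (y - x) *\<^sub>R g x) \<le> e * \<bar>y - x\<bar>" if y: "\<bar>y - x\<bar> < min d1 d2" for y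
    proof -
      consider "y = x" | "y > x" | "y < x" by linarith
      then show ?thesis
      proof cases
        case 2
        have "integral {x..x+(y-x)} g = F y - F x" using int[of x y] 2 by (simp add: integral_unique)
        then show ?thesis using *[of "y - x" "F y - F x" "g x"] d1(2)[of "y - x"] 2 y by simp
      next
        case 3
        have "((\<lambda>x. g (- x)) has_integral F x - F y) {-x..-y}"
          using int[of y x] 3 by simp
        then have "integral {-x..-x+(x-y)} (\<lambda>x. g (-x)) = F x - F y" by (simp add: integral_unique)
        then have le: "cmod (F x - F y - (x - y) *\<^sub>R g x) \<le> e * (x - y)"
          using *[of "x - y" "F x - F y" "g x"] d2(2)[of "x - y"] 3 y by simp
        have eq: "F y - F x - (y - x) *\<^sub>R g x = - (F x - F y - (x - y) *\<^sub>R g x)" by (simp add: algebra_simps)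
        show ?thesis unfolding eq norm_minus_cancel using le 3 by simp
      qed simp
    qed
    then show "\<exists>d>0. \<forall>y. norm (y - x) < d \<longrightarrow> norm (F y - F x - (y - x) *\<^sub>R g x) \<le> e * norm (y - x)"
      using d1(1) d2(1) by (intro exI[of _ "min d1 d2"]) auto
  qed
  have "negligible (uminus ` N2)" 
    by (rule negligible_differentiable_image_negligible[OF _ N2(1)])
      (auto intro!: differentiable_on_minus differentiable_on_ident)
  then show thesis
  proof (rule that[OF negligible_Un[OF N1(1)]])
    fix x assume "x \<notin> N1 \<union> uminus ` N2"
    then have "x \<notin> N1" "- x \<notin> N2" by (auto, metis image_eqI minus_minus)
    then show "(F has_vector_derivative g x) (at x)" by (rule deriv)
  qed
qed

theorem abs_continuous_on_imp_integral:
  assumes "abs_continuous_on {a..b} f" "a \<le> b"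
  obtains g N where "negligible N" "\<And>u v. \<lbrakk>a \<le> u; u \<le> v; v \<le> b\<rbrakk> \<Longrightarrow> g absolutely_integrable_on {u..v}"
    "\<And>u v. \<lbrakk>a \<le> u; u \<le> v; v \<le> b\<rbrakk> \<Longrightarrow> (g has_integral f v - f u) {u..v}"
    "\<And>x. x \<in> {a<..<b} - N \<Longrightarrow> (f has_vector_derivative g x) (at x)"
proof -
  let ?F = "\<lambda>x. f (clamp_to a b x)"
  obtain g where g: "\<And>u v. u \<le> v \<Longrightarrow> g absolutely_integrable_on {u..v}"
    "\<And>u v. u \<le> v \<Longrightarrow> (g has_integral ?F v - ?F u) {u..v}"
    using abs_continuous_on_density[OF assms] by metis
  obtain N where N: "negligible N" "\<And>x. x \<notin> N \<Longrightarrow> (?F has_vector_derivative g x) (at x)"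
    using indefinite_integral_derivative_ae[OF g(2)] by metis
  show thesis
  proof (rule that[of N g])
    show "(g has_integral f v - f u) {u..v}" if "a \<le> u" "u \<le> v" "v \<le> b" for u v
      using g(2)[OF that(2)] that by (simp add: clamp_to_eq)
    show "(f has_vector_derivative g x) (at x)" if "x \<in> {a<..<b} - N" for x
      by (rule has_vector_derivative_transform_within_open[of ?F _ _ "{a<..<b}"])
        (use that N(2) in \<open>auto simp: clamp_to_eq\<close>)
  qed (use N(1) g(1) in auto)
qed

text \<open>Two intervals of the family meet in at most finitely many points, so the sum is the integral over
  their union.\<close>

lemma sum_integrals_interval_family_le:
  fixes r :: "real \<Rightarrow> real"
  assumes D: "interval_family {a..b} D" and r: "r integrable_on {a..b}" "\<And>x. 0 \<le> r x"
  shows "(\<Sum>(c, d)\<in>D. integral {c..d} r) \<le> integral {a..b} r"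
proof -
  have sub: "{c..d} \<subseteq> {a..b}" if "(c, d) \<in> D" for c d using interval_familyD(4)[OF D that] .
  have "(r has_integral (\<Sum>x\<in>D. integral {fst x..snd x} r)) (\<Union>x\<in>D. {fst x..snd x})"
  proof (rule has_integral_UN)
    show "finite D" using D interval_family_finite by blast
    fix x assume "x \<in> D"
    then have "{fst x..snd x} \<subseteq> {a..b}" using sub[of "fst x" "snd x"] by simp
    then show "(r has_integral integral {fst x..snd x} r) {fst x..snd x}"
      using integrable_subinterval_real[OF r(1)] by (intro integrable_integral)
  next
    show "pairwise (\<lambda>x y. negligible ({fst x..snd x} \<inter> {fst y..snd y})) D"
    proof (rule pairwiseI)
      fix x y assume xy: "x \<in> D" "y \<in> D" "x \<noteq> y"
      then have "{fst x<..<snd x} \<inter> {fst y<..<snd y} = {}"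
        using interval_family_disjoint[OF D, of "fst x" "snd x" "fst y" "snd y"] by simp
      then have "{fst x..snd x} \<inter> {fst y..snd y} \<subseteq> {fst x, snd x, fst y, snd y}"
        by (force simp: order.order_iff_strict)
      then show "negligible ({fst x..snd x} \<inter> {fst y..snd y})"
        by (rule negligible_subset[rotated]) (simp add: negligible_finite)
    qed
  qed
  moreover have "(\<Union>x\<in>D. {fst x..snd x}) \<subseteq> {a..b}" using sub by fastforce
  ultimately have "(\<Sum>x\<in>D. integral {fst x..snd x} r) \<le> integral {a..b} r"
    using r by (intro has_integral_subset_le[OF _ _ integrable_integral[OF r(1)]]) auto
  then show ?thesis by (simp add: case_prod_unfold)
qed

text \<open>Split \<open>|g|\<close> into a part bounded by \<open>k\<close>, whose integral over a short family is small, and a remainder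
  whose total integral is small for large \<open>k\<close>.\<close>

lemma abs_continuous_on_indefinite_integral:
  fixes g :: "real \<Rightarrow> complex"
  assumes g: "g absolutely_integrable_on {a..b}"
  shows "abs_continuous_on {a..b} (\<lambda>t. integral {a..t} g)"
  unfolding abs_continuous_on_interval_family
proof (intro allI impI)
  fix \<epsilon> :: real assume "\<epsilon> > 0"
  let ?G = "\<lambda>t. cmod (g t)"
  have gi: "g integrable_on {a..b}" and Gi: "?G integrable_on {a..b}"
    using g by (auto simp: absolutely_integrable_on_def)
  define T where "T k t = min (?G t) (real k)" for k :: nat and t
  have Ti: "T k integrable_on {a..b}" for k
  proof -
    have "(\<lambda>t. min (?G t) (real k)) absolutely_integrable_on {a..b}"
      using set_integrable_norm[OF g] by (intro absolutely_integrable_min_1) auto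
    then show ?thesis using set_lebesgue_integral_eq_integral(1) unfolding T_def by blast
  qed
  have "(\<lambda>k. integral {a..b} (T k)) \<longlonglongrightarrow> integral {a..b} ?G"
  proof (rule dominated_convergence(2)[OF Ti Gi])
    show "norm (T k t) \<le> ?G t" for k t by (simp add: T_def)
    show "(\<lambda>k. T k t) \<longlonglongrightarrow> ?G t" for t
    proof (rule tendsto_eventually)
      obtain m :: nat where "?G t \<le> real m" using real_arch_simple by blast
      then show "\<forall>\<^sub>F k in sequentially. T k t = ?G t"
        by (intro eventually_sequentiallyI[of m]) (simp add: T_def)
    qed
  qed
  then obtain k where k: "\<bar>integral {a..b} (T k) - integral {a..b} ?G\<bar> < \<epsilon> / 2"
    using \<open>\<epsilon> > 0\<close> by (auto simp: LIMSEQ_iff dest!: spec[of _ "\<epsilon> / 2"])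
  let ?r = "\<lambda>t. ?G t - T k t"
  have ri: "?r integrable_on {a..b}" using Gi Ti by (intro integrable_diff)
  have "integral {a..b} ?r = integral {a..b} ?G - integral {a..b} (T k)"
    by (rule integral_diff[OF Gi Ti])
  then have rk: "integral {a..b} ?r < \<epsilon> / 2" using k by linarith
  define \<delta> where "\<delta> = \<epsilon> / (2 * (real k + 1))"
  have "\<delta> > 0" using \<open>\<epsilon> > 0\<close> by (simp add: \<delta>_def)
  moreover have "(\<Sum>(c, d)\<in>D. cmod (integral {a..d} g - integral {a..c} g)) < \<epsilon>"
    if D: "interval_family {a..b} D" and len: "(\<Sum>(c, d)\<in>D. d - c) < \<delta>" for D
  proof -
    have "cmod (integral {a..d} g - integral {a..c} g) \<le> integral {c..d} ?r + real k * (d - c)"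
      if "(c, d) \<in> D" for c d
    proof -
      have *: "a \<le> c" "c \<le> d" "d \<le> b" using interval_familyD[OF D that] by auto
      then have sub: "{c..d} \<subseteq> {a..b}" "{a..d} \<subseteq> {a..b}" by auto
      note int = integrable_subinterval_real[OF _ sub(1)]
      have "integral {a..d} g - integral {a..c} g = integral {c..d} g"
        using Henstock_Kurzweil_Integration.integral_combine[OF *(1,2) integrable_subinterval_real[OF gi sub(2)]]
        by (simp add: algebra_simps)
      also have "cmod \<dots> \<le> integral {c..d} (\<lambda>t. ?r t + real k)"
        by (rule integral_norm_bound_integral) (use int gi ri in \<open>auto simp: T_def intro!: integrable_add\<close>)
      also have "\<dots> = integral {c..d} ?r + real k * (d - c)"
        using *(2) by (subst integral_add) (use int ri in auto)
      finally show ?thesis .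
    qed
    then have "(\<Sum>(c, d)\<in>D. cmod (integral {a..d} g - integral {a..c} g))
        \<le> (\<Sum>(c, d)\<in>D. integral {c..d} ?r + real k * (d - c))"
      by (intro sum_mono) auto
    also have "\<dots> = (\<Sum>(c, d)\<in>D. integral {c..d} ?r) + real k * (\<Sum>(c, d)\<in>D. d - c)"
      by (simp add: case_prod_unfold sum.distrib sum_distrib_left)
    also have "(\<Sum>(c, d)\<in>D. integral {c..d} ?r) \<le> integral {a..b} ?r"
      by (rule sum_integrals_interval_family_le[OF D ri]) (simp add: T_def)
    also have "real k * (\<Sum>(c, d)\<in>D. d - c) \<le> real k * \<delta>"
      using len by (intro mult_left_mono) auto
    also have "\<dots> \<le> \<epsilon> / 2" using \<open>\<epsilon> > 0\<close> by (simp add: \<delta>_def field_simps)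
    finally show ?thesis using rk by simp
  qed
  ultimately show "\<exists>\<delta>>0. \<forall>D. interval_family {a..b} D \<and> (\<Sum>(c, d)\<in>D. d - c) < \<delta> \<longrightarrow>
      (\<Sum>(c, d)\<in>D. cmod (integral {a..d} g - integral {a..c} g)) < \<epsilon>" by blast
qed

section \<open>Calculus of locally absolutely continuous functions\<close>

lemma abs_continuous_on_cong:
  assumes "\<And>t. t \<in> S \<Longrightarrow> f t = g t" "abs_continuous_on S f"
  shows "abs_continuous_on S g"
  unfolding abs_continuous_on_interval_family
proof (intro allI impI)
  fix \<epsilon> :: real assume "\<epsilon> > 0"
  obtain \<delta> where \<delta>: "\<delta> > 0" "\<And>D. \<lbrakk>interval_family S D; (\<Sum>(a, b)\<in>D. b - a) < \<delta>\<rbrakk> \<Longrightarrow> (\<Sum>(a, b)\<in>D. cmod (f b - f a)) < \<epsilon>"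
    using abs_continuous_onD[OF assms(2) \<open>\<epsilon> > 0\<close>] by blast
  have "(\<Sum>(a, b)\<in>D. cmod (f b - f a)) = (\<Sum>(a, b)\<in>D. cmod (g b - g a))" if "interval_family S D" for D
    using interval_familyD[OF that] assms(1) by (intro sum.cong) auto
  then show "\<exists>\<delta>>0. \<forall>D. interval_family S D \<and> (\<Sum>(a, b)\<in>D. b - a) < \<delta> \<longrightarrow> (\<Sum>(a, b)\<in>D. cmod (g b - g a)) < \<epsilon>"
    using \<delta> by metis
qed

lemma abs_continuous_on_dominated:
  assumes f: "abs_continuous_on S f" and g: "abs_continuous_on S g" and "M \<ge> 0"
    and le: "\<And>a b. \<lbrakk>a \<in> S; b \<in> S\<rbrakk> \<Longrightarrow> cmod (h b - h a) \<le> M * (cmod (f b - f a) + cmod (g b - g a))"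
  shows "abs_continuous_on S h"
  unfolding abs_continuous_on_interval_family
proof (intro allI impI)
  fix \<epsilon> :: real assume "\<epsilon> > 0"
  define \<eta> where "\<eta> = \<epsilon> / (2 * (M + 1))"
  have "\<eta> > 0" using \<open>\<epsilon> > 0\<close> \<open>M \<ge> 0\<close> by (simp add: \<eta>_def)
  obtain \<delta>1 where \<delta>1: "\<delta>1 > 0" "\<And>D. \<lbrakk>interval_family S D; (\<Sum>(a, b)\<in>D. b - a) < \<delta>1\<rbrakk> \<Longrightarrow> (\<Sum>(a, b)\<in>D. cmod (f b - f a)) < \<eta>"
    using abs_continuous_onD[OF f \<open>\<eta> > 0\<close>] by blast
  obtain \<delta>2 where \<delta>2: "\<delta>2 > 0" "\<And>D. \<lbrakk>interval_family S D; (\<Sum>(a, b)\<in>D. b - a) < \<delta>2\<rbrakk> \<Longrightarrow> (\<Sum>(a, b)\<in>D. cmod (g b - g a)) < \<eta>"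
    using abs_continuous_onD[OF g \<open>\<eta> > 0\<close>] by blast
  have "(\<Sum>(a, b)\<in>D. cmod (h b - h a)) < \<epsilon>"
    if D: "interval_family S D" "(\<Sum>(a, b)\<in>D. b - a) < min \<delta>1 \<delta>2" for D
  proof -
    let ?F = "\<Sum>(a, b)\<in>D. cmod (f b - f a)" and ?G = "\<Sum>(a, b)\<in>D. cmod (g b - g a)"
    have "(\<Sum>(a, b)\<in>D. cmod (h b - h a)) \<le> (\<Sum>(a, b)\<in>D. M * (cmod (f b - f a) + cmod (g b - g a)))"
      using interval_familyD[OF D(1)] le by (intro sum_mono) auto
    also have "\<dots> = M * (?F + ?G)"
      by (simp add: case_prod_unfold sum.distrib sum_distrib_left[symmetric])
    also have "\<dots> \<le> M * (\<eta> + \<eta>)"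
      using \<delta>1(2)[OF D(1)] \<delta>2(2)[OF D(1)] D(2) \<open>M \<ge> 0\<close> by (intro mult_left_mono) auto
    also have "\<dots> = \<epsilon> - 2 * \<eta>" using \<open>M \<ge> 0\<close> by (simp add: \<eta>_def divide_simps) (simp add: algebra_simps)
    also have "\<dots> < \<epsilon>" using \<open>\<eta> > 0\<close> by simp
    finally show ?thesis .
  qed
  then show "\<exists>\<delta>>0. \<forall>D. interval_family S D \<and> (\<Sum>(a, b)\<in>D. b - a) < \<delta> \<longrightarrow> (\<Sum>(a, b)\<in>D. cmod (h b - h a)) < \<epsilon>"
    using \<delta>1(1) \<delta>2(1) by (intro exI[of _ "min \<delta>1 \<delta>2"]) auto
qed

lemma abs_continuous_on_continuous:
  assumes "abs_continuous_on {a..b} f"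
  shows "continuous_on {a..b} f"
  unfolding continuous_on_iff
proof (intro ballI allI impI)
  fix x \<epsilon> :: real assume x: "x \<in> {a..b}" and "\<epsilon> > 0"
  obtain \<delta> where \<delta>: "\<delta> > 0" "\<And>D. \<lbrakk>interval_family {a..b} D; (\<Sum>(a, b)\<in>D. b - a) < \<delta>\<rbrakk> \<Longrightarrow> (\<Sum>(a, b)\<in>D. cmod (f b - f a)) < \<epsilon>"
    using abs_continuous_onD[OF assms \<open>\<epsilon> > 0\<close>] by blast
  have "dist (f y) (f x) < \<epsilon>" if y: "y \<in> {a..b}" "dist y x < \<delta>" for y
  proof (cases "x \<le> y")
    case True
    then show ?thesis using \<delta>(2)[of "{(x, y)}"] interval_family_single[of x y "{a..b}"] x y
      by (auto simp: dist_norm)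
  next
    case False
    then show ?thesis using \<delta>(2)[of "{(y, x)}"] interval_family_single[of y x "{a..b}"] x y
      by (auto simp: dist_norm norm_minus_commute)
  qed
  then show "\<exists>d>0. \<forall>x'\<in>{a..b}. dist x' x < d \<longrightarrow> dist (f x') (f x) < \<epsilon>" using \<delta>(1) by blast
qed

lemma AC_locD: "f \<in> AC_loc \<Longrightarrow> -1 < a \<Longrightarrow> b < 1 \<Longrightarrow> abs_continuous_on {a..b} f"
proof (cases "a \<le> b")
  case False
  have "D = {}" if "interval_family {a..b} D" for D
    using interval_familyD(2)[OF that] False by fastforce
  then show ?thesis unfolding abs_continuous_on_interval_family by (metis sum.empty zero_less_one)
qed (simp add: AC_loc_def)

lemma AC_locI:
  assumes "\<And>a b. \<lbrakk>-1 < a; a \<le> b; b < 1\<rbrakk> \<Longrightarrow> abs_continuous_on {a..b} f"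
  shows "f \<in> AC_loc"
  using assms by (simp add: AC_loc_def)

lemma AC_loc_cong:
  assumes "\<And>t. t \<in> I11 \<Longrightarrow> f t = g t" "f \<in> AC_loc"
  shows "g \<in> AC_loc"
  by (intro AC_locI abs_continuous_on_cong[OF _ AC_locD[OF assms(2)]]) (use assms(1) in auto)

lemma AC_loc_continuous_on:
  assumes "f \<in> AC_loc"
  shows "continuous_on I11 f"
proof -
  have "isCont f x" if x: "x \<in> I11" for x
  proof -
    have "continuous_on {(x - 1) / 2..(x + 1) / 2} f"
      using x by (intro abs_continuous_on_continuous AC_locD[OF assms]) auto
    then show ?thesis
      by (rule continuous_on_interior) (use x in \<open>auto simp: field_simps\<close>)
  qed
  then show ?thesis by (intro continuous_at_imp_continuous_on) auto
qed

lemma AC_loc_add: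
  assumes "f \<in> AC_loc" "g \<in> AC_loc"
  shows "(\<lambda>t. f t + g t) \<in> AC_loc"
proof (rule AC_locI)
  fix a b :: real assume "-1 < a" "b < 1"
  then show "abs_continuous_on {a..b} (\<lambda>t. f t + g t)"
    using norm_triangle_ineq[of "f _ - f _" "g _ - g _"]
    by (intro abs_continuous_on_dominated[OF AC_locD[OF assms(1)] AC_locD[OF assms(2)], of a b 1])
      (auto simp: algebra_simps)
qed

lemma continuous_on_Icc_bounded:
  fixes f :: "real \<Rightarrow> 'a::real_normed_vector"
  assumes "continuous_on {a..b} f"
  shows "\<exists>B. \<forall>t\<in>{a..b}. norm (f t) \<le> B"
  using compact_imp_bounded[OF compact_continuous_image[OF assms compact_Icc]] by (auto simp: bounded_iff)

lemma AC_loc_mult: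
  assumes "f \<in> AC_loc" "g \<in> AC_loc"
  shows "(\<lambda>t. f t * g t) \<in> AC_loc"
proof (rule AC_locI)
  fix a b :: real assume ab: "-1 < a" "b < 1"
  have cont: "continuous_on {a..b} f" "continuous_on {a..b} g"
    using ab AC_locD assms abs_continuous_on_continuous by blast+
  obtain B C where B: "\<And>t. t \<in> {a..b} \<Longrightarrow> cmod (f t) \<le> B" and C: "\<And>t. t \<in> {a..b} \<Longrightarrow> cmod (g t) \<le> C"
    using continuous_on_Icc_bounded[OF cont(1)] continuous_on_Icc_bounded[OF cont(2)] by metis
  let ?M = "\<bar>B\<bar> + \<bar>C\<bar>"
  show "abs_continuous_on {a..b} (\<lambda>t. f t * g t)"
  proof (rule abs_continuous_on_dominated[OF AC_locD[OF assms(1)] AC_locD[OF assms(2)], of a b ?M])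
    fix s t assume st: "s \<in> {a..b}" "t \<in> {a..b}"
    have "f t * g t - f s * g s = g t * (f t - f s) + f s * (g t - g s)" by (simp add: algebra_simps)
    then have "cmod (f t * g t - f s * g s) \<le> cmod (g t) * cmod (f t - f s) + cmod (f s) * cmod (g t - g s)"
      by (metis norm_mult norm_triangle_ineq)
    also have "\<dots> \<le> ?M * cmod (f t - f s) + ?M * cmod (g t - g s)"
      using B[OF st(1)] C[OF st(2)] by (intro add_mono mult_right_mono) auto
    finally show "cmod (f t * g t - f s * g s) \<le> ?M * (cmod (f t - f s) + cmod (g t - g s))"
      by (simp add: algebra_simps)
  qed (use ab in auto)
qed

lemma AC_loc_cnj:
  assumes "f \<in> AC_loc"
  shows "(\<lambda>t. cnj (f t)) \<in> AC_loc"
proof (rule AC_locI)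
  fix a b :: real assume "-1 < a" "b < 1"
  moreover have "cmod (cnj z - cnj w) = cmod (z - w)" for z w
    by (metis complex_cnj_diff complex_mod_cnj)
  ultimately show "abs_continuous_on {a..b} (\<lambda>t. cnj (f t))"
    by (intro abs_continuous_on_dominated[OF AC_locD[OF assms(1)] AC_locD[OF assms(1)], of a b 1]) auto
qed

lemma AC_loc_C1:
  assumes der: "\<And>t. t \<in> I11 \<Longrightarrow> (f has_vector_derivative f' t) (at t)" and cont: "continuous_on I11 f'"
  shows "f \<in> AC_loc"
proof (rule AC_locI)
  fix a b :: real assume ab: "-1 < a" "a \<le> b" "b < 1"
  then have sub: "{a..b} \<subseteq> I11" by auto
  have c: "continuous_on {a..b} f'" using cont sub continuous_on_subset by blast
  have "abs_continuous_on {a..b} (\<lambda>t. integral {a..t} f')"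
    by (intro abs_continuous_on_indefinite_integral absolutely_integrable_continuous_real c)
  then have "abs_continuous_on {a..b} (\<lambda>t. f t - f a)"
  proof (rule abs_continuous_on_cong[rotated])
    fix t assume that: "t \<in> {a..b}"
    show "integral {a..t} f' = f t - f a"
  proof (rule integral_unique, rule fundamental_theorem_of_calculus)
    fix x assume "x \<in> {a..t}"
    then have "x \<in> I11" using that ab by auto
    then show "(f has_vector_derivative f' x) (at x within {a..t})"
      using der has_vector_derivative_at_within by blast
  qed (use that in auto)
  qed
  then show "abs_continuous_on {a..b} f"
    by (simp add: abs_continuous_on_def)
qed

lemma AC_loc_real_C1:
  assumes "\<And>t. t \<in> I11 \<Longrightarrow> (W has_real_derivative W' t) (at t)" and "continuous_on I11 W'"
  shows "(\<lambda>t. complex_of_real (W t)) \<in> AC_loc"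
proof (rule AC_loc_C1)
  show "((\<lambda>t. complex_of_real (W t)) has_vector_derivative complex_of_real (W' t)) (at t)" if "t \<in> I11" for t
    using assms(1)[OF that] by (auto intro!: derivative_eq_intros simp: has_real_derivative_iff_has_vector_derivative)
  show "continuous_on I11 (\<lambda>t. complex_of_real (W' t))" using assms(2) by (intro continuous_intros)
qed

lemma AC_loc_scaleR_C1:
  assumes "\<And>t. t \<in> I11 \<Longrightarrow> (W has_real_derivative W' t) (at t)" and "continuous_on I11 W'" and "f \<in> AC_loc"
  shows "(\<lambda>t. W t *\<^sub>R f t) \<in> AC_loc"
  using AC_loc_mult[OF AC_loc_real_C1[OF assms(1,2)] assms(3)] by (simp add: scaleR_conv_of_real)

lemma AC_loc_scaleR: "f \<in> AC_loc \<Longrightarrow> (\<lambda>t. c *\<^sub>R f t) \<in> AC_loc"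
  by (rule AC_loc_scaleR_C1[of _ "\<lambda>_. 0"]) auto

lemma AC_loc_linear: "f \<in> AC_loc \<Longrightarrow> (\<lambda>t. (c * t) *\<^sub>R f t) \<in> AC_loc"
  by (rule AC_loc_scaleR_C1[of _ "\<lambda>_. c"]) (auto intro!: derivative_eq_intros)

lemma AC_loc_diff: "f \<in> AC_loc \<Longrightarrow> g \<in> AC_loc \<Longrightarrow> (\<lambda>t. f t - g t) \<in> AC_loc"
  using AC_loc_add[OF _ AC_loc_scaleR[of g "-1"], of f] by simp

lemma AE_I11_iff: "(AE t in lebesgue_on I11. P t) \<longleftrightarrow> negligible {t \<in> I11. \<not> P t}"
proof -
  have "(AE t in lebesgue_on I11. P t) \<longleftrightarrow> (AE t in lebesgue. t \<in> I11 \<longrightarrow> P t)"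
    by (subst AE_restrict_space_iff) auto
  also have "\<dots> \<longleftrightarrow> negligible {t. \<not> (t \<in> I11 \<longrightarrow> P t)}"
    unfolding eventually_ae_filter_negligible by (metis (no_types, lifting) negligible_subset order_refl)
  finally show ?thesis by (simp add: conj_commute)
qed

lemma AE_I11_I: "(\<And>t. t \<in> I11 \<Longrightarrow> P t) \<Longrightarrow> AE t in lebesgue_on I11. P t"
  by (rule AE_I2) simp

text \<open>Local information on \<open>(-1, 1)\<close> is available on compact subintervals only; these radii exhaust the
  open interval by countably many of them.\<close>

lemma I11_exhaustion:
  obtains r :: "nat \<Rightarrow> real" where "\<And>n. 0 < r n" "\<And>n. r n < 1" "\<And>n. r n \<le> r (Suc n)"
    "\<And>t. t \<in> I11 \<Longrightarrow> \<forall>\<^sub>F n in sequentially. t \<in> {- r n<..<r n}"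
proof
  define r where "r n = 1 - 1 / (real n + 2)" for n :: nat
  show "0 < r n" "r n < 1" "r n \<le> r (Suc n)" for n by (auto simp: r_def field_simps)
  fix t assume t: "t \<in> I11"
  obtain m :: nat where m: "1 / (1 - \<bar>t\<bar>) < real m" using reals_Archimedean2 by blast
  show "\<forall>\<^sub>F n in sequentially. t \<in> {- r n<..<r n}"
  proof (rule eventually_sequentiallyI)
    fix n assume "m \<le> n"
    then have "1 / (1 - \<bar>t\<bar>) < real n" using m by linarith
    then have "1 / (real n + 2) < 1 - \<bar>t\<bar>" using t by (auto simp: field_simps)
    then show "t \<in> {- r n<..<r n}" by (auto simp: r_def)
  qed
qed

lemma AE_I11_UN:
  assumes "\<And>a b. \<lbrakk>-1 < a; a < b; b < 1\<rbrakk> \<Longrightarrow> \<exists>N. negligible N \<and> (\<forall>t\<in>{a<..<b} - N. P t)"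
  shows "AE t in lebesgue_on I11. P t"
proof -
  obtain r :: "nat \<Rightarrow> real" where r: "\<And>n. 0 < r n" "\<And>n. r n < 1"
    "\<And>t. t \<in> I11 \<Longrightarrow> \<forall>\<^sub>F n in sequentially. t \<in> {- r n<..<r n}"
    using I11_exhaustion by metis
  have "\<exists>N. negligible N \<and> (\<forall>t\<in>{- r n<..<r n} - N. P t)" for n
    using r(1,2)[of n] by (intro assms) auto
  then obtain N where N: "\<And>n. negligible (N n)" "\<And>n t. t \<in> {- r n<..<r n} - N n \<Longrightarrow> P t" by metis
  have ex: "\<exists>n. t \<in> {- r n<..<r n}" if "t \<in> I11" for t
    using eventually_happens'[OF _ r(3)[OF that]] by simp
  have "{t \<in> I11. \<not> P t} \<subseteq> (\<Union>n. N n)"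
  proof
    fix t assume t: "t \<in> {t \<in> I11. \<not> P t}"
    then obtain n where "t \<in> {- r n<..<r n}" using ex[of t] by blast
    then show "t \<in> (\<Union>n. N n)" using N(2)[of t n] t by blast
  qed
  then show ?thesis unfolding AE_I11_iff by (rule negligible_subset[OF negligible_Union_nat[OF N(1)]])
qed

theorem AC_loc_has_vector_derivative_ae:
  assumes "f \<in> AC_loc"
  shows "AE t in lebesgue_on I11. (f has_vector_derivative vector_derivative f (at t)) (at t)"
proof (rule AE_I11_UN)
  fix a b :: real assume ab: "-1 < a" "a < b" "b < 1"
  obtain g N where gN: "negligible N" "\<And>x. x \<in> {a<..<b} - N \<Longrightarrow> (f has_vector_derivative g x) (at x)"
    using abs_continuous_on_imp_integral[OF AC_locD[OF assms ab(1,3)]] ab(2) by (metis less_imp_le)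
  then have "(f has_vector_derivative vector_derivative f (at t)) (at t)" if "t \<in> {a<..<b} - N" for t
    using that by (metis vector_derivative_at)
  then show "\<exists>N. negligible N \<and> (\<forall>t\<in>{a<..<b} - N. (f has_vector_derivative vector_derivative f (at t)) (at t))"
    using gN(1) by blast
qed

text \<open>Two functions that are the derivative almost everywhere have the same integral, so the density obtained from
  absolute continuity can be exchanged for the explicit derivatives of products computed below.\<close>

theorem AC_loc_FTC:
  assumes f: "f \<in> AC_loc" and der: "AE t in lebesgue_on I11. (f has_vector_derivative f' t) (at t)"
    and ab: "-1 < a" "a \<le> b" "b < 1"
  shows "f' absolutely_integrable_on {a..b}" "(f' has_integral f b - f a) {a..b}"
proof -
  obtain g N where gN: "negligible N" "\<And>u v. \<lbrakk>a \<le> u; u \<le> v; v \<le> b\<rbrakk> \<Longrightarrow> g absolutely_integrable_on {u..v}"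
    "\<And>u v. \<lbrakk>a \<le> u; u \<le> v; v \<le> b\<rbrakk> \<Longrightarrow> (g has_integral f v - f u) {u..v}"
    "\<And>x. x \<in> {a<..<b} - N \<Longrightarrow> (f has_vector_derivative g x) (at x)"
    using abs_continuous_on_imp_integral[OF AC_locD[OF f ab(1,3)] ab(2)] by metis
  let ?N = "N \<union> {t \<in> I11. \<not> (f has_vector_derivative f' t) (at t)} \<union> {a, b}"
  have N: "negligible ?N" using gN(1) der[unfolded AE_I11_iff] by (intro negligible_Un) auto
  have eq: "f' x = g x" if x: "x \<in> {a..b} - ?N" for x
  proof -
    have "x \<in> {a<..<b} - N" "x \<in> I11" using x ab by auto
    then have "(f has_vector_derivative f' x) (at x)" "(f has_vector_derivative g x) (at x)"
      using x gN(4) by auto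
    then show ?thesis using vector_derivative_unique_at by blast
  qed
  show "f' absolutely_integrable_on {a..b}"
    by (rule absolutely_integrable_spike[OF gN(2)[OF _ ab(2)] N eq]) auto
  show "(f' has_integral f b - f a) {a..b}"
    by (rule has_integral_spike[OF N eq gN(3)[OF _ ab(2)]]) auto
qed

text \<open>A continuous function that is the derivative almost everywhere is the derivative everywhere. The
  domain of the Legendre operator controls second derivatives only almost everywhere, and this is
  what starts the regularity argument.\<close>

lemma AC_loc_derivative_continuous:
  assumes G: "G \<in> AC_loc" and ae: "AE t in lebesgue_on I11. (G has_vector_derivative q t) (at t)"
    and q: "continuous_on I11 q" and t: "t \<in> I11"
  shows "(G has_vector_derivative q t) (at t)"
proof -
  define a b where "a = (t - 1) / 2" and "b = (t + 1) / 2"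
  have ab: "-1 < a" "a < t" "t < b" "b < 1" using t by (auto simp: a_def b_def)
  have "continuous_on {a..b} q" by (rule continuous_on_subset[OF q]) (use ab in auto)
  then have "((\<lambda>x. integral {a..x} q) has_vector_derivative q t) (at t within {a..b})"
    by (rule integral_has_vector_derivative) (use ab in auto)
  then have "((\<lambda>x. integral {a..x} q) has_vector_derivative q t) (at t)"
    using ab by (simp add: at_within_Icc_at)
  then have "((\<lambda>x. G a + integral {a..x} q) has_vector_derivative 0 + q t) (at t)"
    by (intro has_vector_derivative_add has_vector_derivative_const)
  then have "((\<lambda>x. G a + integral {a..x} q) has_vector_derivative q t) (at t)" by simp
  then show ?thesis
  proof (rule has_vector_derivative_transform_within_open[of _ _ _ "{a<..<b}"])
    fix x assume "x \<in> {a<..<b}"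
    then have "(q has_integral G x - G a) {a..x}"
      using ab by (intro AC_loc_FTC(2)[OF G ae]) auto
    then show "G a + integral {a..x} q = G x" by (simp add: integral_unique)
  qed (use ab in auto)
qed

section \<open>Square-integrable functions\<close>

lemma continuous_on_I11_measurable:
  fixes f :: "real \<Rightarrow> 'a::euclidean_space"
  shows "continuous_on I11 f \<Longrightarrow> f \<in> borel_measurable (lebesgue_on I11)"
  by (intro continuous_imp_measurable_on_sets_lebesgue) auto

lemma measurable_I11_AE:
  fixes f g :: "real \<Rightarrow> complex"
  assumes "f \<in> borel_measurable (lebesgue_on I11)" "AE t in lebesgue_on I11. f t = g t"
  shows "g \<in> borel_measurable (lebesgue_on I11)"
proof -
  have "AE t in lebesgue. (if t \<in> I11 then f t else 0) = (if t \<in> I11 then g t else 0)"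
    using assms(2) by (subst (asm) AE_restrict_space_iff) auto
  then have "(\<lambda>t. if t \<in> I11 then g t else 0) \<in> borel_measurable lebesgue"
    by (rule borel_measurable_AE[rotated]) (intro borel_measurable_if_I assms(1), simp)
  then show ?thesis by (rule borel_measurable_if_D)
qed

lemma L2_iff: "f \<in> L2 \<longleftrightarrow> f \<in> borel_measurable (lebesgue_on I11) \<and> (\<lambda>t. (cmod (f t))\<^sup>2) integrable_on I11"
proof -
  have "integrable (lebesgue_on I11) (\<lambda>t. (cmod (f t))\<^sup>2) \<longleftrightarrow> (\<lambda>t. (cmod (f t))\<^sup>2) absolutely_integrable_on I11"
    unfolding set_integrable_def by (subst integrable_restrict_space) auto
  also have "\<dots> \<longleftrightarrow> (\<lambda>t. (cmod (f t))\<^sup>2) integrable_on I11"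
    by (rule absolutely_integrable_on_iff_nonneg) auto
  finally show ?thesis by (simp add: L2_def)
qed

lemma L2_measurable: "f \<in> L2 \<Longrightarrow> f \<in> borel_measurable (lebesgue_on I11)"
  by (simp add: L2_iff)

lemma L2I_dominated:
  assumes f: "f \<in> borel_measurable (lebesgue_on I11)" and g: "g integrable_on I11"
    and le: "\<And>t. t \<in> I11 \<Longrightarrow> (cmod (f t))\<^sup>2 \<le> g t"
  shows "f \<in> L2"
proof -
  have "(\<lambda>t. (cmod (f t))\<^sup>2) \<in> borel_measurable (lebesgue_on I11)" using f by measurable
  then have "(\<lambda>t. (cmod (f t))\<^sup>2) absolutely_integrable_on I11"
    by (rule measurable_bounded_by_integrable_imp_absolutely_integrable[OF _ _ g]) (use le in auto)
  then show ?thesis using f by (simp add: L2_iff absolutely_integrable_on_def)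
qed

lemma L2_AE:
  assumes "f \<in> L2" "AE t in lebesgue_on I11. f t = g t"
  shows "g \<in> L2"
proof -
  have "g \<in> borel_measurable (lebesgue_on I11)"
    by (rule measurable_I11_AE[OF L2_measurable[OF assms(1)] assms(2)])
  moreover have "(\<lambda>t. (cmod (g t))\<^sup>2) integrable_on I11"
  proof (rule integrable_spike)
    show "(\<lambda>t. (cmod (f t))\<^sup>2) integrable_on I11" using assms(1) by (simp add: L2_iff)
    show "negligible {t \<in> I11. f t \<noteq> g t}" using assms(2) by (simp add: AE_I11_iff)
  qed auto
  ultimately show ?thesis by (simp add: L2_iff)
qed

lemma L2_cong: "f \<in> L2 \<Longrightarrow> (\<And>t. t \<in> I11 \<Longrightarrow> f t = g t) \<Longrightarrow> g \<in> L2"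
  by (rule L2_AE[OF _ AE_I11_I])

lemma L2_add:
  assumes "f \<in> L2" "g \<in> L2"
  shows "(\<lambda>t. f t + g t) \<in> L2"
proof (rule L2I_dominated)
  show "(\<lambda>t. f t + g t) \<in> borel_measurable (lebesgue_on I11)"
    using L2_measurable[OF assms(1)] L2_measurable[OF assms(2)] by measurable
  show "(\<lambda>t. 2 * (cmod (f t))\<^sup>2 + 2 * (cmod (g t))\<^sup>2) integrable_on I11"
    using assms by (intro integrable_add integrable_on_mult_right) (auto simp: L2_iff)
  fix t
  have "(cmod (f t + g t))\<^sup>2 \<le> (cmod (f t) + cmod (g t))\<^sup>2"
    by (intro power_mono norm_triangle_ineq) auto
  also have "\<dots> \<le> 2 * (cmod (f t))\<^sup>2 + 2 * (cmod (g t))\<^sup>2"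
    using sum_squares_bound[of "cmod (f t)" "cmod (g t)"] by (simp add: power2_sum)
  finally show "(cmod (f t + g t))\<^sup>2 \<le> 2 * (cmod (f t))\<^sup>2 + 2 * (cmod (g t))\<^sup>2" .
qed

lemma L2_bounded_scaleR:
  assumes "f \<in> L2" and w: "continuous_on I11 w" "\<And>t. t \<in> I11 \<Longrightarrow> \<bar>w t\<bar> \<le> C"
  shows "(\<lambda>t. w t *\<^sub>R f t) \<in> L2"
proof (rule L2I_dominated)
  show "(\<lambda>t. w t *\<^sub>R f t) \<in> borel_measurable (lebesgue_on I11)"
    using L2_measurable[OF assms(1)] continuous_on_I11_measurable[OF w(1)] by measurable
  show "(\<lambda>t. C\<^sup>2 * (cmod (f t))\<^sup>2) integrable_on I11"
    using assms(1) by (intro integrable_on_mult_right) (auto simp: L2_iff)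
  fix t assume "t \<in> I11"
  then have "\<bar>w t\<bar>\<^sup>2 \<le> C\<^sup>2" using w(2) by (intro power_mono) auto
  then show "(cmod (w t *\<^sub>R f t))\<^sup>2 \<le> C\<^sup>2 * (cmod (f t))\<^sup>2"
    by (simp add: power_mult_distrib mult_right_mono)
qed

lemma L2_scaleR: "f \<in> L2 \<Longrightarrow> (\<lambda>t. c *\<^sub>R f t) \<in> L2"
  by (rule L2_bounded_scaleR[of f "\<lambda>_. c" "\<bar>c\<bar>"]) auto

lemma L2_diff: "f \<in> L2 \<Longrightarrow> g \<in> L2 \<Longrightarrow> (\<lambda>t. f t - g t) \<in> L2"
  using L2_add[OF _ L2_scaleR[of g "-1"], of f] by simp

lemma L2_linear: "f \<in> L2 \<Longrightarrow> (\<lambda>t. (c * t) *\<^sub>R f t) \<in> L2"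
proof (rule L2_bounded_scaleR[of f _ "\<bar>c\<bar>"])
  show "continuous_on I11 (\<lambda>t. c * t)" by (intro continuous_intros)
  show "\<bar>c * t\<bar> \<le> \<bar>c\<bar>" if "t \<in> I11" for t
  proof -
    have "\<bar>t\<bar> \<le> 1" using that by auto
    then show ?thesis using mult_left_mono[of "\<bar>t\<bar>" 1 "\<bar>c\<bar>"] by (simp add: abs_mult)
  qed
qed

lemma const_integrable_I11: "(\<lambda>t. c::real) integrable_on I11"
  by (rule integrable_on_const) (metis box_real(1) lmeasurable_box)

lemma L2_bounded:
  assumes "continuous_on I11 f" "\<And>t. t \<in> I11 \<Longrightarrow> cmod (f t) \<le> C"
  shows "f \<in> L2"
proof (rule L2I_dominated)
  show "f \<in> borel_measurable (lebesgue_on I11)" by (rule continuous_on_I11_measurable[OF assms(1)])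
  show "(\<lambda>t. C\<^sup>2) integrable_on I11" by (rule const_integrable_I11)
  show "(cmod (f t))\<^sup>2 \<le> C\<^sup>2" if "t \<in> I11" for t
    using assms(2)[OF that] by (intro power_mono) auto
qed

lemma L2_absolutely_integrable:
  assumes "f \<in> L2"
  shows "f absolutely_integrable_on I11"
proof (rule measurable_bounded_by_integrable_imp_absolutely_integrable)
  show "f \<in> borel_measurable (lebesgue_on I11)" by (rule L2_measurable[OF assms])
  show "(\<lambda>t. 1 + (cmod (f t))\<^sup>2) integrable_on I11"
    using assms const_integrable_I11 by (intro integrable_add) (auto simp: L2_iff)
  show "cmod (f t) \<le> 1 + (cmod (f t))\<^sup>2" for t
    using sum_squares_bound[of 1 "cmod (f t)"] norm_ge_zero[of "f t"] by (simp, linarith)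
qed simp

lemma L2_integral_subinterval:
  assumes "f \<in> L2" "-1 < a" "b < 1"
  shows "(\<lambda>t. (cmod (f t))\<^sup>2) integrable_on {a..b}"
    "integral {a..b} (\<lambda>t. (cmod (f t))\<^sup>2) \<le> integral I11 (\<lambda>t. (cmod (f t))\<^sup>2)"
proof -
  have sub: "{a..b} \<subseteq> I11" using assms by auto
  have i: "(\<lambda>t. (cmod (f t))\<^sup>2) integrable_on I11" using assms(1) by (simp add: L2_iff)
  then show j: "(\<lambda>t. (cmod (f t))\<^sup>2) integrable_on {a..b}" 
    using integrable_on_subinterval[OF i sub] by simp
  show "integral {a..b} (\<lambda>t. (cmod (f t))\<^sup>2) \<le> integral I11 (\<lambda>t. (cmod (f t))\<^sup>2)"
    using sub i j by (intro integral_subset_le) auto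
qed

text \<open>Both Hardy inequalities bound integrals over \<open>[-r, r]\<close> uniformly in \<open>r\<close>; monotone convergence turns
  this into square integrability.\<close>

lemma L2I_exhaustion:
  assumes meas: "f \<in> borel_measurable (lebesgue_on I11)"
    and int: "\<And>r. \<lbrakk>0 < r; r < 1\<rbrakk> \<Longrightarrow> (\<lambda>t. (cmod (f t))\<^sup>2) integrable_on {-r..r}"
    and le: "\<And>r. \<lbrakk>0 < r; r < 1\<rbrakk> \<Longrightarrow> integral {-r..r} (\<lambda>t. (cmod (f t))\<^sup>2) \<le> K"
  shows "f \<in> L2"
proof -
  obtain r :: "nat \<Rightarrow> real" where r: "\<And>n. 0 < r n" "\<And>n. r n < 1" "\<And>n. r n \<le> r (Suc n)"
    "\<And>t. t \<in> I11 \<Longrightarrow> \<forall>\<^sub>F n in sequentially. t \<in> {- r n<..<r n}"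
    using I11_exhaustion by metis
  let ?q = "\<lambda>t. (cmod (f t))\<^sup>2"
  have sub: "{- r n..r n} \<subseteq> I11" for n using r(2)[of n] by auto
  have "?q integrable_on I11 \<and> (\<lambda>n. integral I11 (\<lambda>t. if t \<in> {- r n..r n} then ?q t else 0)) \<longlonglongrightarrow> integral I11 ?q"
  proof (rule monotone_convergence_increasing)
    show "(\<lambda>t. if t \<in> {- r n..r n} then ?q t else 0) integrable_on I11" for n
      using int[OF r(1,2)] integrable_restrict_Int[of "{- r n..r n}" ?q I11] sub[of n] by (simp only: Int_absorb2)
    show "(if t \<in> {- r n..r n} then ?q t else 0) \<le> (if t \<in> {- r (Suc n)..r (Suc n)} then ?q t else 0)" for n t
      using r(3)[of n] by auto
    show "(\<lambda>n. if t \<in> {- r n..r n} then ?q t else 0) \<longlonglongrightarrow> ?q t" if "t \<in> I11" for t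
      by (rule tendsto_eventually, rule eventually_mono[OF r(4)[OF that]]) simp
    have "integral I11 (\<lambda>t. if t \<in> {- r n..r n} then ?q t else 0) = integral {- r n..r n} ?q" for n
      using integral_restrict_Int[of I11 "{- r n..r n}" ?q] sub[of n] by (simp only: Int_absorb1 Int_absorb2)
    moreover have "\<bar>integral {- r n..r n} ?q\<bar> \<le> K" for n
      using le[OF r(1,2), of n] integral_nonneg[OF int[OF r(1,2), of n]] by simp
    ultimately show "bounded (range (\<lambda>n. integral I11 (\<lambda>t. if t \<in> {- r n..r n} then ?q t else 0)))"
      by (auto simp: bounded_iff intro!: exI[of _ K])
  qed
  then show ?thesis using meas by (simp add: L2_iff)
qed

section \<open>Two weighted Hardy inequalities\<close>

text \<open>Written \<open>p\<close> in the comments.\<close>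

abbreviation (input) wt :: "real \<Rightarrow> real" where "wt t \<equiv> 1 - t\<^sup>2"

lemma wt_pos: "t \<in> I11 \<Longrightarrow> 0 < wt t"
  using abs_square_less_1[of t] by auto

lemma wt_nonzero: "\<forall>t\<in>I11. wt t \<noteq> 0"
  using wt_pos by (metis less_irrefl)

lemma wt_power_derivative: "((\<lambda>t. wt t ^ m) has_real_derivative real m * wt t ^ (m - 1) * (- 2 * t)) (at t)"
  by (auto intro!: derivative_eq_intros)

lemma wt_derivative: "(wt has_real_derivative - 2 * t) (at t)"
  by (auto intro!: derivative_eq_intros)

lemma inverse_wt_derivative:
  "t \<in> I11 \<Longrightarrow> ((\<lambda>t. inverse (wt t)) has_real_derivative 2 * t * inverse (wt t) ^ 2) (at t)"
  using wt_nonzero by (auto intro!: derivative_eq_intros simp: power2_eq_square)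

lemma L2_wt_power: "f \<in> L2 \<Longrightarrow> (\<lambda>t. wt t ^ m *\<^sub>R f t) \<in> L2"
proof (rule L2_bounded_scaleR[of f _ 1])
  show "continuous_on I11 (\<lambda>t. wt t ^ m)" by (intro continuous_intros)
  show "\<bar>wt t ^ m\<bar> \<le> 1" if "t \<in> I11" for t
    using wt_pos[OF that] by (simp add: power_abs power_le_one)
qed

lemma L2_wt: "f \<in> L2 \<Longrightarrow> (\<lambda>t. wt t *\<^sub>R f t) \<in> L2"
  using L2_wt_power[of f 1] by simp

lemma AC_loc_wt_power: "f \<in> AC_loc \<Longrightarrow> (\<lambda>t. wt t ^ m *\<^sub>R f t) \<in> AC_loc"
  by (rule AC_loc_scaleR_C1[OF wt_power_derivative]) (auto intro!: continuous_intros)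

lemma AC_loc_wt: "f \<in> AC_loc \<Longrightarrow> (\<lambda>t. wt t *\<^sub>R f t) \<in> AC_loc"
  using AC_loc_wt_power[of f 1] by simp

lemma AC_loc_divide_wt: "f \<in> AC_loc \<Longrightarrow> (\<lambda>t. inverse (wt t) *\<^sub>R f t) \<in> AC_loc"
  by (rule AC_loc_scaleR_C1[OF inverse_wt_derivative]) (auto intro!: continuous_intros wt_nonzero)

text \<open>The integrated derivative of \<open>W |g|\<^sup>2\<close>, which is locally absolutely continuous as a product.\<close>

lemma energy_identity:
  assumes g: "g \<in> AC_loc" and der: "AE t in lebesgue_on I11. (g has_vector_derivative g' t) (at t)"
    and W: "\<And>t. t \<in> I11 \<Longrightarrow> (W has_real_derivative W' t) (at t)" "continuous_on I11 W'"
    and ab: "-1 < a" "a \<le> b" "b < 1"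
  shows "((\<lambda>t. W' t * (cmod (g t))\<^sup>2 + 2 * W t * Re (cnj (g t) * g' t)) has_integral
            W b * (cmod (g b))\<^sup>2 - W a * (cmod (g a))\<^sup>2) {a..b}"
proof -
  let ?F = "\<lambda>t. complex_of_real (W t) * (g t * cnj (g t))"
  let ?F' = "\<lambda>t. complex_of_real (W t) * (g t * cnj (g' t) + g' t * cnj (g t)) + complex_of_real (W' t) * (g t * cnj (g t))"
  have "?F \<in> AC_loc" by (intro AC_loc_mult AC_loc_cnj AC_loc_real_C1[OF W] g)
  moreover have "AE t in lebesgue_on I11. (?F has_vector_derivative ?F' t) (at t)"
    using der AE_space
  proof eventually_elim
    case (elim t)
    then have "((\<lambda>t. complex_of_real (W t)) has_vector_derivative complex_of_real (W' t)) (at t)"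
      using W(1)[of t] by (auto intro!: derivative_eq_intros simp: has_real_derivative_iff_has_vector_derivative)
    then show ?case using elim by (intro has_vector_derivative_mult has_vector_derivative_cnj)
  qed
  ultimately have "(?F' has_integral ?F b - ?F a) {a..b}" by (rule AC_loc_FTC(2)[OF _ _ ab])
  from has_integral_Re[OF this] show ?thesis
  proof (rule has_integral_eq_rhs[OF has_integral_eq, rotated])
    have sq: "g t * cnj (g t) = complex_of_real ((cmod (g t))\<^sup>2)" for t by (rule complex_norm_square[symmetric])
    show "W b * (cmod (g b))\<^sup>2 - W a * (cmod (g a))\<^sup>2 = Re (?F b - ?F a)" unfolding sq by simp
    show "Re (?F' t) = W' t * (cmod (g t))\<^sup>2 + 2 * W t * Re (cnj (g t) * g' t)" if "t \<in> {a..b}" for t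
      unfolding sq by (simp add: algebra_simps)
  qed
qed

lemma Re_cnj_mult_le: "\<bar>Re (cnj z * w)\<bar> \<le> cmod z * cmod w"
  using abs_Re_le_cmod[of "cnj z * w"] by (simp add: norm_mult)

text \<open>Take \<open>W = t p\<^bsup>2m+1\<^esup>\<close> in the energy identity. Its derivative is close to \<open>-(4m+2) p\<^bsup>2m\<^esup>\<close> near both endpoints,
  while the boundary term \<open>W(r) |g(r)|\<^sup>2 - W(-r) |g(-r)|\<^sup>2\<close> is nonnegative. Hence the integral of
  \<open>p\<^bsup>2m\<^esup> |g|\<^sup>2\<close> is bounded by the cross term, which is absorbed by the inequality
  \<open>2 x y \<le> x\<^sup>2 / 2 + 2 y\<^sup>2\<close>, and by the contribution of a fixed compact interval.\<close>

lemma Hardy_lower_weight: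
  assumes g: "g \<in> AC_loc" and der: "AE t in lebesgue_on I11. (g has_vector_derivative g' t) (at t)"
    and L2: "(\<lambda>t. wt t ^ Suc m *\<^sub>R g' t) \<in> L2"
  shows "(\<lambda>t. wt t ^ m *\<^sub>R g t) \<in> L2"
proof -
  let ?X = "\<lambda>t. (cmod (wt t ^ m *\<^sub>R g t))\<^sup>2" and ?Y = "\<lambda>t. (cmod (wt t ^ Suc m *\<^sub>R g' t))\<^sup>2"
  have gc: "continuous_on I11 g" by (rule AC_loc_continuous_on[OF g])
  have Xc: "continuous_on I11 ?X" by (intro continuous_intros gc)
  \<comment> \<open>Outside this compact interval \<open>p \<le> 1/6\<close>, since \<open>(12/13)\<^sup>2 > 5/6\<close>.\<close>
  have "continuous_on {-12/13..12/13} ?X" by (rule continuous_on_subset[OF Xc]) auto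
  then obtain C where C: "\<And>t. t \<in> {-12/13..12/13} \<Longrightarrow> ?X t \<le> C"
    using continuous_on_Icc_bounded by fastforce
  have "C \<ge> 0" using C[of 0] by (simp, smt (verit) zero_le_power2)
  define W where "W t = t * wt t ^ (2 * m + 1)" for t
  define W' where "W' t = wt t ^ (2 * m) * (wt t - (4 * real m + 2) * t\<^sup>2)" for t
  have W: "(W has_real_derivative W' t) (at t)" for t
  proof -
    have "((\<lambda>t. t * wt t ^ N) has_real_derivative wt t ^ N + t * (real N * wt t ^ (N - 1) * (- 2 * t))) (at t)" for N
      by (auto intro!: derivative_eq_intros)
    from this[of "2 * m + 1"] show ?thesis
      unfolding W_def[abs_def] W'_def by (simp add: algebra_simps power2_eq_square)
  qed
  have W'c: "continuous_on I11 W'" unfolding W'_def[abs_def] by (intro continuous_intros)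
  let ?Q = "\<lambda>t. W' t * (cmod (g t))\<^sup>2 + 2 * W t * Re (cnj (g t) * g' t)"
  let ?K = "integral I11 ?Y"
  have ptw: "?Q t \<le> 2 * ?Y t + 5 / 2 * C - ?X t" if t: "t \<in> I11" for t
  proof -
    let ?p = "wt t"
    have p: "0 < ?p" "?p \<le> 1" using wt_pos[OF t] by auto
    let ?x = "?p ^ m * cmod (g t)" and ?y = "?p ^ Suc m * cmod (g' t)"
    have X: "?X t = ?x\<^sup>2" and Y: "?Y t = ?y\<^sup>2" using p by (simp_all add: abs_mult power_abs)
    have 1: "W' t * (cmod (g t))\<^sup>2 = ?x\<^sup>2 * (?p - (4 * real m + 2) * (1 - ?p))"
      by (simp add: W'_def power_mult_distrib power_mult[symmetric] mult.commute[of 2 m] algebra_simps)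
    have "2 * W t * Re (cnj (g t) * g' t) \<le> \<bar>2 * W t * Re (cnj (g t) * g' t)\<bar>" by simp
    also have "\<dots> = 2 * \<bar>t\<bar> * ?p ^ (2 * m + 1) * \<bar>Re (cnj (g t) * g' t)\<bar>"
      using p by (simp add: W_def abs_mult power_abs)
    also have "\<dots> \<le> 2 * 1 * ?p ^ (2 * m + 1) * (cmod (g t) * cmod (g' t))"
      using t p Re_cnj_mult_le[of "g t" "g' t"] by (intro mult_mono) auto
    also have "\<dots> = 2 * ?x * ?y"
    proof -
      have "?p ^ (2 * m + 1) = ?p ^ m * ?p ^ Suc m"
        unfolding power_add[symmetric] by (rule arg_cong[of _ _ "\<lambda>n. ?p ^ n"]) simp
      then show ?thesis by (simp only: mult_1_right ac_simps)
    qed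
    also have "\<dots> \<le> ?x\<^sup>2 / 2 + 2 * ?y\<^sup>2"
      using zero_le_power2[of "?x - 2 * ?y"] by (simp add: power2_diff power_mult_distrib)
    finally have 2: "2 * W t * Re (cnj (g t) * g' t) \<le> ?x\<^sup>2 / 2 + 2 * ?y\<^sup>2" .
    have "(4 * real m + 2) * (1 - ?p) \<ge> 2 * (1 - ?p)" using p by (intro mult_right_mono) auto
    then have "?x\<^sup>2 * (?p - (4 * real m + 2) * (1 - ?p)) \<le> ?x\<^sup>2 * (3 * ?p - 2)"
      by (intro mult_left_mono) auto
    moreover have "A * (3 * q - 2) + A / 2 = A * (3 * q - 3 / 2)" for A q :: real
      by (simp add: field_simps)
    ultimately have 3: "?Q t \<le> ?x\<^sup>2 * (3 * ?p - 3 / 2) + 2 * ?y\<^sup>2" using 1 2 by (smt (verit))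
    \<comment> \<open>Near the endpoints the factor is at most -1; elsewhere it is at most 3/2 and \<open>C\<close> bounds the rest.\<close>
    have "?x\<^sup>2 * (3 * ?p - 3 / 2) \<le> 5 / 2 * C - ?x\<^sup>2"
    proof (cases "?p \<le> 1 / 6")
      case True
      then have "?x\<^sup>2 * (3 * ?p - 3 / 2) \<le> ?x\<^sup>2 * (- 1)" by (intro mult_left_mono) auto
      then show ?thesis using \<open>C \<ge> 0\<close> by simp
    next
      case False
      then have "t\<^sup>2 \<le> (12 / 13)\<^sup>2" by (simp add: power_divide)
      then have "\<bar>t\<bar> \<le> 12 / 13" using abs_le_square_iff[of t "12 / 13"] by simp
      then have "t \<in> {-12/13..12/13}" by (auto simp: abs_le_iff)
      then have "?x\<^sup>2 \<le> C" using C X by metis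
      moreover have "?x\<^sup>2 * (3 * ?p - 3 / 2) \<le> ?x\<^sup>2 * (3 / 2)" using p by (intro mult_left_mono) auto
      ultimately show ?thesis by simp
    qed
    then show ?thesis using 3 X Y by simp
  qed
  show ?thesis
  proof (rule L2I_exhaustion)
    show "(\<lambda>t. wt t ^ m *\<^sub>R g t) \<in> borel_measurable (lebesgue_on I11)"
      by (intro continuous_on_I11_measurable continuous_intros gc)
    fix r :: real assume r: "0 < r" "r < 1"
    have "continuous_on {-r..r} ?X" by (rule continuous_on_subset[OF Xc]) (use r in auto)
    then show Xi: "?X integrable_on {-r..r}" by (rule integrable_continuous_real)
    have Yi: "?Y integrable_on {-r..r}" "integral {-r..r} ?Y \<le> ?K"
      using L2_integral_subinterval[OF L2, of "-r" r] r by auto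
    let ?Z = "\<lambda>t. 2 * ?Y t + 5 / 2 * C - ?X t"
    have "((\<lambda>t. 5 / 2 * C) has_integral 2 * r * (5 / 2 * C)) {-r..r}"
      using has_integral_const_real[of "5 / 2 * C" "-r" r] r by simp
    then have Zi: "(?Z has_integral 2 * integral {-r..r} ?Y + 2 * r * (5 / 2 * C) - integral {-r..r} ?X) {-r..r}"
      by (intro has_integral_diff has_integral_add has_integral_mult_right integrable_integral Xi Yi)
    have "W r * (cmod (g r))\<^sup>2 - W (- r) * (cmod (g (- r)))\<^sup>2
        \<le> 2 * integral {-r..r} ?Y + 2 * r * (5 / 2 * C) - integral {-r..r} ?X"
      by (rule has_integral_le[OF energy_identity[OF g der W W'c] Zi]) (use r ptw in auto)
    moreover have "0 \<le> W r * (cmod (g r))\<^sup>2 - W (- r) * (cmod (g (- r)))\<^sup>2"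
      using r wt_pos[of r] by (simp add: W_def)
    moreover have "2 * r * (5 / 2 * C) \<le> 5 * C" using r \<open>C \<ge> 0\<close> mult_left_mono[of r 1 C] by simp
    ultimately show "integral {-r..r} ?X \<le> 2 * ?K + 5 * C" using Yi(2) by linarith
  qed
qed

text \<open>A Cauchy-Schwarz estimate on an interval of length at most \<open>P\<close> on which \<open>p \<le> P\<close>. It uses
  \<open>2 |u| \<le> 1 / sqrt P + |u|\<^sup>2 sqrt P\<close>, whose two terms have integrals of the same order
  \<open>sqrt P\<close>.\<close>

lemma weighted_increment_bound:
  assumes v: "v \<in> AC_loc" and der: "AE t in lebesgue_on I11. (v has_vector_derivative wt t ^ n *\<^sub>R u t) (at t)"
    and u: "u \<in> L2" and xy: "-1 < x" "x \<le> y" "y < 1"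
    and P: "0 < P" "y - x \<le> P" "\<And>t. t \<in> {x..y} \<Longrightarrow> wt t \<le> P"
  shows "cmod (v y - v x) \<le> P ^ n * sqrt P * ((1 + integral I11 (\<lambda>t. (cmod (u t))\<^sup>2)) / 2)"
proof -
  let ?K = "integral I11 (\<lambda>t. (cmod (u t))\<^sup>2)" and ?k = "integral {x..y} (\<lambda>t. (cmod (u t))\<^sup>2)"
  let ?h = "\<lambda>t. P ^ n * (1 / sqrt P + sqrt P * (cmod (u t))\<^sup>2) / 2"
  have s: "0 < sqrt P" using P(1) by simp
  have ui: "(\<lambda>t. (cmod (u t))\<^sup>2) integrable_on {x..y}" and uK: "?k \<le> ?K"
    using L2_integral_subinterval[OF u xy(1,3)] by auto
  have "((\<lambda>t. 1 / sqrt P) has_integral (y - x) * (1 / sqrt P)) {x..y}"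
    using has_integral_const_real[of "1 / sqrt P" x y] xy(2) by simp
  then have hI: "(?h has_integral P ^ n * ((y - x) * (1 / sqrt P) + sqrt P * ?k) / 2) {x..y}"
    by (intro has_integral_divide has_integral_mult_right has_integral_add integrable_integral ui)
  have vI: "((\<lambda>t. wt t ^ n *\<^sub>R u t) has_integral v y - v x) {x..y}"
    by (rule AC_loc_FTC(2)[OF v der xy])
  have "cmod (integral {x..y} (\<lambda>t. wt t ^ n *\<^sub>R u t)) \<le> integral {x..y} ?h"
  proof (rule integral_norm_bound_integral)
    fix t assume t: "t \<in> {x..y}"
    then have "0 < wt t" using wt_pos[of t] xy by auto
    then have "cmod (wt t ^ n *\<^sub>R u t) = wt t ^ n * cmod (u t)" by (simp add: abs_of_pos power_abs)
    also have "\<dots> \<le> P ^ n * cmod (u t)"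
      using \<open>0 < wt t\<close> P(3)[OF t] by (intro mult_right_mono power_mono) auto
    also have "\<dots> \<le> P ^ n * ((1 / sqrt P + sqrt P * (cmod (u t))\<^sup>2) / 2)"
    proof (rule mult_left_mono)
      have "0 \<le> (sqrt P * cmod (u t) - 1)\<^sup>2 / sqrt P" using s by simp
      also have "\<dots> = sqrt P * (cmod (u t))\<^sup>2 - 2 * cmod (u t) + 1 / sqrt P"
        using s by (simp add: power2_eq_square field_simps)
      finally show "cmod (u t) \<le> (1 / sqrt P + sqrt P * (cmod (u t))\<^sup>2) / 2" by simp
    qed (use P(1) in simp)
    finally show "cmod (wt t ^ n *\<^sub>R u t) \<le> ?h t" by simp
  qed (use hI vI in \<open>blast intro: has_integral_integrable\<close>)+
  then have "cmod (v y - v x) \<le> P ^ n * ((y - x) * (1 / sqrt P) + sqrt P * ?k) / 2"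
    unfolding integral_unique[OF vI] integral_unique[OF hI] .
  also have "\<dots> = P ^ n * (((y - x) * (1 / sqrt P) + sqrt P * ?k) / 2)" by simp
  also have "\<dots> \<le> P ^ n * ((sqrt P + sqrt P * ?K) / 2)"
  proof (intro mult_left_mono divide_right_mono add_mono)
    have "(y - x) * (1 / sqrt P) \<le> P * (1 / sqrt P)" using P(2) s by (intro mult_right_mono) auto
    then show "(y - x) * (1 / sqrt P) \<le> sqrt P" using P(1) by (simp add: real_div_sqrt)
  qed (use uK s P(1) in auto)
  also have "\<dots> = P ^ n * sqrt P * ((1 + ?K) / 2)" by (simp add: field_simps)
  finally show ?thesis .
qed

text \<open>Let the other end of the interval in the previous estimate tend to the endpoint nearer to \<open>t\<close>. On the
  way there \<open>p\<close> is at most \<open>p(t)\<close>, and the distance is at most \<open>p(t)\<close> too.\<close>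

lemma endpoint_decay:
  assumes v: "v \<in> AC_loc" and der: "AE t in lebesgue_on I11. (v has_vector_derivative wt t ^ n *\<^sub>R u t) (at t)"
    and u: "u \<in> L2" and lim: "(v \<longlongrightarrow> 0) (at_left 1)" "(v \<longlongrightarrow> 0) (at_right (-1))"
    and t: "t \<in> I11"
  shows "cmod (v t) \<le> wt t ^ n * sqrt (wt t) * ((1 + integral I11 (\<lambda>t. (cmod (u t))\<^sup>2)) / 2)"
proof (cases "t \<ge> 0")
  case True
  have bound: "cmod (v s - v t) \<le> wt t ^ n * sqrt (wt t) * ((1 + integral I11 (\<lambda>t. (cmod (u t))\<^sup>2)) / 2)"
    if "s \<in> {t<..<1}" for s
  proof (rule weighted_increment_bound[OF v der u _ _ _ wt_pos[OF t]])
    have "wt t = (1 - t) * (1 + t)" by (simp add: power2_eq_square algebra_simps)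
    also have "\<dots> \<ge> (1 - t) * 1" using t True by (intro mult_left_mono) auto
    finally show "s - t \<le> wt t" using that by auto
    show "wt x \<le> wt t" if "x \<in> {t..s}" for x using that True by (auto intro: power_mono)
  qed (use t that in auto)
  have "((\<lambda>s. cmod (v s - v t)) \<longlongrightarrow> cmod (0 - v t)) (at_left 1)" by (intro tendsto_intros lim)
  moreover have "\<forall>\<^sub>F s in at_left 1. s \<in> {t<..<1}" using t by (intro eventually_at_left_real) auto
  then have "\<forall>\<^sub>F s in at_left 1. cmod (v s - v t) \<le> wt t ^ n * sqrt (wt t) * ((1 + integral I11 (\<lambda>t. (cmod (u t))\<^sup>2)) / 2)"
    by (rule eventually_mono) (rule bound)
  ultimately show ?thesis using tendsto_upperbound[OF _ _ trivial_limit_at_left_real] by fastforce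
next
  case False
  have bound: "cmod (v t - v s) \<le> wt t ^ n * sqrt (wt t) * ((1 + integral I11 (\<lambda>t. (cmod (u t))\<^sup>2)) / 2)"
    if "s \<in> {-1<..<t}" for s
  proof (rule weighted_increment_bound[OF v der u _ _ _ wt_pos[OF t]])
    have "wt t = (1 + t) * (1 - t)" by (simp add: power2_eq_square algebra_simps)
    also have "\<dots> \<ge> (1 + t) * 1" using t False by (intro mult_left_mono) auto
    finally show "t - s \<le> wt t" using that by auto
    show "wt x \<le> wt t" if "x \<in> {s..t}" for x 
      using that False power_mono[of "-t" "-x" 2] by auto
  qed (use t that in auto)
  have "((\<lambda>s. cmod (v t - v s)) \<longlongrightarrow> cmod (v t - 0)) (at_right (-1))" by (intro tendsto_intros lim)
  moreover have "\<forall>\<^sub>F s in at_right (-1). s \<in> {-1<..<t}" using t by (intro eventually_at_right_real) auto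
  then have "\<forall>\<^sub>F s in at_right (-1). cmod (v t - v s) \<le> wt t ^ n * sqrt (wt t) * ((1 + integral I11 (\<lambda>t. (cmod (u t))\<^sup>2)) / 2)"
    by (rule eventually_mono) (rule bound)
  ultimately show ?thesis using tendsto_upperbound[OF _ _ trivial_limit_at_right_real] by fastforce
qed

text \<open>The energy identity with \<open>W = t p\<^bsup>-(2n+1)\<^esup>\<close>. Here \<open>W' |v|\<^sup>2\<close> dominates \<open>y\<^sup>2\<close> for \<open>y = p\<^bsup>-(n+1)\<^esup> |v|\<close> on the whole
  interval, so no compact part has to be split off; but the boundary term has the unfavourable sign, and
  the decay of \<open>v\<close> at the endpoints is just enough to bound it.\<close>

lemma Hardy_divide_weight:
  assumes v: "v \<in> AC_loc" and der: "AE t in lebesgue_on I11. (v has_vector_derivative wt t ^ n *\<^sub>R u t) (at t)"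
    and u: "u \<in> L2" and lim: "(v \<longlongrightarrow> 0) (at_left 1)" "(v \<longlongrightarrow> 0) (at_right (-1))"
  shows "(\<lambda>t. inverse (wt t) ^ Suc n *\<^sub>R v t) \<in> L2"
proof -
  let ?K = "integral I11 (\<lambda>t. (cmod (u t))\<^sup>2)"
  let ?y = "\<lambda>t. (cmod (inverse (wt t) ^ Suc n *\<^sub>R v t))\<^sup>2"
  define C where "C = ((1 + ?K) / 2)\<^sup>2"
  have decay: "inverse (wt t) ^ (2 * n + 1) * (cmod (v t))\<^sup>2 \<le> C" if t: "t \<in> I11" for t
  proof -
    have p: "0 < wt t" by (rule wt_pos[OF t])
    have "(cmod (v t))\<^sup>2 \<le> (wt t ^ n * sqrt (wt t) * ((1 + ?K) / 2))\<^sup>2"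
      by (intro power_mono endpoint_decay[OF v der u lim t]) auto
    also have "\<dots> = (wt t ^ n)\<^sup>2 * (sqrt (wt t))\<^sup>2 * C" by (simp only: power_mult_distrib C_def)
    also have "(wt t ^ n)\<^sup>2 * (sqrt (wt t))\<^sup>2 = wt t ^ (2 * n + 1)"
      using p by (simp only: real_sqrt_pow2[OF less_imp_le[OF p]] power_add power_one_right power_mult[symmetric] mult.commute[of n 2])
    finally have "inverse (wt t) ^ (2 * n + 1) * (cmod (v t))\<^sup>2 \<le> inverse (wt t) ^ (2 * n + 1) * (wt t ^ (2 * n + 1) * C)"
      using p by (intro mult_left_mono) auto
    also have "\<dots> = (inverse (wt t) * wt t) ^ (2 * n + 1) * C" by (simp only: power_mult_distrib mult.assoc)
    finally show ?thesis using p by simp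
  qed
  define W where "W t = t * inverse (wt t) ^ (2 * n + 1)" for t
  define W' where "W' t = inverse (wt t) ^ (2 * n + 1) + t * (real (2 * n + 1) * inverse (wt t) ^ (2 * n + 2) * (2 * t))" for t
  have W: "(W has_real_derivative W' t) (at t)" if t: "t \<in> I11" for t
  proof -
    have p: "wt t \<noteq> 0" using wt_pos[OF t] by simp
    have "((\<lambda>t. t * inverse (wt t) ^ N) has_real_derivative
        inverse (wt t) ^ N + t * (real N * inverse (wt t) ^ (N - 1) * (inverse (wt t) * (2 * t) * inverse (wt t)))) (at t)" for N
      using p by (auto intro!: derivative_eq_intros)
    from this[of "2 * n + 1"] show ?thesis
      unfolding W_def[abs_def] W'_def by (simp add: algebra_simps)
  qed
  have W'c: "continuous_on I11 W'"
    unfolding W'_def[abs_def] by (intro continuous_intros wt_nonzero)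
  let ?Q = "\<lambda>t. W' t * (cmod (v t))\<^sup>2 + 2 * W t * Re (cnj (v t) * (wt t ^ n *\<^sub>R u t))"
  have ptw: "?y t / 2 - 2 * (cmod (u t))\<^sup>2 \<le> ?Q t" if t: "t \<in> I11" for t
  proof -
    define p where "p = wt t"
    have p: "0 < p" "p \<le> 1" using wt_pos[OF t] by (auto simp: p_def)
    have t2: "t\<^sup>2 = 1 - p" by (simp add: p_def)
    define y where "y = inverse p ^ Suc n * cmod (v t)"
    have Y: "?y t = y\<^sup>2" using p by (simp add: y_def p_def[symmetric] abs_mult power_abs)
    have y2: "y\<^sup>2 = inverse p ^ (2 * n + 2) * (cmod (v t))\<^sup>2"
    proof -
      have "Suc n * 2 = 2 * n + 2" by simp
      then show ?thesis by (simp only: y_def power_mult_distrib power_mult[symmetric])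
    qed
    have ip: "inverse p ^ (2 * n + 1) = p * inverse p ^ (2 * n + 2)" using p by simp
    have "W' t * (cmod (v t))\<^sup>2 = y\<^sup>2 * (p + real (2 * n + 1) * 2 * t\<^sup>2)"
      unfolding W'_def y2 p_def[symmetric] ip by (simp add: algebra_simps power2_eq_square)
    also have "\<dots> \<ge> y\<^sup>2 * 1"
    proof (rule mult_left_mono)
      have "1 * (1 - p) \<le> (real (2 * n + 1) * 2) * (1 - p)" using p by (intro mult_right_mono) auto
      then have "p + 1 * (1 - p) \<le> p + (real (2 * n + 1) * 2) * (1 - p)" by (rule add_left_mono)
      then show "1 \<le> p + real (2 * n + 1) * 2 * t\<^sup>2" unfolding t2 by (rule order_trans[rotated]) simp
    qed simp
    finally have 1: "y\<^sup>2 \<le> W' t * (cmod (v t))\<^sup>2" by simp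
    have "- (2 * W t * Re (cnj (v t) * (p ^ n *\<^sub>R u t))) \<le> \<bar>2 * W t * Re (cnj (v t) * (p ^ n *\<^sub>R u t))\<bar>" by simp
    also have "\<dots> = 2 * \<bar>t\<bar> * inverse p ^ (2 * n + 1) * \<bar>Re (cnj (v t) * (p ^ n *\<^sub>R u t))\<bar>"
      using p by (simp add: W_def abs_mult power_abs p_def[symmetric])
    also have "\<dots> \<le> 2 * 1 * inverse p ^ (2 * n + 1) * (cmod (v t) * cmod (p ^ n *\<^sub>R u t))"
      using t p Re_cnj_mult_le[of "v t" "p ^ n *\<^sub>R u t"] by (intro mult_mono) auto
    also have "\<dots> = 2 * (inverse p ^ (2 * n + 1) * p ^ n) * cmod (v t) * cmod (u t)"
      using p by (simp add: power_abs)
    also have "inverse p ^ (2 * n + 1) * p ^ n = inverse p ^ Suc n"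
    proof -
      have "inverse p ^ (2 * n + 1) = inverse p ^ Suc n * inverse p ^ n"
        unfolding power_add[symmetric] by (rule arg_cong[of _ _ "\<lambda>k. inverse p ^ k"]) simp
      moreover have "inverse p ^ n * p ^ n = 1" using p by (simp add: power_mult_distrib[symmetric])
      ultimately show ?thesis by (simp only: mult.assoc mult_1_right)
    qed
    also have "2 * inverse p ^ Suc n * cmod (v t) * cmod (u t) = 2 * y * cmod (u t)" by (simp add: y_def)
    also have "\<dots> \<le> y\<^sup>2 / 2 + 2 * (cmod (u t))\<^sup>2"
      using zero_le_power2[of "y - 2 * cmod (u t)"] by (simp add: power2_diff power_mult_distrib)
    finally have "y\<^sup>2 / 2 - 2 * (cmod (u t))\<^sup>2 \<le> W' t * (cmod (v t))\<^sup>2 + 2 * W t * Re (cnj (v t) * (p ^ n *\<^sub>R u t))"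
      using 1 by linarith
    then show ?thesis unfolding Y p_def .
  qed
  have vc: "continuous_on I11 v" by (rule AC_loc_continuous_on[OF v])
  have yc: "continuous_on I11 (\<lambda>t. inverse (wt t) ^ Suc n *\<^sub>R v t)"
    by (intro continuous_intros vc wt_nonzero)
  show ?thesis
  proof (rule L2I_exhaustion)
    show "(\<lambda>t. inverse (wt t) ^ Suc n *\<^sub>R v t) \<in> borel_measurable (lebesgue_on I11)"
      by (rule continuous_on_I11_measurable[OF yc])
    fix r :: real assume r: "0 < r" "r < 1"
    have "continuous_on {-r..r} ?y"
      by (intro continuous_on_subset[OF continuous_on_power[OF continuous_on_norm[OF yc]]]) (use r in auto)
    then show yi: "?y integrable_on {-r..r}" by (rule integrable_continuous_real)
    have ui: "(\<lambda>t. (cmod (u t))\<^sup>2) integrable_on {-r..r}" "integral {-r..r} (\<lambda>t. (cmod (u t))\<^sup>2) \<le> ?K"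
      using L2_integral_subinterval[OF u, of "-r" r] r by auto
    have "((\<lambda>t. ?y t / 2 - 2 * (cmod (u t))\<^sup>2) has_integral
        integral {-r..r} ?y / 2 - 2 * integral {-r..r} (\<lambda>t. (cmod (u t))\<^sup>2)) {-r..r}"
      by (intro has_integral_diff has_integral_divide has_integral_mult_right integrable_integral yi ui)
    then have "integral {-r..r} ?y / 2 - 2 * integral {-r..r} (\<lambda>t. (cmod (u t))\<^sup>2)
        \<le> W r * (cmod (v r))\<^sup>2 - W (- r) * (cmod (v (- r)))\<^sup>2"
      by (rule has_integral_le[OF _ energy_identity[OF v der W W'c]]) (use r ptw in auto)
    moreover have "W r * (cmod (v r))\<^sup>2 \<le> 1 * C"
      unfolding W_def mult.assoc using r decay[of r] wt_pos[of r] by (intro mult_mono) auto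
    moreover have "- W (- r) * (cmod (v (- r)))\<^sup>2 \<le> 1 * C"
    proof -
      have "r * (inverse (wt (- r)) ^ (2 * n + 1) * (cmod (v (- r)))\<^sup>2) \<le> 1 * C"
        using r decay[of "- r"] wt_pos[of "- r"] by (intro mult_mono) auto
      then show ?thesis by (simp add: W_def mult.assoc)
    qed
    ultimately show "integral {-r..r} ?y \<le> 4 * C + 4 * ?K" using ui(2) by linarith
  qed
qed

section \<open>Behaviour at the endpoints\<close>

lemma AC_closedI:
  assumes v: "v \<in> AC_loc" and der: "AE t in lebesgue_on I11. (v has_vector_derivative v' t) (at t)"
    and int: "v' absolutely_integrable_on I11"
  shows "v \<in> AC_closed"
proof -
  have ai: "v' absolutely_integrable_on {-1..1}"
  proof (rule absolutely_integrable_spike_set[OF int])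
    show "negligible {x \<in> I11 - {- 1..1}. v' x \<noteq> 0}" by (rule negligible_subset[of "{}"]) auto
    show "negligible {x \<in> {- 1..1} - I11. v' x \<noteq> 0}" by (rule negligible_subset[of "{-1, 1}"]) auto
  qed
  then have i: "v' integrable_on {-1..1}" by (simp add: absolutely_integrable_on_def)
  let ?J = "\<lambda>t. integral {-1..t} v'"
  define F where "F t = ?J t + (v 0 - ?J 0)" for t
  have "abs_continuous_on {-1..1} F"
    using abs_continuous_on_indefinite_integral[OF ai] by (simp add: abs_continuous_on_def F_def)
  moreover have incr: "?J y - ?J x = v y - v x" if "-1 < x" "x \<le> y" "y < 1" for x y
  proof -
    have "?J x + integral {x..y} v' = ?J y"
      using that integrable_subinterval_real[OF i, of "-1" y]
      by (intro Henstock_Kurzweil_Integration.integral_combine) auto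
    then show ?thesis
      using integral_unique[OF AC_loc_FTC(2)[OF v der that]] by (simp add: algebra_simps)
  qed
  have "F t = v t" if "t \<in> I11" for t
    using incr[of 0 t] incr[of t 0] that by (cases "t \<ge> 0") (auto simp: F_def algebra_simps)
  ultimately show ?thesis by (auto simp: AC_closed_def)
qed

text \<open>On a stretch of length \<open>r / 2\<close> the integral of \<open>|w|\<^sup>2\<close> is at least \<open>c / (2 sqrt r)\<close>, which is unbounded
  as \<open>r\<close> tends to 0. The stretches are arbitrary so that one statement serves both endpoints.\<close>

lemma not_L2_if_large_near_endpoint:
  assumes w: "w \<in> L2" and "c > 0" "\<delta> > 0"
    and large: "\<And>r. \<lbrakk>0 < r; r < \<delta>\<rbrakk> \<Longrightarrow> \<exists>x y. -1 < x \<and> y < 1 \<and> y - x = r / 2 \<and>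
        (\<forall>t\<in>{x..y}. c / (r * sqrt r) \<le> (cmod (w t))\<^sup>2)"
  shows False
proof -
  let ?K = "integral I11 (\<lambda>t. (cmod (w t))\<^sup>2)"
  have K: "0 \<le> ?K" using w by (intro integral_nonneg) (auto simp: L2_iff)
  have bound: "c / (2 * sqrt r) \<le> ?K" if r: "0 < r" "r < \<delta>" for r
  proof -
    obtain x y where xy: "-1 < x" "y < 1" "y - x = r / 2" "\<And>t. t \<in> {x..y} \<Longrightarrow> c / (r * sqrt r) \<le> (cmod (w t))\<^sup>2"
      using large[OF r] by blast
    have "((\<lambda>t. c / (r * sqrt r)) has_integral (y - x) * (c / (r * sqrt r))) {x..y}"
    proof -
      have "x \<le> y" using xy(3) r by simp
      then show ?thesis using has_integral_const_real[of "c / (r * sqrt r)" x y] by simp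
    qed
    then have "(y - x) * (c / (r * sqrt r)) \<le> integral {x..y} (\<lambda>t. (cmod (w t))\<^sup>2)"
      by (rule has_integral_le[OF _ integrable_integral[OF L2_integral_subinterval(1)[OF w xy(1,2)]]])
        (rule xy(4))
    also have "\<dots> \<le> ?K" by (rule L2_integral_subinterval(2)[OF w xy(1,2)])
    finally show ?thesis using r by (simp add: xy(3))
  qed
  \<comment> \<open>chosen so that the lower bound exceeds \<open>?K\<close> once \<open>sqrt r \<le> q\<close>\<close>
  define q where "q = c / (2 * (?K + 1))"
  have q: "q > 0" using K \<open>c > 0\<close> by (simp add: q_def)
  define r where "r = min (\<delta> / 2) (q\<^sup>2)"
  have r: "0 < r" "r < \<delta>" using q \<open>\<delta> > 0\<close> by (auto simp: r_def)
  have "sqrt r \<le> q" using q real_sqrt_le_mono[of r "q\<^sup>2"] by (simp add: r_def)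
  then have "c / (2 * q) \<le> c / (2 * sqrt r)"
    using r \<open>c > 0\<close> q by (intro divide_left_mono) auto
  moreover have "c / (2 * q) = ?K + 1" using K \<open>c > 0\<close> by (simp add: q_def field_simps)
  ultimately show False using bound[OF r] by simp
qed

text \<open>Since \<open>v'\<close> is integrable, \<open>v\<close> has limits at the endpoints. If one of them were not 0, then \<open>v / p\<close> would be
  of the size of the reciprocal distance to that endpoint, which is not square integrable.\<close>

lemma limits_zero_at_endpoints:
  assumes v: "v \<in> AC_loc" and der: "AE t in lebesgue_on I11. (v has_vector_derivative v' t) (at t)"
    and v': "v' \<in> L2" and vp: "(\<lambda>t. inverse (wt t) *\<^sub>R v t) \<in> L2"
  shows "(v \<longlongrightarrow> 0) (at_left 1)" "(v \<longlongrightarrow> 0) (at_right (-1))"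
proof -
  obtain F where F: "abs_continuous_on {-1..1} F" "\<And>t. t \<in> I11 \<Longrightarrow> F t = v t"
    using AC_closedI[OF v der L2_absolutely_integrable[OF v']] by (auto simp: AC_closed_def)
  have Fc: "continuous_on {-1..1} F" by (rule abs_continuous_on_continuous[OF F(1)])
  let ?w = "\<lambda>t. inverse (wt t) *\<^sub>R v t"
  have large: "c\<^sup>2 / 4 / (r * sqrt r) \<le> (cmod (?w t))\<^sup>2"
    if r: "0 < r" "r < 1" and c: "0 < c" "c \<le> cmod (v t)" and t: "t \<in> I11" "wt t \<le> 2 * r" for r c t
  proof -
    have p: "0 < wt t" by (rule wt_pos[OF t(1)])
    have "r \<le> sqrt r" using r by (intro real_le_rsqrt) (simp add: power2_eq_square mult_left_le)
    then have "c\<^sup>2 / 4 / (r * sqrt r) \<le> c\<^sup>2 / 4 / (r * r)" using r by (intro divide_left_mono mult_left_mono) auto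
    also have "\<dots> = (c / (2 * r))\<^sup>2" by (simp add: power2_eq_square)
    also have "\<dots> \<le> (c / wt t)\<^sup>2"
      using p t(2) c r by (intro power_mono divide_left_mono) auto
    also have "\<dots> \<le> (cmod (v t) / wt t)\<^sup>2" using p c by (intro power_mono divide_right_mono) auto
    also have "\<dots> = (cmod (?w t))\<^sup>2" using p by (simp add: divide_inverse abs_of_pos)
    finally show ?thesis .
  qed
  have lim1: "(F \<longlongrightarrow> F 1) (at_left 1)"
    using Fc by (simp add: continuous_on_Icc_at_leftD)
  have "F 1 = 0"
  proof (rule ccontr)
    assume "F 1 \<noteq> 0"
    define c where "c = cmod (F 1) / 2"
    have c: "c > 0" "c < cmod (F 1)" using \<open>F 1 \<noteq> 0\<close> by (auto simp: c_def)
    have "\<forall>\<^sub>F t in at_left 1. c < cmod (F t)"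
      by (rule order_tendstoD(1)[OF tendsto_norm[OF lim1] c(2)])
    then obtain b where b: "b < 1" "\<And>t. b < t \<Longrightarrow> t < 1 \<Longrightarrow> c < cmod (F t)"
      by (auto simp: eventually_at_left_field)
    show False
    proof (rule not_L2_if_large_near_endpoint[OF vp])
      show "0 < c\<^sup>2 / 4" "0 < min 1 (1 - b)" using c b by auto
      fix r assume r: "0 < r" "r < min 1 (1 - b)"
      show "\<exists>x y. -1 < x \<and> y < 1 \<and> y - x = r / 2 \<and> (\<forall>t\<in>{x..y}. c\<^sup>2 / 4 / (r * sqrt r) \<le> (cmod (?w t))\<^sup>2)"
      proof (intro exI conjI ballI)
        fix t assume t: "t \<in> {1 - r..1 - r / 2}"
        have tI: "t \<in> I11" using t r by auto
        have "wt t = (1 - t) * (1 + t)" by (simp add: power2_eq_square algebra_simps)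
        also have "\<dots> \<le> r * 2" using t tI by (intro mult_mono) auto
        finally show "c\<^sup>2 / 4 / (r * sqrt r) \<le> (cmod (?w t))\<^sup>2"
          using r t b(2)[of t] F(2)[OF tI] c by (intro large tI) auto
      qed (use r in auto)
    qed
  qed
  then have "(F \<longlongrightarrow> 0) (at_left 1)" using lim1 by simp
  moreover have "\<forall>\<^sub>F t in at_left 1. F t = v t"
    using eventually_at_left_real[of "-1" 1] by (rule eventually_mono) (use F(2) in auto)
  ultimately show "(v \<longlongrightarrow> 0) (at_left 1)" by (rule Lim_transform_eventually)
  have lim2: "(F \<longlongrightarrow> F (-1)) (at_right (-1))"
    using Fc by (simp add: continuous_on_Icc_at_rightD)
  have "F (-1) = 0"
  proof (rule ccontr)
    assume "F (-1) \<noteq> 0"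
    define c where "c = cmod (F (-1)) / 2"
    have c: "c > 0" "c < cmod (F (-1))" using \<open>F (-1) \<noteq> 0\<close> by (auto simp: c_def)
    have "\<forall>\<^sub>F t in at_right (-1). c < cmod (F t)"
      by (rule order_tendstoD(1)[OF tendsto_norm[OF lim2] c(2)])
    then obtain b where b: "-1 < b" "\<And>t. -1 < t \<Longrightarrow> t < b \<Longrightarrow> c < cmod (F t)"
      by (auto simp: eventually_at_right_field)
    show False
    proof (rule not_L2_if_large_near_endpoint[OF vp])
      show "0 < c\<^sup>2 / 4" "0 < min 1 (b + 1)" using c b by auto
      fix r assume r: "0 < r" "r < min 1 (b + 1)"
      show "\<exists>x y. -1 < x \<and> y < 1 \<and> y - x = r / 2 \<and> (\<forall>t\<in>{x..y}. c\<^sup>2 / 4 / (r * sqrt r) \<le> (cmod (?w t))\<^sup>2)"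
      proof (intro exI conjI ballI)
        fix t assume t: "t \<in> {-1 + r / 2..-1 + r}"
        have tI: "t \<in> I11" using t r by auto
        have "wt t = (1 + t) * (1 - t)" by (simp add: power2_eq_square algebra_simps)
        also have "\<dots> \<le> r * 2" using t tI by (intro mult_mono) auto
        finally show "c\<^sup>2 / 4 / (r * sqrt r) \<le> (cmod (?w t))\<^sup>2"
          using r t b(2)[of t] F(2)[OF tI] c by (intro large tI) auto
      qed (use r in auto)
    qed
  qed
  then have "(F \<longlongrightarrow> 0) (at_right (-1))" using lim2 by simp
  moreover have "\<forall>\<^sub>F t in at_right (-1). F t = v t"
    using eventually_at_right_real[of "-1" 1] by (rule eventually_mono) (use F(2) in auto)
  ultimately show "(v \<longlongrightarrow> 0) (at_right (-1))" by (rule Lim_transform_eventually)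
qed

section \<open>Iterated derivatives\<close>

lemma nderiv_0: "nderiv 0 f = f"
  by (simp add: nderiv_def)

lemma nderiv_Suc: "nderiv (Suc j) f t = vector_derivative (nderiv j f) (at t)"
  by (simp add: nderiv_def)

lemma AC_loc_order_AC_loc: "f \<in> AC_loc_order m \<Longrightarrow> j \<le> m \<Longrightarrow> nderiv j f \<in> AC_loc"
  by (simp add: AC_loc_order_def)

lemma AC_loc_order_derivative:
  "f \<in> AC_loc_order m \<Longrightarrow> j < m \<Longrightarrow> t \<in> I11 \<Longrightarrow> (nderiv j f has_vector_derivative nderiv (Suc j) f t) (at t)"
  unfolding nderiv_Suc AC_loc_order_def using vector_derivative_works by blast

lemma AC_loc_order_derivative_ae:
  "f \<in> AC_loc_order m \<Longrightarrow> j \<le> m \<Longrightarrow>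
    AE t in lebesgue_on I11. (nderiv j f has_vector_derivative nderiv (Suc j) f t) (at t)"
  unfolding nderiv_Suc by (rule AC_loc_has_vector_derivative_ae[OF AC_loc_order_AC_loc])

lemma AC_loc_order_mono: "f \<in> AC_loc_order m \<Longrightarrow> l \<le> m \<Longrightarrow> f \<in> AC_loc_order l"
  by (auto simp: AC_loc_order_def)

lemma AC_loc_order_SucI:
  assumes f: "f \<in> AC_loc_order m"
    and der: "\<And>t. t \<in> I11 \<Longrightarrow> (nderiv m f has_vector_derivative q t) (at t)" and q: "q \<in> AC_loc"
  shows "f \<in> AC_loc_order (Suc m)" "\<And>t. t \<in> I11 \<Longrightarrow> nderiv (Suc m) f t = q t"
proof -
  show eq: "nderiv (Suc m) f t = q t" if "t \<in> I11" for t
    unfolding nderiv_Suc by (rule vector_derivative_at[OF der[OF that]])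
  have "nderiv (Suc m) f \<in> AC_loc" by (rule AC_loc_cong[OF _ q]) (simp add: eq)
  moreover have "nderiv m f differentiable (at t)" if "t \<in> I11" for t
    using der[OF that] by (rule differentiableI_vector)
  ultimately show "f \<in> AC_loc_order (Suc m)" 
    using f by (auto simp: AC_loc_order_def less_Suc_eq le_Suc_eq)
qed

lemma has_vector_derivative_cong_I11:
  assumes "(f has_vector_derivative d) (at t)" "t \<in> I11" "\<And>s. s \<in> I11 \<Longrightarrow> f s = g s"
  shows "(g has_vector_derivative d) (at t)"
  by (rule has_vector_derivative_transform_within_open[OF assms(1) _ assms(2)]) (use assms(3) in auto)

text \<open>To compute iterated derivatives it suffices to exhibit a sequence of functions each of which is the
  derivative of its predecessor; the last derivative is required almost everywhere only.\<close>

lemma AC_loc_order_jet: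
  assumes G0: "\<And>t. t \<in> I11 \<Longrightarrow> G 0 t = f t"
    and der: "\<And>j t. j < m \<Longrightarrow> t \<in> I11 \<Longrightarrow> (G j has_vector_derivative G (Suc j) t) (at t)"
    and AC: "\<And>j. j \<le> m \<Longrightarrow> G j \<in> AC_loc"
    and ae: "AE t in lebesgue_on I11. (G m has_vector_derivative G (Suc m) t) (at t)"
  shows "f \<in> AC_loc_order m" "\<And>j t. j \<le> m \<Longrightarrow> t \<in> I11 \<Longrightarrow> nderiv j f t = G j t"
    "AE t in lebesgue_on I11. nderiv (Suc m) f t = G (Suc m) t"
proof -
  have eq: "\<forall>t\<in>I11. nderiv j f t = G j t" if "j \<le> m" for j
    using that
  proof (induction j)
    case 0
    then show ?case using G0 by (simp add: nderiv_0)
  next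
    case (Suc j)
    show ?case
    proof
      fix t assume t: "t \<in> I11"
      have "(nderiv j f has_vector_derivative G (Suc j) t) (at t)"
        using Suc t by (intro has_vector_derivative_cong_I11[OF der[of j t]]) auto
      then show "nderiv (Suc j) f t = G (Suc j) t" unfolding nderiv_Suc by (rule vector_derivative_at)
    qed
  qed
  then show "\<And>j t. j \<le> m \<Longrightarrow> t \<in> I11 \<Longrightarrow> nderiv j f t = G j t" by blast
  have der': "(nderiv j f has_vector_derivative d) (at t)"
    if "j \<le> m" "t \<in> I11" "(G j has_vector_derivative d) (at t)" for j t d
    by (rule has_vector_derivative_cong_I11[OF that(3,2)]) (use eq[OF that(1)] in simp)
  show "f \<in> AC_loc_order m"
    unfolding AC_loc_order_def
  proof (intro CollectI conjI allI impI ballI)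
    fix j t assume "j < m" "t \<in> I11"
    then show "nderiv j f differentiable (at t)"
      using der'[OF _ _ der] by (intro differentiableI_vector) auto
  next
    fix j assume j: "j \<le> m"
    show "nderiv j f \<in> AC_loc" by (rule AC_loc_cong[OF _ AC[OF j]]) (use eq[OF j] in simp)
  qed
  show "AE t in lebesgue_on I11. nderiv (Suc m) f t = G (Suc m) t"
    using ae AE_space
  proof eventually_elim
    case (elim t)
    then show ?case unfolding nderiv_Suc by (intro vector_derivative_at der') auto
  qed
qed

section \<open>The weighted Sobolev space\<close>

text \<open>For \<open>n \<ge> 1\<close> this turns out to be the domain of the \<open>n\<close>-th power of the Legendre operator, for every \<open>k\<close>.\<close>

definition weighted_sobolev :: "nat \<Rightarrow> (real \<Rightarrow> complex) set" where
  "weighted_sobolev n = {f. f \<in> AC_loc_order (2 * n - 1) \<and> (\<lambda>t. wt t ^ n *\<^sub>R nderiv (2 * n) f t) \<in> L2}"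

lemma nderiv_lower_weight:
  assumes "f \<in> AC_loc_order m" "j \<le> m" "(\<lambda>t. wt t ^ Suc i *\<^sub>R nderiv (Suc j) f t) \<in> L2"
  shows "(\<lambda>t. wt t ^ i *\<^sub>R nderiv j f t) \<in> L2"
  by (rule Hardy_lower_weight[OF AC_loc_order_AC_loc[OF assms(1,2)] AC_loc_order_derivative_ae[OF assms(1,2)] assms(3)])

text \<open>Each step down trades one derivative for one power of the weight.\<close>

lemma weighted_sobolev_high:
  assumes f: "f \<in> weighted_sobolev n" and "n \<ge> 1" "i \<le> n"
  shows "(\<lambda>t. wt t ^ i *\<^sub>R nderiv (n + i) f t) \<in> L2"
  using \<open>i \<le> n\<close>
proof (induction i rule: inc_induct)
  case base
  then show ?case using f by (simp add: weighted_sobolev_def mult_2)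
next
  case (step i)
  show ?case
    by (rule nderiv_lower_weight[of f "2 * n - 1"]) (use f step in \<open>auto simp: weighted_sobolev_def\<close>)
qed

text \<open>Below order \<open>n\<close> there is no weight left to trade, but inserting a factor \<open>p \<le> 1\<close> keeps the descent
  going.\<close>

lemma weighted_sobolev_low:
  assumes f: "f \<in> weighted_sobolev n" and "n \<ge> 1" "j \<le> n"
  shows "nderiv j f \<in> L2"
  using \<open>j \<le> n\<close>
proof (induction j rule: inc_induct)
  case base
  then show ?case using weighted_sobolev_high[OF f \<open>n \<ge> 1\<close>, of 0] by simp
next
  case (step j)
  have "(\<lambda>t. wt t ^ Suc 0 *\<^sub>R nderiv (Suc j) f t) \<in> L2" by (rule L2_wt_power[OF step.IH])
  then have "(\<lambda>t. wt t ^ 0 *\<^sub>R nderiv j f t) \<in> L2"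
    by (rule nderiv_lower_weight[of f "2 * n - 1", rotated 2]) (use f step in \<open>auto simp: weighted_sobolev_def\<close>)
  then show ?case by simp
qed

lemma weighted_sobolev_AC_closed:
  assumes f: "f \<in> weighted_sobolev n" and j: "j < n"
  shows "nderiv j f \<in> AC_closed"
proof (rule AC_closedI)
  have o: "f \<in> AC_loc_order (2 * n - 1)" using f by (simp add: weighted_sobolev_def)
  show "nderiv j f \<in> AC_loc" by (rule AC_loc_order_AC_loc[OF o]) (use j in auto)
  show "AE t in lebesgue_on I11. (nderiv j f has_vector_derivative nderiv (Suc j) f t) (at t)"
    by (rule AC_loc_order_derivative_ae[OF o]) (use j in auto)
  show "nderiv (Suc j) f absolutely_integrable_on I11"
    by (rule L2_absolutely_integrable[OF weighted_sobolev_low[OF f]]) (use j in auto)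
qed

section \<open>The Legendre expression on the weighted Sobolev spaces\<close>

text \<open>The derivative of order \<open>j + 1\<close> of the flux \<open>(1 - t\<^sup>2) f'\<close>. The formula makes sense as soon as the derivatives
  of \<open>f\<close> up to order \<open>j + 2\<close> do, and does not presuppose that the flux is differentiable that often.\<close>

definition legendre_jet :: "(real \<Rightarrow> complex) \<Rightarrow> nat \<Rightarrow> real \<Rightarrow> complex" where
  "legendre_jet f j t = wt t *\<^sub>R nderiv (j + 2) f t - (2 * (real j + 1) * t) *\<^sub>R nderiv (j + 1) f t
     - (real j * (real j + 1)) *\<^sub>R nderiv j f t"

lemma legendre_jet_derivative:
  assumes "(nderiv j f has_vector_derivative nderiv (j + 1) f t) (at t)"
    "(nderiv (j + 1) f has_vector_derivative nderiv (j + 2) f t) (at t)"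
    "(nderiv (j + 2) f has_vector_derivative nderiv (j + 3) f t) (at t)"
  shows "(legendre_jet f j has_vector_derivative legendre_jet f (Suc j) t) (at t)"
proof -
  have lin: "((\<lambda>t. c * t) has_real_derivative c) (at t)" for c by (auto intro!: derivative_eq_intros)
  let ?d = "(wt t *\<^sub>R nderiv (j + 3) f t + (- 2 * t) *\<^sub>R nderiv (j + 2) f t)
      - ((2 * (real j + 1) * t) *\<^sub>R nderiv (j + 2) f t + (2 * (real j + 1)) *\<^sub>R nderiv (j + 1) f t)
      - ((real j * (real j + 1)) *\<^sub>R nderiv (j + 1) f t + 0 *\<^sub>R nderiv j f t)"
  have "(legendre_jet f j has_vector_derivative ?d) (at t)"
    unfolding legendre_jet_def[abs_def]
    by (intro has_vector_derivative_diff has_vector_derivative_scaleR wt_derivative lin DERIV_const assms)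
  also have "?d = legendre_jet f (Suc j) t"
    unfolding legendre_jet_def by (simp add: numeral_3_eq_3 scaleR_conv_of_real algebra_simps)
  finally show ?thesis .
qed

lemma legendre_expr_eq:
  assumes "(nderiv 1 f has_vector_derivative nderiv 2 f t) (at t)"
  shows "legendre_expr k f t = k *\<^sub>R f t - legendre_jet f 0 t"
proof -
  have "((\<lambda>s. wt s *\<^sub>R nderiv 1 f s) has_vector_derivative wt t *\<^sub>R nderiv 2 f t + (- 2 * t) *\<^sub>R nderiv 1 f t) (at t)"
    by (intro has_vector_derivative_scaleR wt_derivative assms)
  then have "vector_derivative (\<lambda>s. wt s *\<^sub>R nderiv 1 f s) (at t) = wt t *\<^sub>R nderiv 2 f t + (- 2 * t) *\<^sub>R nderiv 1 f t"
    by (rule vector_derivative_at)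
  then show ?thesis by (simp add: legendre_expr_def legendre_jet_def numeral_2_eq_2)
qed

lemma AC_loc_legendre_jet:
  assumes "f \<in> AC_loc_order m" "j + 2 \<le> m"
  shows "legendre_jet f j \<in> AC_loc"
  unfolding legendre_jet_def[abs_def]
  by (intro AC_loc_diff AC_loc_wt AC_loc_linear AC_loc_scaleR AC_loc_order_AC_loc[OF assms(1)]) (use assms(2) in auto)

lemma weighted_flux_derivative:
  assumes "f \<in> AC_loc_order 1" "(nderiv 1 f has_vector_derivative nderiv 2 f t) (at t)"
  shows "((\<lambda>t. wt t *\<^sub>R nderiv 1 f t) has_vector_derivative legendre_jet f 0 t) (at t)"
proof -
  have "((\<lambda>s. wt s *\<^sub>R nderiv 1 f s) has_vector_derivative wt t *\<^sub>R nderiv 2 f t + (- 2 * t) *\<^sub>R nderiv 1 f t) (at t)"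
    by (intro has_vector_derivative_scaleR wt_derivative assms)
  then show ?thesis by (simp add: legendre_jet_def numeral_2_eq_2)
qed

text \<open>The boundary condition holds automatically: the flux divided by \<open>p\<close> is \<open>f'\<close>, which is square
  integrable.\<close>

lemma weighted_sobolev_in_dom:
  assumes f: "f \<in> weighted_sobolev n" and n: "n \<ge> 1"
  shows "f \<in> legendre_dom k"
proof -
  have o: "f \<in> AC_loc_order 1" 
    using f n by (auto simp: weighted_sobolev_def intro: AC_loc_order_mono)
  have f0: "f \<in> L2" using weighted_sobolev_low[OF f n, of 0] by (simp add: nderiv_0)
  have f1: "nderiv 1 f \<in> L2" using weighted_sobolev_low[OF f n, of 1] n by simp
  have f2: "(\<lambda>t. wt t *\<^sub>R nderiv 2 f t) \<in> L2"
  proof (cases "n = 1")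
    case True
    then show ?thesis using weighted_sobolev_high[OF f n, of 1] by (simp add: numeral_2_eq_2)
  next
    case False
    then show ?thesis using n by (intro L2_wt weighted_sobolev_low[OF f n]) auto
  qed
  have jet: "legendre_jet f 0 \<in> L2"
    using L2_diff[OF f2 L2_linear[OF f1, of 2]] by (simp add: legendre_jet_def[abs_def] numeral_2_eq_2)
  have ae: "AE t in lebesgue_on I11. (nderiv 1 f has_vector_derivative nderiv 2 f t) (at t)"
    using AC_loc_order_derivative_ae[OF o, of 1] by (simp add: numeral_2_eq_2)
  have "(\<lambda>t. k *\<^sub>R f t - legendre_jet f 0 t) \<in> L2" by (intro L2_diff L2_scaleR f0 jet)
  then have expr: "legendre_expr k f \<in> L2"
    by (rule L2_AE) (use ae in eventually_elim, simp add: legendre_expr_eq)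
  have v: "(\<lambda>t. wt t *\<^sub>R nderiv 1 f t) \<in> AC_loc" by (intro AC_loc_wt AC_loc_order_AC_loc[OF o]) simp
  have der: "AE t in lebesgue_on I11. ((\<lambda>t. wt t *\<^sub>R nderiv 1 f t) has_vector_derivative legendre_jet f 0 t) (at t)"
    using ae by eventually_elim (rule weighted_flux_derivative[OF o])
  have "(\<lambda>t. inverse (wt t) *\<^sub>R (wt t *\<^sub>R nderiv 1 f t)) \<in> L2"
    by (rule L2_cong[OF f1]) (use wt_nonzero in simp)
  from limits_zero_at_endpoints[OF v der jet this] show ?thesis
    using o f0 expr by (simp add: legendre_dom_def)
qed

text \<open>The flux vanishes at the endpoints and has a square integrable derivative, so dividing it by \<open>p\<close>
  leaves it square integrable. With \<open>f' \<in> L2\<close> the second-order term follows from the equation.\<close>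

lemma legendre_dom_in_weighted_sobolev:
  assumes f: "f \<in> legendre_dom k"
  shows "f \<in> weighted_sobolev 1"
proof -
  have o: "f \<in> AC_loc_order 1" and f0: "f \<in> L2" and expr: "legendre_expr k f \<in> L2"
    and lim: "((\<lambda>t. wt t *\<^sub>R nderiv 1 f t) \<longlongrightarrow> 0) (at_left 1)" "((\<lambda>t. wt t *\<^sub>R nderiv 1 f t) \<longlongrightarrow> 0) (at_right (-1))"
    using f by (auto simp: legendre_dom_def)
  have ae: "AE t in lebesgue_on I11. (nderiv 1 f has_vector_derivative nderiv 2 f t) (at t)"
    using AC_loc_order_derivative_ae[OF o, of 1] by (simp add: numeral_2_eq_2)
  let ?u = "\<lambda>t. k *\<^sub>R f t - legendre_expr k f t"
  have u: "?u \<in> L2" by (intro L2_diff L2_scaleR f0 expr)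
  have jet_u: "AE t in lebesgue_on I11. ?u t = legendre_jet f 0 t"
    using ae by eventually_elim (simp add: legendre_expr_eq)
  have v: "(\<lambda>t. wt t *\<^sub>R nderiv 1 f t) \<in> AC_loc" by (intro AC_loc_wt AC_loc_order_AC_loc[OF o]) simp
  have "AE t in lebesgue_on I11. ((\<lambda>t. wt t *\<^sub>R nderiv 1 f t) has_vector_derivative wt t ^ 0 *\<^sub>R ?u t) (at t)"
    using ae jet_u by eventually_elim (use weighted_flux_derivative[OF o] in simp)
  from Hardy_divide_weight[OF v this u lim]
  have "(\<lambda>t. inverse (wt t) ^ Suc 0 *\<^sub>R (wt t *\<^sub>R nderiv 1 f t)) \<in> L2" .
  then have f1: "nderiv 1 f \<in> L2" by (rule L2_cong) (use wt_nonzero in simp)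
  have "(\<lambda>t. ?u t + (2 * t) *\<^sub>R nderiv 1 f t) \<in> L2" by (intro L2_add u L2_linear f1)
  then have "(\<lambda>t. wt t ^ 1 *\<^sub>R nderiv (2 * 1) f t) \<in> L2"
    by (rule L2_AE) (use jet_u in eventually_elim, simp add: legendre_jet_def numeral_2_eq_2)
  then show ?thesis using o by (simp add: weighted_sobolev_def)
qed

text \<open>The derivative of order \<open>2n\<close> of the Legendre expression involves \<open>f\<^bsub>2n+2\<^esub>\<close>, \<open>f\<^bsub>2n+1\<^esub>\<close> and \<open>f\<^bsub>2n\<^esub>\<close>. The descent
  in the space for \<open>n + 1\<close> shows that they are square integrable with the weights \<open>p\<^bsup>n+1\<^esup>\<close>, \<open>p\<^sup>n\<close> and
  \<open>p\<^bsup>n-1\<^esup>\<close>.\<close>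

lemma weighted_sobolev_legendre_expr:
  assumes f: "f \<in> weighted_sobolev (Suc n)" and n: "n \<ge> 1"
  shows "legendre_expr k f \<in> weighted_sobolev n"
proof -
  have o: "f \<in> AC_loc_order (2 * n + 1)" using f by (simp add: weighted_sobolev_def)
  define G where "G j t = k *\<^sub>R nderiv j f t - legendre_jet f j t" for j t
  have der: "(nderiv j f has_vector_derivative nderiv (Suc j) f t) (at t)" if "j < 2 * n + 1" "t \<in> I11" for j t
    by (rule AC_loc_order_derivative[OF o that])
  have Gder: "(G j has_vector_derivative G (Suc j) t) (at t)"
    if "j \<le> 2 * n - 1" "(nderiv (j + 2) f has_vector_derivative nderiv (j + 3) f t) (at t)" "t \<in> I11" for j t
  proof -
    have d: "(nderiv j f has_vector_derivative nderiv (j + 1) f t) (at t)" "(nderiv (j + 1) f has_vector_derivative nderiv (j + 2) f t) (at t)"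
      using der[of j t] der[of "j + 1" t] that n by auto
    have "((\<lambda>t. k *\<^sub>R nderiv j f t) has_vector_derivative k *\<^sub>R nderiv (Suc j) f t) (at t)"
      using d(1) by (auto intro: has_vector_derivative_scaleR[OF DERIV_const, THEN has_vector_derivative_eq_rhs])
    then show ?thesis unfolding G_def[abs_def]
      by (intro has_vector_derivative_diff legendre_jet_derivative[OF d that(2)])
  qed
  have G0: "G 0 t = legendre_expr k f t" if "t \<in> I11" for t
    using der[of 1 t] n that legendre_expr_eq[of f t k] by (simp add: G_def nderiv_0 numeral_2_eq_2)
  have GAC: "G j \<in> AC_loc" if "j \<le> 2 * n - 1" for j
    unfolding G_def[abs_def]
    by (intro AC_loc_diff AC_loc_scaleR AC_loc_order_AC_loc[OF o] AC_loc_legendre_jet[OF o]) (use that n in auto)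
  have Gae: "AE t in lebesgue_on I11. (G (2 * n - 1) has_vector_derivative G (Suc (2 * n - 1)) t) (at t)"
    using AC_loc_order_derivative_ae[OF o order_refl] AE_space
  proof eventually_elim
    case (elim t)
    moreover have "2 * n - 1 + 2 = 2 * n + 1" "2 * n - 1 + 3 = Suc (2 * n + 1)" using n by auto
    ultimately show ?case using Gder[of "2 * n - 1" t] by simp
  qed
  have "legendre_expr k f \<in> AC_loc_order (2 * n - 1)"
    and "AE t in lebesgue_on I11. nderiv (Suc (2 * n - 1)) (legendre_expr k f) t = G (Suc (2 * n - 1)) t"
    using AC_loc_order_jet[of G "legendre_expr k f" "2 * n - 1", OF G0 Gder GAC Gae] der n
    by (auto simp: numeral_3_eq_3)
  moreover have "Suc (2 * n - 1) = 2 * n" using n by simp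
  ultimately have o': "legendre_expr k f \<in> AC_loc_order (2 * n - 1)"
    and ae: "AE t in lebesgue_on I11. nderiv (2 * n) (legendre_expr k f) t = G (2 * n) t" by simp_all
  have top: "(\<lambda>t. wt t ^ Suc n *\<^sub>R nderiv (2 * n + 2) f t) \<in> L2"
    using weighted_sobolev_high[OF f, of "Suc n"] by (simp add: mult_2)
  have mid: "(\<lambda>t. wt t ^ n *\<^sub>R nderiv (2 * n + 1) f t) \<in> L2"
    using weighted_sobolev_high[OF f, of n] by (simp add: mult_2)
  have "(\<lambda>t. wt t ^ (n - 1) *\<^sub>R nderiv (Suc n + (n - 1)) f t) \<in> L2"
    by (rule weighted_sobolev_high[OF f]) auto
  then have "(\<lambda>t. wt t *\<^sub>R (wt t ^ (n - 1) *\<^sub>R nderiv (2 * n) f t)) \<in> L2"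
    using n by (intro L2_wt) (simp add: mult_2)
  then have low: "(\<lambda>t. wt t ^ n *\<^sub>R nderiv (2 * n) f t) \<in> L2"
    by (rule L2_cong) (use n in \<open>simp add: power_eq_if\<close>)
  have "(\<lambda>t. k *\<^sub>R (wt t ^ n *\<^sub>R nderiv (2 * n) f t) - (wt t ^ Suc n *\<^sub>R nderiv (2 * n + 2) f t
       - (2 * (real (2 * n) + 1) * t) *\<^sub>R (wt t ^ n *\<^sub>R nderiv (2 * n + 1) f t)
       - (real (2 * n) * (real (2 * n) + 1)) *\<^sub>R (wt t ^ n *\<^sub>R nderiv (2 * n) f t))) \<in> L2"
    by (intro L2_diff L2_scaleR L2_linear top mid low)
  then have "(\<lambda>t. wt t ^ n *\<^sub>R G (2 * n) t) \<in> L2"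
  proof (rule L2_cong)
    fix t
    have "k *\<^sub>R (q *\<^sub>R c) - ((p * q) *\<^sub>R a - x *\<^sub>R (q *\<^sub>R b) - y *\<^sub>R (q *\<^sub>R c)) = q *\<^sub>R (k *\<^sub>R c - (p *\<^sub>R a - x *\<^sub>R b - y *\<^sub>R c))"
      for p q x y :: real and a b c :: complex
      by (simp add: scaleR_right_diff_distrib mult.commute)
    then show "k *\<^sub>R (wt t ^ n *\<^sub>R nderiv (2 * n) f t) - (wt t ^ Suc n *\<^sub>R nderiv (2 * n + 2) f t
       - (2 * (real (2 * n) + 1) * t) *\<^sub>R (wt t ^ n *\<^sub>R nderiv (2 * n + 1) f t)
       - (real (2 * n) * (real (2 * n) + 1)) *\<^sub>R (wt t ^ n *\<^sub>R nderiv (2 * n) f t)) = wt t ^ n *\<^sub>R G (2 * n) t"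
      unfolding G_def legendre_jet_def power_Suc by blast
  qed
  then have "(\<lambda>t. wt t ^ n *\<^sub>R nderiv (2 * n) (legendre_expr k f) t) \<in> L2"
    by (rule L2_AE) (use ae in eventually_elim, simp)
  then show ?thesis using o' by (simp add: weighted_sobolev_def)
qed

section \<open>Regularity gained from the Legendre expression\<close>

lemma solve_legendre_jet:
  assumes "legendre_jet f j t = H" "t \<in> I11"
  shows "nderiv (j + 2) f t = inverse (wt t) *\<^sub>R (H + (2 * (real j + 1) * t) *\<^sub>R nderiv (j + 1) f t
     + (real j * (real j + 1)) *\<^sub>R nderiv j f t)"
proof -
  have "wt t *\<^sub>R nderiv (j + 2) f t = H + (2 * (real j + 1) * t) *\<^sub>R nderiv (j + 1) f t
     + (real j * (real j + 1)) *\<^sub>R nderiv j f t"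
    using assms(1) unfolding legendre_jet_def by (simp add: algebra_simps)
  then have "inverse (wt t) *\<^sub>R (wt t *\<^sub>R nderiv (j + 2) f t) = inverse (wt t) *\<^sub>R (H + (2 * (real j + 1) * t) *\<^sub>R nderiv (j + 1) f t
     + (real j * (real j + 1)) *\<^sub>R nderiv j f t)" by (rule arg_cong)
  then show ?thesis using wt_nonzero assms(2) by simp
qed

text \<open>Bootstrapping: the equation, differentiated \<open>j\<close> times and solved for \<open>f\<^bsub>j+2\<^esub>\<close>, shows that this derivative is
  as regular as \<open>f\<^bsub>j+1\<^esub>\<close> and \<open>g\<^sub>j\<close>, so the equation can be differentiated once more.\<close>

lemma legendre_regularity:
  assumes f: "f \<in> AC_loc_order 1" and g: "g \<in> AC_loc_order m"
    and ae: "AE t in lebesgue_on I11. g t = legendre_expr k f t"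
    and j: "j \<le> m"
  shows "f \<in> AC_loc_order (j + 2) \<and> (\<forall>t\<in>I11. legendre_jet f j t = k *\<^sub>R nderiv j f t - nderiv j g t)"
  using j
proof (induction j)
  case 0
  define q where "q t = inverse (wt t) *\<^sub>R ((k *\<^sub>R f t - g t) + (2 * t) *\<^sub>R nderiv 1 f t)" for t
  have f0: "f \<in> AC_loc" and f1: "nderiv 1 f \<in> AC_loc" and g0: "g \<in> AC_loc"
    using AC_loc_order_AC_loc[OF f, of 0] AC_loc_order_AC_loc[OF f, of 1] AC_loc_order_AC_loc[OF g, of 0]
    by (simp_all add: nderiv_0)
  have q: "q \<in> AC_loc" unfolding q_def[abs_def]
    by (intro AC_loc_divide_wt AC_loc_add AC_loc_diff AC_loc_scaleR AC_loc_linear f0 f1 g0)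
  have "AE t in lebesgue_on I11. (nderiv 1 f has_vector_derivative nderiv (Suc 1) f t) (at t)"
    by (rule AC_loc_order_derivative_ae[OF f]) simp
  then have "AE t in lebesgue_on I11. (nderiv 1 f has_vector_derivative q t) (at t)"
    using ae AE_space
  proof eventually_elim
    case (elim t)
    then have t: "t \<in> I11" and d: "(nderiv 1 f has_vector_derivative nderiv 2 f t) (at t)" by (auto simp: numeral_2_eq_2)
    have "legendre_jet f 0 t = k *\<^sub>R f t - g t"
      using elim(2) legendre_expr_eq[OF d, of k] by simp
    from solve_legendre_jet[OF this t] have "nderiv 2 f t = q t" by (simp add: q_def numeral_2_eq_2)
    then show ?case using d by simp
  qed
  \<comment> \<open>Now \<open>q\<close> is continuous, so the second derivative exists at every point.\<close>
  then have der: "(nderiv 1 f has_vector_derivative q t) (at t)" if "t \<in> I11" for t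
    using AC_loc_derivative_continuous[OF f1 _ AC_loc_continuous_on[OF q] that] by blast
  have f2: "f \<in> AC_loc_order (Suc 1)" and eq: "\<And>t. t \<in> I11 \<Longrightarrow> nderiv (Suc 1) f t = q t"
    using AC_loc_order_SucI[OF f der q] by auto
  have "legendre_jet f 0 t = k *\<^sub>R nderiv 0 f t - nderiv 0 g t" if t: "t \<in> I11" for t
    using eq[OF t] wt_nonzero t by (simp add: legendre_jet_def q_def nderiv_0 numeral_2_eq_2)
  then show ?case using f2 by (simp add: numeral_2_eq_2)
next
  case (Suc j)
  then have f: "f \<in> AC_loc_order (j + 2)" and jet: "\<And>t. t \<in> I11 \<Longrightarrow> legendre_jet f j t = k *\<^sub>R nderiv j f t - nderiv j g t"
    by auto
  let ?R = "\<lambda>t. inverse (wt t) *\<^sub>R ((k *\<^sub>R nderiv j f t - nderiv j g t) + (2 * (real j + 1) * t) *\<^sub>R nderiv (j + 1) f t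
     + (real j * (real j + 1)) *\<^sub>R nderiv j f t)"
  have R: "?R t = nderiv (j + 2) f t" if "t \<in> I11" for t
    using solve_legendre_jet[OF jet[OF that] that] by simp
  have d0: "(nderiv j f has_vector_derivative nderiv (j + 1) f t) (at t)"
    and d1: "(nderiv (j + 1) f has_vector_derivative nderiv (j + 2) f t) (at t)"
    and dg: "(nderiv j g has_vector_derivative nderiv (j + 1) g t) (at t)" if "t \<in> I11" for t
    using AC_loc_order_derivative[OF f _ that, of j] AC_loc_order_derivative[OF f _ that, of "j + 1"]
      AC_loc_order_derivative[OF g _ that, of j] Suc.prems by auto
  have lin: "((\<lambda>t. c * t) has_real_derivative c) (at t)" for c t by (auto intro!: derivative_eq_intros)
  have d2: "(nderiv (j + 2) f has_vector_derivative nderiv (j + 3) f t) (at t)" if t: "t \<in> I11" for t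
  proof -
    note D0 = has_vector_derivative_scaleR[OF DERIV_const d0[OF t]]
    obtain d where d: "(?R has_vector_derivative d) (at t)"
      using has_vector_derivative_scaleR[OF inverse_wt_derivative[OF t] has_vector_derivative_add[OF
          has_vector_derivative_add[OF has_vector_derivative_diff[OF D0 dg[OF t]]
            has_vector_derivative_scaleR[OF lin d1[OF t]]] D0]] by blast
    have "(nderiv (j + 2) f has_vector_derivative d) (at t)"
      by (rule has_vector_derivative_cong_I11[OF d t R])
    then show ?thesis
      using vector_derivative_at[of "nderiv (j + 2) f" d t] nderiv_Suc[of "j + 2" f t] by (simp add: numeral_3_eq_3)
  qed
  have jet': "legendre_jet f (Suc j) t = k *\<^sub>R nderiv (j + 1) f t - nderiv (j + 1) g t" if t: "t \<in> I11" for t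
  proof -
    have "((\<lambda>t. k *\<^sub>R nderiv j f t - nderiv j g t) has_vector_derivative
        (k *\<^sub>R nderiv (j + 1) f t + 0 *\<^sub>R nderiv j f t) - nderiv (j + 1) g t) (at t)"
      by (intro has_vector_derivative_diff has_vector_derivative_scaleR DERIV_const d0[OF t] dg[OF t])
    then have "(legendre_jet f j has_vector_derivative
        (k *\<^sub>R nderiv (j + 1) f t + 0 *\<^sub>R nderiv j f t) - nderiv (j + 1) g t) (at t)"
      by (rule has_vector_derivative_cong_I11[OF _ t]) (simp add: jet)
    from vector_derivative_unique_at[OF this legendre_jet_derivative[OF d0[OF t] d1[OF t] d2[OF t]]]
    show ?thesis by simp
  qed
  define q where "q t = inverse (wt t) *\<^sub>R ((k *\<^sub>R nderiv (j + 1) f t - nderiv (j + 1) g t)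
     + (2 * (real (Suc j) + 1) * t) *\<^sub>R nderiv (j + 2) f t + (real (Suc j) * (real (Suc j) + 1)) *\<^sub>R nderiv (j + 1) f t)" for t
  have q: "q \<in> AC_loc" unfolding q_def[abs_def]
    by (intro AC_loc_divide_wt AC_loc_add AC_loc_diff AC_loc_scaleR AC_loc_linear
        AC_loc_order_AC_loc[OF f] AC_loc_order_AC_loc[OF g]) (use Suc.prems in auto)
  have "(nderiv (j + 2) f has_vector_derivative q t) (at t)" if t: "t \<in> I11" for t
    using d2[OF t] solve_legendre_jet[OF jet'[OF t] t] by (simp add: q_def numeral_3_eq_3)
  from AC_loc_order_SucI(1)[OF f this q] show ?case using jet' by simp
qed

text \<open>The step in which a priori knowledge is improved. The equation of order \<open>2n - 1\<close> bounds \<open>p\<^bsup>n+1\<^esup> f\<^bsub>2n+1\<^esub>\<close>. This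
  is one power of the weight too weak, but enough to see that \<open>v = p\<^bsup>2n+1\<^esup> f\<^bsub>2n+1\<^esub>\<close> vanishes at the endpoints.
  The equation of order \<open>2n\<close> says \<open>v' = p\<^bsup>2n\<^esup> (h\<^bsub>2n\<^esub> + 2n (2n + 1) f\<^bsub>2n\<^esub>)\<close> with \<open>h = k f - g\<close>, where \<open>p\<^sup>n\<close> times the bracket
  is square integrable; so the Hardy inequality recovers the missing power.\<close>

lemma weighted_sobolev_SucI:
  assumes f: "f \<in> weighted_sobolev n" and g: "g \<in> weighted_sobolev n" and n: "n \<ge> 1"
    and ae: "AE t in lebesgue_on I11. g t = legendre_expr k f t"
  shows "f \<in> weighted_sobolev (Suc n)"
proof -
  let ?m = "2 * n - 1"
  have m: "?m + 2 = 2 * n + 1" "?m + 1 = 2 * n" "Suc ?m = 2 * n" "real ?m + 1 = 2 * real n" 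
    using n by (auto simp: of_nat_diff)
  have f1: "f \<in> AC_loc_order 1" and go: "g \<in> AC_loc_order ?m"
    using f g n by (auto simp: weighted_sobolev_def intro: AC_loc_order_mono)
  have o: "f \<in> AC_loc_order (2 * n + 1)"
    and jet: "\<And>t. t \<in> I11 \<Longrightarrow> legendre_jet f ?m t = k *\<^sub>R nderiv ?m f t - nderiv ?m g t"
    using legendre_regularity[OF f1 go ae order_refl] m(1) by auto
  define H where "H j t = k *\<^sub>R nderiv j f t - nderiv j g t" for j t
  have high: "(\<lambda>t. wt t ^ n *\<^sub>R nderiv (2 * n) u t) \<in> L2" "(\<lambda>t. wt t ^ n *\<^sub>R nderiv ?m u t) \<in> L2"
    if u: "u \<in> weighted_sobolev n" for u
  proof -
    show "(\<lambda>t. wt t ^ n *\<^sub>R nderiv (2 * n) u t) \<in> L2" using u by (simp add: weighted_sobolev_def)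
    have "(\<lambda>t. wt t ^ (n - 1) *\<^sub>R nderiv (n + (n - 1)) u t) \<in> L2"
      by (rule weighted_sobolev_high[OF u n]) simp
    moreover have "n + (n - 1) = ?m" using n by simp
    ultimately have "(\<lambda>t. wt t *\<^sub>R (wt t ^ (n - 1) *\<^sub>R nderiv ?m u t)) \<in> L2" by (intro L2_wt) simp
    then show "(\<lambda>t. wt t ^ n *\<^sub>R nderiv ?m u t) \<in> L2"
      by (rule L2_cong) (use n in \<open>simp add: power_eq_if\<close>)
  qed
  have H: "(\<lambda>t. wt t ^ n *\<^sub>R H (2 * n) t) \<in> L2" "(\<lambda>t. wt t ^ n *\<^sub>R H ?m t) \<in> L2"
    using L2_diff[OF L2_scaleR[OF high(1)[OF f], of k] high(1)[OF g]] L2_diff[OF L2_scaleR[OF high(2)[OF f], of k] high(2)[OF g]]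
    by (simp_all add: H_def scaleR_right_diff_distrib mult.commute)
  \<comment> \<open>The derivative of order \<open>2n + 1\<close>, with one power of the weight more than needed.\<close>
  have "(\<lambda>t. wt t ^ n *\<^sub>R H ?m t + (2 * (2 * real n) * t) *\<^sub>R (wt t ^ n *\<^sub>R nderiv (2 * n) f t)
     + (real ?m * (2 * real n)) *\<^sub>R (wt t ^ n *\<^sub>R nderiv ?m f t)) \<in> L2"
    by (intro L2_add L2_scaleR L2_linear H high[OF f])
  then have weak: "(\<lambda>t. wt t ^ Suc n *\<^sub>R nderiv (2 * n + 1) f t) \<in> L2"
  proof (rule L2_cong)
    fix t assume t: "t \<in> I11"
    have "nderiv (2 * n + 1) f t = inverse (wt t) *\<^sub>R (H ?m t + (2 * (2 * real n) * t) *\<^sub>R nderiv (2 * n) f t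
        + (real ?m * (2 * real n)) *\<^sub>R nderiv ?m f t)"
      using solve_legendre_jet[OF jet[OF t] t] unfolding m H_def .
    then have "wt t ^ Suc n *\<^sub>R nderiv (2 * n + 1) f t = wt t ^ n *\<^sub>R (H ?m t + (2 * (2 * real n) * t) *\<^sub>R nderiv (2 * n) f t
        + (real ?m * (2 * real n)) *\<^sub>R nderiv ?m f t)" using wt_nonzero t by simp
    then show "wt t ^ n *\<^sub>R H ?m t + (2 * (2 * real n) * t) *\<^sub>R (wt t ^ n *\<^sub>R nderiv (2 * n) f t)
     + (real ?m * (2 * real n)) *\<^sub>R (wt t ^ n *\<^sub>R nderiv ?m f t) = wt t ^ Suc n *\<^sub>R nderiv (2 * n + 1) f t"
      by (simp only: scaleR_add_right scaleR_scaleR mult.commute)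
  qed
  have fae: "AE t in lebesgue_on I11. (nderiv (2 * n + 1) f has_vector_derivative nderiv (2 * n + 2) f t) (at t)"
    using AC_loc_order_derivative_ae[OF o order_refl] by simp
  have "AE t in lebesgue_on I11. (nderiv ?m g has_vector_derivative nderiv (2 * n) g t) (at t)"
    using AC_loc_order_derivative_ae[OF go order_refl] m(3) by simp
  with fae have top: "AE t in lebesgue_on I11. legendre_jet f (2 * n) t = H (2 * n) t"
    using AE_space
  proof eventually_elim
    case (elim t)
    then have t: "t \<in> I11" by simp
    have d0: "(nderiv ?m f has_vector_derivative nderiv (?m + 1) f t) (at t)"
      and d1: "(nderiv (?m + 1) f has_vector_derivative nderiv (?m + 2) f t) (at t)"
      and d2: "(nderiv (?m + 2) f has_vector_derivative nderiv (?m + 3) f t) (at t)"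
    proof -
      show "(nderiv ?m f has_vector_derivative nderiv (?m + 1) f t) (at t)"
        using AC_loc_order_derivative[OF o _ t, of ?m] by simp
      show "(nderiv (?m + 1) f has_vector_derivative nderiv (?m + 2) f t) (at t)"
        using AC_loc_order_derivative[OF o _ t, of "2 * n"] m by simp
      have "?m + 3 = 2 * n + 2" using n by simp
      then show "(nderiv (?m + 2) f has_vector_derivative nderiv (?m + 3) f t) (at t)" using elim m by simp
    qed
    have "((\<lambda>t. k *\<^sub>R nderiv ?m f t - nderiv ?m g t) has_vector_derivative
        (k *\<^sub>R nderiv (?m + 1) f t + 0 *\<^sub>R nderiv ?m f t) - nderiv (2 * n) g t) (at t)"
      by (intro has_vector_derivative_diff has_vector_derivative_scaleR DERIV_const d0 elim)
    then have "(legendre_jet f ?m has_vector_derivative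
        (k *\<^sub>R nderiv (?m + 1) f t + 0 *\<^sub>R nderiv ?m f t) - nderiv (2 * n) g t) (at t)"
      by (rule has_vector_derivative_cong_I11[OF _ t]) (rule jet[symmetric])
    from vector_derivative_unique_at[OF this legendre_jet_derivative[OF d0 d1 d2]]
    show ?case using m by (simp add: H_def)
  qed
  define N where "N = 2 * n + 1"
  define u where "u t = wt t ^ n *\<^sub>R (H (2 * n) t + (real (2 * n) * (real (2 * n) + 1)) *\<^sub>R nderiv (2 * n) f t)" for t
  let ?v = "\<lambda>t. wt t ^ N *\<^sub>R nderiv N f t"
  have u: "u \<in> L2"
    using L2_add[OF H(1) L2_scaleR[OF high(1)[OF f], of "real (2 * n) * (real (2 * n) + 1)"]]
    by (simp add: u_def[abs_def] scaleR_add_right mult.commute)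
  have v: "?v \<in> AC_loc" by (intro AC_loc_wt_power AC_loc_order_AC_loc[OF o]) (simp add: N_def)
  have der: "AE t in lebesgue_on I11. (?v has_vector_derivative wt t ^ n *\<^sub>R u t) (at t)"
    using fae top
  proof eventually_elim
    case (elim t)
    have eq: "(p ^ n * p ^ n * p) *\<^sub>R a + (x * (p ^ n * p ^ n) * (- 2 * t)) *\<^sub>R b = p ^ n *\<^sub>R p ^ n *\<^sub>R (h + y *\<^sub>R c)"
      if "p *\<^sub>R a - (2 * x * t) *\<^sub>R b - y *\<^sub>R c = h" for p x y :: real and a b c h :: complex
      unfolding that[symmetric] by (simp add: scaleR_conv_of_real algebra_simps)
    have "(?v has_vector_derivative wt t ^ N *\<^sub>R nderiv (2 * n + 2) f t + (real N * wt t ^ (N - 1) * (- 2 * t)) *\<^sub>R nderiv N f t) (at t)"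
      using elim(1) by (intro has_vector_derivative_scaleR wt_power_derivative) (simp add: N_def)
    also have "wt t ^ N *\<^sub>R nderiv (2 * n + 2) f t + (real N * wt t ^ (N - 1) * (- 2 * t)) *\<^sub>R nderiv N f t = wt t ^ n *\<^sub>R u t"
    proof -
      have pN: "wt t ^ N = wt t ^ n * wt t ^ n * wt t" "wt t ^ (N - 1) = wt t ^ n * wt t ^ n"
        by (simp_all add: N_def mult_2 power_add)
      have "wt t *\<^sub>R nderiv (2 * n + 2) f t - (2 * real N * t) *\<^sub>R nderiv N f t
          - (real (2 * n) * (real (2 * n) + 1)) *\<^sub>R nderiv (2 * n) f t = H (2 * n) t"
        using elim(2) unfolding legendre_jet_def N_def by (simp add: add.commute)
      from eq[OF this] show ?thesis unfolding pN u_def .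
    qed
    finally show ?case .
  qed
  have "(\<lambda>t. wt t ^ (n - 1) *\<^sub>R (wt t ^ Suc n *\<^sub>R nderiv N f t)) \<in> L2"
    by (rule L2_wt_power) (use weak in \<open>simp add: N_def\<close>)
  then have vp: "(\<lambda>t. inverse (wt t) *\<^sub>R ?v t) \<in> L2"
  proof (rule L2_cong)
    fix t assume "t \<in> I11"
    then have p: "wt t \<noteq> 0" using wt_nonzero by blast
    have "N = Suc ((n - 1) + Suc n)" using n by (simp add: N_def)
    then have "inverse (wt t) * wt t ^ N = wt t ^ (n - 1) * wt t ^ Suc n"
      using p by (simp only: power_Suc power_add) simp
    then show "wt t ^ (n - 1) *\<^sub>R (wt t ^ Suc n *\<^sub>R nderiv N f t) = inverse (wt t) *\<^sub>R ?v t"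
      by (simp only: scaleR_scaleR)
  qed
  have "(\<lambda>t. inverse (wt t) ^ Suc n *\<^sub>R ?v t) \<in> L2"
    by (rule Hardy_divide_weight[OF v der u limits_zero_at_endpoints[OF v der L2_wt_power[OF u] vp]])
  then have strong: "(\<lambda>t. wt t ^ n *\<^sub>R nderiv (2 * n + 1) f t) \<in> L2"
  proof (rule L2_cong)
    fix t assume "t \<in> I11"
    then have p: "wt t \<noteq> 0" using wt_nonzero by blast
    have "N = Suc n + n" by (simp add: N_def)
    then have "inverse (wt t) ^ Suc n * wt t ^ N = (inverse (wt t) * wt t) ^ Suc n * wt t ^ n"
      by (simp only: power_add power_mult_distrib mult.assoc)
    then have "inverse (wt t) ^ Suc n * wt t ^ N = wt t ^ n" using p by simp
    then show "inverse (wt t) ^ Suc n *\<^sub>R ?v t = wt t ^ n *\<^sub>R nderiv (2 * n + 1) f t"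
      by (simp only: scaleR_scaleR N_def)
  qed
  have "(\<lambda>t. wt t ^ n *\<^sub>R H (2 * n) t + (2 * (real (2 * n) + 1) * t) *\<^sub>R (wt t ^ n *\<^sub>R nderiv (2 * n + 1) f t)
     + (real (2 * n) * (real (2 * n) + 1)) *\<^sub>R (wt t ^ n *\<^sub>R nderiv (2 * n) f t)) \<in> L2"
    by (intro L2_add L2_scaleR L2_linear H strong high[OF f])
  then have "(\<lambda>t. wt t ^ Suc n *\<^sub>R nderiv (2 * n + 2) f t) \<in> L2"
  proof (rule L2_AE)
    show "AE t in lebesgue_on I11. wt t ^ n *\<^sub>R H (2 * n) t + (2 * (real (2 * n) + 1) * t) *\<^sub>R (wt t ^ n *\<^sub>R nderiv (2 * n + 1) f t)
     + (real (2 * n) * (real (2 * n) + 1)) *\<^sub>R (wt t ^ n *\<^sub>R nderiv (2 * n) f t) = wt t ^ Suc n *\<^sub>R nderiv (2 * n + 2) f t"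
      using top
    proof eventually_elim
      case (elim t)
      have "q *\<^sub>R h + x *\<^sub>R (q *\<^sub>R b) + y *\<^sub>R (q *\<^sub>R c) = (p * q) *\<^sub>R a"
        if "p *\<^sub>R a - x *\<^sub>R b - y *\<^sub>R c = h" for p q x y :: real and a b c h :: complex
        unfolding that[symmetric] by (simp add: scaleR_conv_of_real algebra_simps)
      from this[OF elim[unfolded legendre_jet_def]] show ?case unfolding power_Suc .
    qed
  qed
  then show ?thesis using o by (simp add: weighted_sobolev_def)
qed

section \<open>The domains of the powers and sharpness\<close>

lemma legendre_power_dom_Suc:
  "f \<in> legendre_power_dom k (Suc n) \<longleftrightarrow>
     f \<in> legendre_dom k \<and> (\<exists>g\<in>legendre_power_dom k n. g \<in> L2 \<and> (AE t in lebesgue_on I11. g t = legendre_expr k f t))"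
proof
  assume "f \<in> legendre_power_dom k (Suc n)"
  then obtain h where "(f, h) \<in> legendre_op k ^^ Suc n" by (auto simp: legendre_power_dom_def)
  then obtain g where "(f, g) \<in> legendre_op k" "(g, h) \<in> legendre_op k ^^ n" by (meson relpow_Suc_D2)
  then show "f \<in> legendre_dom k \<and> (\<exists>g\<in>legendre_power_dom k n. g \<in> L2 \<and> (AE t in lebesgue_on I11. g t = legendre_expr k f t))"
    by (auto simp: legendre_power_dom_def legendre_op_def)
next
  assume "f \<in> legendre_dom k \<and> (\<exists>g\<in>legendre_power_dom k n. g \<in> L2 \<and> (AE t in lebesgue_on I11. g t = legendre_expr k f t))"
  then obtain g h where "(f, g) \<in> legendre_op k" "(g, h) \<in> legendre_op k ^^ n"
    by (auto simp: legendre_power_dom_def legendre_op_def)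
  then have "(f, h) \<in> legendre_op k ^^ Suc n" by (rule relpow_Suc_I2)
  then show "f \<in> legendre_power_dom k (Suc n)" by (auto simp: legendre_power_dom_def)
qed

lemma legendre_power_dom_mono: "f \<in> legendre_power_dom k (Suc n) \<Longrightarrow> f \<in> legendre_power_dom k n"
  unfolding legendre_power_dom_def by auto

text \<open>In the inductive step \<open>f\<close> itself lies in the domain of the smaller power, so the induction
  hypothesis describes both \<open>f\<close> and its image.\<close>

theorem legendre_power_dom_eq: "legendre_power_dom k (Suc n) = weighted_sobolev (Suc n)"
proof (induction n)
  case 0
  have "legendre_power_dom k 0 = UNIV" by (auto simp: legendre_power_dom_def)
  then have "f \<in> legendre_power_dom k (Suc 0) \<longleftrightarrow> f \<in> legendre_dom k" for f
    unfolding legendre_power_dom_Suc by (auto simp: legendre_dom_def)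
  then show ?case
    using legendre_dom_in_weighted_sobolev weighted_sobolev_in_dom[of _ 1] by auto
next
  case (Suc n)
  show ?case
  proof (intro set_eqI iffI)
    fix f assume f: "f \<in> legendre_power_dom k (Suc (Suc n))"
    then obtain g where g: "g \<in> legendre_power_dom k (Suc n)" "AE t in lebesgue_on I11. g t = legendre_expr k f t"
      unfolding legendre_power_dom_Suc[of f k "Suc n"] by blast
    have "f \<in> weighted_sobolev (Suc n)" "g \<in> weighted_sobolev (Suc n)"
      using legendre_power_dom_mono[OF f] g(1) unfolding Suc.IH by auto
    then show "f \<in> weighted_sobolev (Suc (Suc n))"
      by (rule weighted_sobolev_SucI[OF _ _ _ g(2)]) simp
  next
    fix f assume f: "f \<in> weighted_sobolev (Suc (Suc n))"
    then have dom: "f \<in> legendre_dom k" by (rule weighted_sobolev_in_dom) simp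
    have "legendre_expr k f \<in> legendre_power_dom k (Suc n)"
      unfolding Suc.IH by (rule weighted_sobolev_legendre_expr[OF f]) simp
    then show "f \<in> legendre_power_dom k (Suc (Suc n))"
      unfolding legendre_power_dom_Suc[of f k "Suc n"] using dom by (auto simp: legendre_dom_def)
  qed
qed

text \<open>For \<open>(1 - t)\<close> to the power \<open>a = n + 1/4\<close>, the function \<open>p\<^sup>n f\<^bsub>2n\<^esub>\<close> has the size of the bounded function
  \<open>(1 - t)\<close> to the power \<open>1/4\<close>, while \<open>f\<^bsub>n+1\<^esub>\<close> has the size of \<open>(1 - t)\<close> to the power \<open>-3/4\<close>. As \<open>a\<close> is not an
  integer, no derivative vanishes identically.\<close>

lemma weighted_sobolev_sharp:
  assumes n: "n \<ge> 1"
  shows "\<exists>g\<in>weighted_sobolev n. nderiv (n + 1) g \<notin> L2"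
proof -
  define a where "a = real n + 1 / 4"
  \<comment> \<open>\<open>G j\<close> is the derivative of order \<open>j\<close> of \<open>(1 - t)\<close> to the power \<open>a\<close>.\<close>
  define c where "c j = (\<Prod>i<j. - (a - real i))" for j :: nat
  define G where "G j t = complex_of_real (c j * (1 - t) powr (a - real j))" for j t
  have der: "(G j has_vector_derivative G (Suc j) t) (at t)" if "t \<in> I11" for j t
  proof -
    have "((\<lambda>t. c j * (1 - t) powr (a - real j)) has_real_derivative c (Suc j) * (1 - t) powr (a - real (Suc j))) (at t)"
      using that by (auto intro!: derivative_eq_intros simp: c_def algebra_simps)
    then show ?thesis unfolding G_def[abs_def]
      by (rule has_vector_derivative_of_real)
  qed
  have cont: "continuous_on I11 (G j)" for j
    using der[of _ j] by (intro continuous_at_imp_continuous_on ballI) (rule has_vector_derivative_continuous)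
  have AC: "G j \<in> AC_loc" for j by (rule AC_loc_C1[OF der cont])
  have jets: "f \<in> AC_loc_order m \<and> (\<forall>t\<in>I11. nderiv m f t = G m t)" if "f = G 0" for m f
    using AC_loc_order_jet(1,2)[of G f m] that der AC AE_I11_I[OF der] by auto
  let ?g = "G 0"
  have "(\<lambda>t. wt t ^ n *\<^sub>R G (2 * n) t) \<in> L2"
  proof (rule L2_bounded)
    show "continuous_on I11 (\<lambda>t. wt t ^ n *\<^sub>R G (2 * n) t)" by (intro continuous_intros cont)
    fix t assume t: "t \<in> I11"
    have s: "0 < 1 - t" "0 < 1 + t" "1 + t \<le> 2" "1 - t \<le> 2" using t by auto
    have "wt t ^ n = (1 + t) ^ n * (1 - t) powr real n"
      using s by (simp add: powr_realpow power_mult_distrib[symmetric] power2_eq_square algebra_simps)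
    then have "cmod (wt t ^ n *\<^sub>R G (2 * n) t) = \<bar>c (2 * n)\<bar> * ((1 + t) ^ n * ((1 - t) powr real n * (1 - t) powr (a - real (2 * n))))"
      using s by (simp add: G_def abs_mult norm_mult)
    also have "(1 - t) powr real n * (1 - t) powr (a - real (2 * n)) = (1 - t) powr (1 / 4)"
      unfolding powr_add[symmetric] by (simp add: a_def)
    also have "\<bar>c (2 * n)\<bar> * ((1 + t) ^ n * (1 - t) powr (1 / 4)) \<le> \<bar>c (2 * n)\<bar> * (2 ^ n * 2 powr (1 / 4))"
      using s by (intro mult_left_mono mult_mono power_mono powr_mono2) auto
    finally show "cmod (wt t ^ n *\<^sub>R G (2 * n) t) \<le> \<bar>c (2 * n)\<bar> * (2 ^ n * 2 powr (1 / 4))" .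
  qed
  then have "(\<lambda>t. wt t ^ n *\<^sub>R nderiv (2 * n) ?g t) \<in> L2"
    by (rule L2_cong) (use jets[OF refl] in simp)
  then have g: "?g \<in> weighted_sobolev n" using jets[OF refl] by (simp add: weighted_sobolev_def)
  have "nderiv (n + 1) ?g \<notin> L2"
  proof
    assume "nderiv (n + 1) ?g \<in> L2"
    then have L2: "G (n + 1) \<in> L2" by (rule L2_cong) (use jets[OF refl] in simp)
    \<comment> \<open>A vanishing factor would make \<open>4n + 1\<close> divisible by 4.\<close>
    have "c (n + 1) \<noteq> 0" unfolding c_def a_def
    proof (subst prod_zero_iff, simp, safe)
      fix i :: nat assume "i < n + 1" "- (real n + 1 / 4 - real i) = 0"
      then have "4 * real i = 4 * real n + 1" by simp
      then have "real (4 * i) = real (4 * n + 1)" by simp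
      then have "4 * i = 4 * n + 1" using of_nat_eq_iff by blast
      then show False by presburger
    qed
    then have cpos: "0 < (c (n + 1))\<^sup>2" by simp
    show False
    proof (rule not_L2_if_large_near_endpoint[OF L2 cpos zero_less_one])
      fix r :: real assume r: "0 < r" "r < 1"
      show "\<exists>x y. -1 < x \<and> y < 1 \<and> y - x = r / 2 \<and> (\<forall>t\<in>{x..y}. (c (n + 1))\<^sup>2 / (r * sqrt r) \<le> (cmod (G (n + 1) t))\<^sup>2)"
      proof (intro exI conjI ballI)
        fix t assume t: "t \<in> {1 - r..1 - r / 2}"
        define s where "s = 1 - t"
        have s: "0 < s" "s \<le> r" using t r by (auto simp: s_def)
        have "(c (n + 1))\<^sup>2 / (r * sqrt r) \<le> (c (n + 1))\<^sup>2 / (s * sqrt s)"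
          using s r by (intro divide_left_mono mult_mono) auto
        also have "\<dots> = (c (n + 1))\<^sup>2 * (s powr (- (3 / 4)))\<^sup>2"
        proof -
          have "(s powr (- (3 / 4)))\<^sup>2 = s powr (- (3 / 4) + - (3 / 4))"
            unfolding power2_eq_square powr_add ..
          also have "\<dots> = inverse (s powr (1 + 1 / 2))" by (simp add: powr_minus)
          also have "s powr (1 + 1 / 2) = s * sqrt s" using s by (simp only: powr_add powr_half_sqrt powr_one less_imp_le)
          finally show ?thesis by (simp only: divide_inverse)
        qed
        also have "\<dots> = (cmod (G (n + 1) t))\<^sup>2"
          by (simp add: G_def a_def s_def norm_mult power_mult_distrib)
        finally show "(c (n + 1))\<^sup>2 / (r * sqrt r) \<le> (cmod (G (n + 1) t))\<^sup>2" .
      qed (use r in auto)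
    qed
  qed
  then show ?thesis using g by blast
qed

theorem theorem9p2:
  fixes k :: real and n :: nat
  assumes "k \<ge> 0" and "n \<ge> 1"
  shows "legendre_power_dom k n =
           {f. f \<in> AC_loc_order (2 * n - 1) \<and> (\<lambda>t. (1 - t\<^sup>2) ^ n *\<^sub>R nderiv (2 * n) f t) \<in> L2}
       \<and> (\<forall>f \<in> legendre_power_dom k n. nderiv n f \<in> L2)
       \<and> (\<forall>f \<in> legendre_power_dom k n. \<forall>j<n. nderiv j f \<in> AC_closed)
       \<and> (\<exists>g \<in> legendre_power_dom k n. nderiv (n + 1) g \<notin> L2)"
proof -
  have dom: "legendre_power_dom k n = weighted_sobolev n"
    using legendre_power_dom_eq[of k "n - 1"] \<open>n \<ge> 1\<close> by simp
  show ?thesis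
    unfolding dom
  proof (intro conjI ballI allI impI)
    show "weighted_sobolev n = {f. f \<in> AC_loc_order (2 * n - 1) \<and> (\<lambda>t. (1 - t\<^sup>2) ^ n *\<^sub>R nderiv (2 * n) f t) \<in> L2}"
      by (rule weighted_sobolev_def)
    show "nderiv n f \<in> L2" if "f \<in> weighted_sobolev n" for f
      by (rule weighted_sobolev_low[OF that \<open>n \<ge> 1\<close> order_refl])
    show "nderiv j f \<in> AC_closed" if "f \<in> weighted_sobolev n" "j < n" for f j
      by (rule weighted_sobolev_AC_closed[OF that])
    show "\<exists>g\<in>weighted_sobolev n. nderiv (n + 1) g \<notin> L2"
      by (rule weighted_sobolev_sharp[OF \<open>n \<ge> 1\<close>])
  qed
qed

end
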